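(* Let $0<s<1$ and $a=1-2s$. Let $Q,B$ be real constant $N\times N$ matrices with $Q=Q^\star\ge 0$, let $\mathscr K u=\operatorname{tr}(Q\nabla^2u)+\langle BX,\nabla u\rangle-\partial_t u$, and assume $K(t)>0$ for every $t>0$ and $\operatorname{tr}B\ge0$. Let $u\in\mathscr S(\mathbb R^{N+1})$ and, for $(X,t)\in\mathbb R^{N+1}$, $z>0$, set $$U(X,t,z)=\int_0^\infty\int_{\mathbb R^N}P^{(a)}_z(X,Y,\tau)\,u(Y,t-\tau)\,dY\,d\tau .$$ Then $U\in C^\infty(\mathbb R^{N+1}\times(0,\infty))$, $\mathscr K_aU=0$ in $\mathbb R^{N+1}\times(0,\infty)$, and for every $1\le p<\infty$ $$\lim_{z\to0^+}\|U(\cdot,\cdot,z)-u\|_{L^p(\mathbb R^{N+1})}=0 .$$ Furthermore, for every $1\le p<\infty$, with the limit taken in $L^p(\mathbb R^{N+1})$, $$-\frac{2^{-a}\,\Gamma\left(\frac{1-a}{2}\right)}{\Gamma\left(\frac{1+a}{2}\right)}\lim_{z\to0^+}z^a\partial_zU(\cdot,\cdot,z)=(-\mathscr K)^su .$$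
   Context: Points of $\mathbb R^{N+1}$ are written $(X,t)$ with $X\in\mathbb R^N$, $t\in\mathbb R$; $\star$ denotes transpose; $\mathscr S(\mathbb R^{N+1})$ is the Schwartz space; $\nabla,\nabla^2$ are the gradient and Hessian in $X$. Set $\mathscr A u=\operatorname{tr}(Q\nabla^2u)+\langle BX,\nabla u\rangle$, so $\mathscr K=\mathscr A-\partial_t$. For $t>0$, $$K(t)=\frac1t\int_0^te^{\sigma B}Qe^{\sigma B^\star}d\sigma,$$ and $$p(X,Y,t)=(4\pi)^{-N/2}\big(\det(tK(t))\big)^{-1/2}\exp\Big(-\frac{\langle K(t)^{-1}(Y-e^{tB}X),\,Y-e^{tB}X\rangle}{4t}\Big).$$ The evolutive semigroup is $P^{\mathscr K}_\tau u(X,t)=\int_{\mathbb R^N}p(X,Y,\tau)u(Y,t-\tau)\,dY$, $\tau>0$. For $0<s<1$ and $u\in\mathscr S(\mathbb R^{N+1})$, $$(-\mathscr K)^su(X,t)=-\frac{s}{\Gamma(1-s)}\int_0^\infty\tau^{-1-s}\big[P^{\mathscr K}_\tau u(X,t)-u(X,t)\big]d\tau$$ (a convergent integral). For $a\in(-1,1)$ the Bessel operator is $\mathscr B^{(a)}_z=\partial_z^2+\frac az\partial_z$ on $z>0$, the extension operator is $\mathscr K_a=z^a(\mathscr A+\mathscr B^{(a)}_z-\partial_t)$ on $\mathbb R^{N+1}\times(0,\infty)$, and the Poisson kernel is, for $X,Y\in\mathbb R^N$, $t>0$, $z>0$, $$P^{(a)}_z(X,Y,t)=\frac{1}{2^{1-a}\Gamma\left(\frac{1-a}{2}\right)}\,\frac{z^{1-a}}{t^{\frac{3-a}{2}}}\,e^{-\frac{z^2}{4t}}\,p(X,Y,t).$$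 *)

theory Defs
  imports "HOL-Analysis.Analysis"
begin

section \<open>Smooth functions and the Schwartz space\<close>

primrec iter_deriv ::
  "'a::real_normed_vector list \<Rightarrow> ('a \<Rightarrow> 'b::real_normed_vector) \<Rightarrow> 'a \<Rightarrow> 'b" where
  "iter_deriv [] f = f"
| "iter_deriv (v # vs) f = (\<lambda>x. frechet_derivative (iter_deriv vs f) (at x) v)"

text \<open>The class \<open>C\<^sup>\<infinity>(S)\<close>, meant for open \<open>S\<close>: every iterated partial derivative is
  differentiable (hence continuous) at every point of \<open>S\<close>.  The derivatives are not relative
  to \<open>S\<close>, but for open \<open>S\<close> they depend on the values of the function in \<open>S\<close> only.\<close>

definition smooth_on :: "'a::euclidean_space set \<Rightarrow> ('a \<Rightarrow> 'b::real_normed_vector) \<Rightarrow> bool" where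
  "smooth_on S f \<longleftrightarrow> (\<forall>vs \<in> lists Basis. \<forall>x\<in>S. iter_deriv vs f differentiable (at x))"

definition schwartz :: "('a::euclidean_space \<Rightarrow> real) set" where
  "schwartz = {u. smooth_on UNIV u \<and>
     (\<forall>vs \<in> lists Basis. \<forall>k. \<exists>C. \<forall>x. norm x ^ k * \<bar>iter_deriv vs u x\<bar> \<le> C)}"

section \<open>The spaces \<open>L\<^sup>p\<close>\<close>

text \<open>The norm is extended-valued, so that functions outside \<open>L\<^sup>p\<close> have norm \<open>\<infinity>\<close>.\<close>

definition Lp_norm :: "real \<Rightarrow> ('a::euclidean_space \<Rightarrow> real) \<Rightarrow> ennreal" where
  "Lp_norm p f =
     (let I = (\<integral>\<^sup>+ x. ennreal (\<bar>f x\<bar> powr p) \<partial>lborel)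
      in if I = \<infinity> then \<infinity> else ennreal (enn2real I powr (1 / p)))"

definition Lp_space :: "real \<Rightarrow> ('a::euclidean_space \<Rightarrow> real) set" where
  "Lp_space p = {f \<in> borel_measurable lborel. Lp_norm p f < \<infinity>}"

definition Lp_tendsto ::
  "real \<Rightarrow> ('i \<Rightarrow> 'a::euclidean_space \<Rightarrow> real) \<Rightarrow> ('a \<Rightarrow> real) \<Rightarrow> 'i filter \<Rightarrow> bool" where
  "Lp_tendsto p f l F \<longleftrightarrow>
     (\<forall>\<^sub>F i in F. f i \<in> Lp_space p) \<and> l \<in> Lp_space p \<and>
     ((\<lambda>i. Lp_norm p (\<lambda>x. f i x - l x)) \<longlongrightarrow> 0) F"

section \<open>Matrices\<close>

text \<open>The type \<open>real^'n^'n\<close> multiplies componentwise with \<open>*\<close>, so \<open>^\<close> and \<open>exp\<close> are not the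
  matrix power and the matrix exponential.\<close>

primrec matrix_power :: "real^'n^'n \<Rightarrow> nat \<Rightarrow> real^'n^'n" where
  "matrix_power A 0 = mat 1"
| "matrix_power A (Suc k) = A ** matrix_power A k"

definition matrix_exp :: "real^'n^'n \<Rightarrow> real^'n^'n" where
  "matrix_exp A = (\<Sum>k. matrix_power A k /\<^sub>R fact k)"

definition pos_semidef :: "real^'n^'n \<Rightarrow> bool" where
  "pos_semidef A \<longleftrightarrow> (\<forall>x. (A *v x) \<bullet> x \<ge> 0)"

definition pos_def :: "real^'n^'n \<Rightarrow> bool" where
  "pos_def A \<longleftrightarrow> (\<forall>x. x \<noteq> 0 \<longrightarrow> (A *v x) \<bullet> x > 0)"

section \<open>The Kolmogorov operator, its semigroup and its fractional powers\<close>

definition grad :: "(real^'n \<Rightarrow> real) \<Rightarrow> real^'n \<Rightarrow> real^'n" where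
  "grad f X = (\<chi> i. iter_deriv [axis i 1] f X)"

definition hessian :: "(real^'n \<Rightarrow> real) \<Rightarrow> real^'n \<Rightarrow> real^'n^'n" where
  "hessian f X = (\<chi> i j. iter_deriv [axis i 1, axis j 1] f X)"

definition A_op :: "real^'n^'n \<Rightarrow> real^'n^'n \<Rightarrow> (real^'n \<Rightarrow> real) \<Rightarrow> real^'n \<Rightarrow> real" where
  "A_op Q B f X = trace (Q ** hessian f X) + (B *v X) \<bullet> grad f X"

definition K_mat :: "real^'n^'n \<Rightarrow> real^'n^'n \<Rightarrow> real \<Rightarrow> real^'n^'n" where
  "K_mat Q B t =
     (1 / t) *\<^sub>R (LBINT \<sigma>:{0..t}. matrix_exp (\<sigma> *\<^sub>R B) ** Q ** matrix_exp (\<sigma> *\<^sub>R transpose B))"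

definition kol_kernel ::
  "real^'n^'n \<Rightarrow> real^'n^'n \<Rightarrow> real^'n \<Rightarrow> real^'n \<Rightarrow> real \<Rightarrow> real" where
  "kol_kernel Q B X Y t =
     (4 * pi) powr (- real CARD('n) / 2) * det (t *\<^sub>R K_mat Q B t) powr (- 1 / 2) *
     (let v = Y - matrix_exp (t *\<^sub>R B) *v X
      in exp (- (((matrix_inv (K_mat Q B t) *v v) \<bullet> v) / (4 * t))))"

definition evol_semigroup ::
  "real^'n^'n \<Rightarrow> real^'n^'n \<Rightarrow> real \<Rightarrow> ((real^'n) \<times> real \<Rightarrow> real) \<Rightarrow> (real^'n) \<times> real \<Rightarrow> real" where
  "evol_semigroup Q B \<tau> u =
     (\<lambda>(X, t). LINT Y|lborel. kol_kernel Q B X Y \<tau> * u (Y, t - \<tau>))"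

text \<open>The operator \<open>(-K)\<^sup>s\<close>, where \<open>K = A_op Q B - \<partial>\<^sub>t\<close>, for \<open>0 < s < 1\<close>.\<close>

definition frac_power ::
  "real \<Rightarrow> real^'n^'n \<Rightarrow> real^'n^'n \<Rightarrow> ((real^'n) \<times> real \<Rightarrow> real) \<Rightarrow> (real^'n) \<times> real \<Rightarrow> real" where
  "frac_power s Q B u x =
     - (s / Gamma (1 - s)) *
       (LBINT \<tau>:{0<..}. \<tau> powr (- 1 - s) * (evol_semigroup Q B \<tau> u x - u x))"

section \<open>The extension problem\<close>

definition bessel_op :: "real \<Rightarrow> (real \<Rightarrow> real) \<Rightarrow> real \<Rightarrow> real" where
  "bessel_op a f z = deriv (deriv f) z + (a / z) * deriv f z"

definition ext_op ::
  "real \<Rightarrow> real^'n^'n \<Rightarrow> real^'n^'n \<Rightarrow>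
   (((real^'n) \<times> real) \<times> real \<Rightarrow> real) \<Rightarrow> ((real^'n) \<times> real) \<times> real \<Rightarrow> real" where
  "ext_op a Q B U = (\<lambda>((X, t), z).
     z powr a *
       (A_op Q B (\<lambda>Y. U ((Y, t), z)) X + bessel_op a (\<lambda>\<zeta>. U ((X, t), \<zeta>)) z
        - deriv (\<lambda>r. U ((X, r), z)) t))"

definition poisson_kernel ::
  "real \<Rightarrow> real^'n^'n \<Rightarrow> real^'n^'n \<Rightarrow> real \<Rightarrow> real^'n \<Rightarrow> real^'n \<Rightarrow> real \<Rightarrow> real" where
  "poisson_kernel a Q B z X Y t =
     1 / (2 powr (1 - a) * Gamma ((1 - a) / 2)) *
     (z powr (1 - a) / t powr ((3 - a) / 2)) * exp (- (z\<^sup>2 / (4 * t))) * kol_kernel Q B X Y t"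

end

theory Submission
  imports Defs "HOL-Probability.Probability"
begin

text \<open>In the variable \<open>Y\<close> the kernel \<open>p(X, Y, \<tau>)\<close> is a Gaussian of covariance
  \<open>cov \<tau> = \<tau> K(\<tau>)\<close> centred at \<open>flow \<tau> X = e\<^bsup>\<tau>B\<^esup> X\<close>.  With \<open>freq \<tau> \<xi> = e\<^bsup>\<tau>B\<^sup>\<star>\<^esup> \<xi>\<close> and
  \<open>covq \<tau> \<xi> = \<langle>cov \<tau> \<xi>, \<xi>\<rangle>\<close>, the partial Fourier transform \<open>v(\<xi>, r)\<close> of \<open>u\<close> in \<open>Y\<close> turns \<open>U\<close>
  into a superposition of the modes
  \<open>exp (- covq \<tau> \<xi> + i \<langle>freq \<tau> \<xi>, X\<rangle>) v(\<xi>, t - \<tau>)\<close> with weights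
  \<open>z\<^bsup>\<alpha>\<^esup> \<tau>\<^bsup>-\<beta>\<^esup> exp (- z\<^sup>2 / 4\<tau>)\<close>.  For \<open>z > 0\<close> such integrals converge absolutely and the class
  they span is closed under partial derivatives, so \<open>U\<close> is smooth.  The extension
  operator applied to the integrand is a total derivative in \<open>\<tau>\<close> that vanishes at \<open>0\<close> and at
  \<open>\<infinity>\<close>, hence the equation.

  For the limits, write \<open>P\<^sub>\<tau>\<close> for the semigroup.  The inequality \<open>tr B \<ge> 0\<close> makes it a
  contraction of \<open>L\<^sup>1\<close>, and Taylor expansion gives
  \<open>\<parallel>P\<^sub>\<tau> u - u\<parallel> \<le> C min (1, \<tau>)\<close> in \<open>L\<^sup>1\<close> and in \<open>L\<^sup>\<infinity>\<close>.  The weight of \<open>U\<close> has integral \<open>1\<close>, so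
  \<open>U - u\<close> is a weighted integral of the differences \<open>P\<^sub>\<tau> u - u\<close>; the same holds for the normal
  derivative, since the weight of \<open>\<partial>\<^sub>z U\<close> has integral \<open>0\<close>.  Bounding the weights by powers of \<open>z\<close>
  and \<open>\<tau>\<close> yields both limits with a rate, in every \<open>L\<^sup>p\<close> at once.\<close>

section \<open>Smoothness, Schwartz functions and differentiation under the integral\<close>

text \<open>Since \<open>Q\<close> may be degenerate, the Gaussian can have different small-time
  scales in different directions, and derivatives of \<open>p\<close> in \<open>X\<close> would have
  to follow them. On the Fourier side \<open>X\<close> occurs only in a phase of modulus 1: a
  derivative in \<open>X\<close> is a factor \<open>freq \<tau> \<xi>\<close>, and the only
  quantitative lower bound on the covariance is the one at time 1. Decay in \<open>\<tau>\<close> is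
  taken from the time variable of \<open>u\<close>. The rate \<open>\<tau>\<close>, rather than its
  square root, is essential at the boundary: near 0 the kernel \<open>\<tau> powr (- 1 - s)\<close>
  does not integrate the square root when \<open>s \<ge> 1 / 2\<close>. It is obtained by splitting
  \<open>P\<^sub>\<tau> u - u\<close> into transport along the flow and Gaussian averaging around
  the transported point. In the averaging, reflection of the Gaussian cancels the first-order Taylor
  terms. In the transport, the speed grows linearly with the point, because the drift has unbounded
  coefficients; one additional power of decay of \<open>u\<close> pays for it. A single number then
  bounds both the L1 norm and the supremum, and hence every \<open>L\<^sup>p\<close> norm.\<close>

lemma smooth_on_family:
  fixes W :: "('a::euclidean_space \<Rightarrow> 'b::real_normed_vector) set"
  assumes S: "open S" and f: "g \<in> W" "\<And>x. x \<in> S \<Longrightarrow> f x = g x"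
    and diff: "\<And>f x. f \<in> W \<Longrightarrow> x \<in> S \<Longrightarrow> f differentiable (at x)"
    and closed: "\<And>f b. f \<in> W \<Longrightarrow> b \<in> Basis \<Longrightarrow>
      \<exists>g\<in>W. \<forall>x\<in>S. frechet_derivative f (at x) b = g x"
  shows "smooth_on S f"
proof -
  \<comment> \<open>Every iterated derivative of \<open>f\<close> agrees on \<open>S\<close> with a
    member of \<open>W\<close>. The agreement survives the next derivative because \<open>S\<close>
    is open and a derivative depends only on nearby values.\<close>
  have *: "\<exists>g\<in>W. \<forall>x\<in>S. iter_deriv vs f x = g x" if "vs \<in> lists Basis" for vs
    using that
  proof (induction vs)
    case Nil
    then show ?case using f by auto
  next
    case (Cons b vs)
    then obtain g where g: "g \<in> W" "\<And>x. x \<in> S \<Longrightarrow> iter_deriv vs f x = g x" by auto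
    have "b \<in> Basis" using Cons by auto
    from closed[OF g(1) this] obtain h
      where h: "h \<in> W" "\<And>x. x \<in> S \<Longrightarrow> frechet_derivative g (at x) b = h x" by blast
    have "frechet_derivative (iter_deriv vs f) (at x) = frechet_derivative g (at x)" if "x \<in> S" for x
      using frechet_derivative_transform_within_open[OF diff[OF g(1) that] S that] g(2) by metis
    then show ?case using h by (intro bexI[of _ h]) auto
  qed
  show ?thesis
    unfolding smooth_on_def
  proof (intro ballI)
    fix vs :: "'a list" and x assume "vs \<in> lists Basis" "x \<in> S"
    then obtain g where g: "g \<in> W" "\<And>x. x \<in> S \<Longrightarrow> iter_deriv vs f x = g x" using * by blast
    have "(g has_derivative frechet_derivative g (at x)) (at x)"
      using diff[OF g(1) \<open>x \<in> S\<close>] by (simp add: frechet_derivative_works)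
    then have "(iter_deriv vs f has_derivative frechet_derivative g (at x)) (at x)"
      by (rule has_derivative_transform_within_open[OF _ S \<open>x \<in> S\<close>]) (simp add: g(2))
    then show "iter_deriv vs f differentiable (at x)" by (auto simp: differentiable_def)
  qed
qed

text \<open>Dominated convergence for difference quotients. The bound on \<open>f'\<close> has to
  become a Lipschitz bound with constant \<open>g w\<close>; this is the mean value inequality on a
  ball inside \<open>S\<close>, as \<open>S\<close> itself may fail to be convex.\<close>

lemma has_derivative_lebesgue_integral:
  fixes f :: "'a::euclidean_space \<Rightarrow> 'b \<Rightarrow> 'c::{banach,second_countable_topology}"
  assumes S: "open S" "x0 \<in> S"
    and int: "\<And>x. x \<in> S \<Longrightarrow> integrable M (f x)"
    and der: "\<And>x w. x \<in> S \<Longrightarrow> w \<in> space M \<Longrightarrow> ((\<lambda>x. f x w) has_derivative f' x w) (at x)"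
    and meas: "\<And>h. (\<lambda>w. f' x0 w h) \<in> borel_measurable M"
    and bound: "\<And>x w h. x \<in> S \<Longrightarrow> w \<in> space M \<Longrightarrow> norm (f' x w h) \<le> g w * norm h"
    and g: "integrable M g"
  shows "((\<lambda>x. LINT w|M. f x w) has_derivative (\<lambda>h. LINT w|M. f' x0 w h)) (at x0)"
proof -
  have lin: "bounded_linear (f' x w)" if "x \<in> S" "w \<in> space M" for x w
    using der[OF that] has_derivative_bounded_linear by blast
  have int': "integrable M (\<lambda>w. f' x0 w h)" for h
    by (rule Bochner_Integration.integrable_bound[OF integrable_mult_left[OF g, of "norm h"] meas])
       (auto intro!: AE_I2 order_trans[OF bound[OF S(2)]])
  obtain e where e: "e > 0" "ball x0 e \<subseteq> S" using S open_contains_ball by metis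
  have lip: "norm (f y w - f x0 w) \<le> g w * norm (y - x0)" if "y \<in> ball x0 e" "w \<in> space M" for y w
  proof (rule differentiable_bound[of "ball x0 e" "\<lambda>x. f x w" "\<lambda>x. f' x w"])
    fix x assume x: "x \<in> ball x0 e"
    then have "x \<in> S" using e by auto
    then show "((\<lambda>x. f x w) has_derivative f' x w) (at x within ball x0 e)"
      using der that by (blast intro: has_derivative_at_withinI)
    show "onorm (f' x w) \<le> g w"
      using bound[OF \<open>x \<in> S\<close> \<open>w \<in> space M\<close>] by (intro onorm_le) (auto simp: mult.commute)
  qed (use that e in auto)
  have blin: "bounded_linear (\<lambda>h. LINT w|M. f' x0 w h)"
  proof (rule bounded_linear_intro[where K = "LINT w|M. g w"])
    show "(LINT w|M. f' x0 w (x + y)) = (LINT w|M. f' x0 w x) + (LINT w|M. f' x0 w y)" for x y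
    proof -
      have "(LINT w|M. f' x0 w (x + y)) = (LINT w|M. f' x0 w x + f' x0 w y)"
        by (intro Bochner_Integration.integral_cong refl linear_add bounded_linear.linear lin S)
      then show ?thesis using int' by simp
    qed
    show "(LINT w|M. f' x0 w (r *\<^sub>R x)) = r *\<^sub>R (LINT w|M. f' x0 w x)" for r x
    proof -
      have "(LINT w|M. f' x0 w (r *\<^sub>R x)) = (LINT w|M. r *\<^sub>R f' x0 w x)"
        by (intro Bochner_Integration.integral_cong refl linear_cmul bounded_linear.linear lin S)
      then show ?thesis by simp
    qed
    show "norm (LINT w|M. f' x0 w x) \<le> norm x * (LINT w|M. g w)" for x
    proof -
      have "norm (LINT w|M. f' x0 w x) \<le> (LINT w|M. norm (f' x0 w x))" by (rule integral_norm_bound)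
      also have "\<dots> \<le> (LINT w|M. g w * norm x)"
        using int' g bound[OF S(2)] by (intro integral_mono) auto
      finally show ?thesis by (simp add: mult.commute)
    qed
  qed
  show ?thesis
    unfolding has_derivative_iff_norm
  proof (intro conjI blin)
    show "((\<lambda>y. norm ((LINT w|M. f y w) - (LINT w|M. f x0 w) - (LINT w|M. f' x0 w (y - x0))) / norm (y - x0)) \<longlongrightarrow> 0) (at x0)"
      unfolding tendsto_at_iff_sequentially comp_def
    proof (intro allI impI)
      fix X assume X: "\<forall>i. X i \<in> UNIV - {x0}" "X \<longlonglongrightarrow> x0"
      \<comment> \<open>From the index \<open>N\<close> on the sequence stays in the ball. All
        quotients are therefore shifted by \<open>N\<close>, and \<open>LIMSEQ_offset\<close> undoes
        the shift at the end.\<close>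
      then obtain N where N: "\<And>n. n \<ge> N \<Longrightarrow> X n \<in> ball x0 e"
        using e(1) by (metis (no_types, lifting) dist_commute lim_sequentially mem_ball)
      define r where "r n w = (1 / norm (X (n+N) - x0)) *\<^sub>R (f (X (n+N)) w - f x0 w - f' x0 w (X (n+N) - x0))" for n w
      have Xn: "norm (X n - x0) > 0" for n using X by auto
      have XS: "X (n+N) \<in> S" for n using N[of "n+N"] e by auto
      \<comment> \<open>In the majorant \<open>2 * g w\<close> one copy of \<open>g w\<close> comes
        from the Lipschitz bound and one from the derivative at \<open>x0\<close>.\<close>
      have "(\<lambda>n. LINT w|M. r n w) \<longlonglongrightarrow> (LINT w|M. 0)"
      proof (rule integral_dominated_convergence[where w = "\<lambda>w. 2 * g w"])
        show "r i \<in> borel_measurable M" for i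
          unfolding r_def using int[OF XS] int[OF S(2)] int' by (auto dest!: borel_measurable_integrable)
        show "AE x in M. (\<lambda>i. r i x) \<longlonglongrightarrow> 0"
        proof (rule AE_I2)
          fix w assume w: "w \<in> space M"
          have "((\<lambda>y. norm (f y w - f x0 w - f' x0 w (y - x0)) / norm (y - x0)) \<longlongrightarrow> 0) (at x0)"
            using der[OF S(2) w] unfolding has_derivative_iff_norm by auto
          from this[unfolded tendsto_at_iff_sequentially comp_def, rule_format, of "\<lambda>n. X (n+N)"]
          have "(\<lambda>n. norm (r n w)) \<longlonglongrightarrow> 0"
            using X LIMSEQ_ignore_initial_segment[OF X(2)] by (simp add: r_def divide_inverse mult.commute)
          then show "(\<lambda>i. r i w) \<longlonglongrightarrow> 0" by (rule tendsto_norm_zero_cancel)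
        qed
        show "AE x in M. norm (r i x) \<le> 2 * g x" for i
        proof (rule AE_I2)
          fix w assume w: "w \<in> space M"
          have "norm (f (X (i+N)) w - f x0 w - f' x0 w (X (i+N) - x0))
              \<le> g w * norm (X (i+N) - x0) + g w * norm (X (i+N) - x0)"
            using N w S by (intro order_trans[OF norm_triangle_ineq4] add_mono lip bound) auto
          then show "norm (r i w) \<le> 2 * g w"
            using Xn[of "i+N"] by (simp add: r_def divide_le_eq mult.commute algebra_simps del: scaleR_diff_right scaleR_right_diff_distrib)
        qed
      qed (use g in auto)
      then have "(\<lambda>n. norm (LINT w|M. r n w)) \<longlonglongrightarrow> 0" using tendsto_norm_zero by force
      moreover have "norm (LINT w|M. r n w) = norm ((LINT w|M. f (X (n+N)) w) - (LINT w|M. f x0 w) - (LINT w|M. f' x0 w (X (n+N) - x0))) / norm (X (n+N) - x0)" for n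
        unfolding r_def using int[OF XS, of n] int[OF S(2)] int' by simp
      ultimately have "(\<lambda>n. norm ((LINT w|M. f (X (n+N)) w) - (LINT w|M. f x0 w) - (LINT w|M. f' x0 w (X (n+N) - x0))) / norm (X (n+N) - x0)) \<longlonglongrightarrow> 0"
        by simp
      then show "(\<lambda>n. norm ((LINT w|M. f (X n) w) - (LINT w|M. f x0 w) - (LINT w|M. f' x0 w (X n - x0))) / norm (X n - x0)) \<longlonglongrightarrow> 0"
        by (rule LIMSEQ_offset)
    qed
  qed
qed

section \<open>Polynomial weights and the decay of Schwartz functions\<close>

text \<open>The square of the Japanese bracket. Because it grows quadratically,
  \<open>1 / jap x ^ DIM('a)\<close> is integrable, and on the line a single power is
  enough.\<close>

abbreviation jap :: "'a::real_normed_vector \<Rightarrow> real" where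
  "jap x \<equiv> 1 + (norm x)\<^sup>2"

lemma jap_ge_1: "1 \<le> jap x"
  by simp

lemma jap_pos [simp]: "0 < jap x"
  by (rule less_le_trans[OF zero_less_one jap_ge_1])

text \<open>Peetre's inequality: the weight passes from a point to its translate at the price of the
  weight of the shift.\<close>

lemma jap_add_le: "jap (x + y) \<le> 2 * jap x * jap y"
proof -
  have "norm (x + y) \<le> norm x + norm y" by (rule norm_triangle_ineq)
  then have "(norm (x + y))\<^sup>2 \<le> (norm x + norm y)\<^sup>2" by (intro power_mono) auto
  also have "\<dots> \<le> 2 * (norm x)\<^sup>2 + 2 * (norm y)\<^sup>2"
    using zero_le_power2[of "norm x - norm y"] unfolding power2_sum power2_diff by linarith
  finally have "jap (x + y) \<le> 2 + 2 * (norm x)\<^sup>2 + 2 * (norm y)\<^sup>2 + 2 * ((norm x)\<^sup>2 * (norm y)\<^sup>2)"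
    by (smt (verit) mult_nonneg_nonneg zero_le_power2)
  then show ?thesis by (simp add: algebra_simps)
qed

text \<open>\<open>jap x ^ DIM('a)\<close> dominates the product of the one-dimensional weights
  \<open>1 + (x \<bullet> b)\<^sup>2\<close>, and the reciprocals of these are integrable on the
  line.\<close>

lemma integrable_jap_power:
  assumes "DIM('a) \<le> M"
  shows "integrable lborel (\<lambda>x::'a::euclidean_space. 1 / jap x ^ M)"
proof -
  have 1: "integrable lborel (\<lambda>x::real. 1 / (1 + x\<^sup>2))"
  proof -
    have "integrable lborel (\<lambda>x::real. indicator {0<..} x *\<^sub>R (1 / (1 + x\<^sup>2)))"
      using integrable_I0i_1_div_plus_square by (simp add: interval_lebesgue_integrable_def set_integrable_def einterval_def inverse_eq_divide greaterThan_def)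
    note a = this
    have b: "integrable lborel (\<lambda>x::real. indicator {0<..} (-x) *\<^sub>R (1 / (1 + x\<^sup>2)))"
      using lborel_integrable_real_affine[OF a, of "-1" 0] by simp
    \<comment> \<open>The two open half-lines miss the origin, so their indicator functions add up
      to 1 only almost everywhere.\<close>
    have "AE x in lborel. x \<noteq> (0::real)" by (rule AE_lborel_singleton)
    then have c: "AE x::real in lborel. indicator {0<..} x *\<^sub>R (1 / (1 + x\<^sup>2)) + indicator {0<..} (-x) *\<^sub>R (1 / (1 + x\<^sup>2)) = 1 / (1 + x\<^sup>2)"
      by eventually_elim (auto simp: indicator_def)
    show ?thesis
      by (rule integrable_cong_AE_imp[OF Bochner_Integration.integrable_add[OF a b] _ c]) measurable
  qed
  have 2: "integrable lborel (\<lambda>x::'a. \<Prod>b\<in>Basis. 1 / (1 + (x \<bullet> b)\<^sup>2))"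
  proof (rule integrableI_bounded)
    have "(\<integral>\<^sup>+ x. ennreal (norm (\<Prod>b\<in>Basis. 1 / (1 + ((x::'a) \<bullet> b)\<^sup>2))) \<partial>lborel)
       = (\<integral>\<^sup>+ x. (\<Prod>b\<in>Basis. ennreal (1 / (1 + ((x::'a) \<bullet> b)\<^sup>2))) \<partial>lborel)"
      by (intro nn_integral_cong) (simp add: prod_ennreal prod_nonneg abs_prod)
    also have "\<dots> = (\<Prod>b\<in>(Basis::'a set). (\<integral>\<^sup>+ x. ennreal (1 / (1 + x\<^sup>2)) \<partial>lborel))"
      by (rule nn_integral_lborel_prod) auto
    also have "\<dots> < \<infinity>"
      using 1 by (simp add: integrable_iff_bounded power_less_top_ennreal)
    finally show "(\<integral>\<^sup>+ x. ennreal (norm (\<Prod>b\<in>Basis. 1 / (1 + ((x::'a) \<bullet> b)\<^sup>2))) \<partial>lborel) < \<infinity>" .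
  qed measurable
  show ?thesis
  proof (rule Bochner_Integration.integrable_bound[OF 2])
    show "AE x::'a in lborel. norm (1 / jap x ^ M) \<le> norm (\<Prod>b\<in>Basis. 1 / (1 + (x \<bullet> b)\<^sup>2))"
    proof (rule AE_I2)
      fix x :: 'a
      have "(\<Prod>b\<in>Basis. (1 + (x \<bullet> b)\<^sup>2)) \<le> (\<Prod>b\<in>(Basis::'a set). jap x)"
      proof (intro prod_mono conjI)
        fix b :: 'a assume "b \<in> Basis"
        then have "(x \<bullet> b)\<^sup>2 \<le> (norm x)\<^sup>2" using Basis_le_norm[of b x] by (metis abs_le_square_iff abs_norm_cancel)
        then show "1 + (x \<bullet> b)\<^sup>2 \<le> jap x" by simp
      qed (simp add: add_nonneg_nonneg)
      also have "\<dots> = jap x ^ DIM('a)" by simp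
      also have "\<dots> \<le> jap x ^ M" using assms by (intro power_increasing) (auto simp: jap_ge_1)
      finally have le: "(\<Prod>b\<in>Basis. (1 + (x \<bullet> b)\<^sup>2)) \<le> jap x ^ M" .
      have pos: "0 < (\<Prod>b\<in>Basis. (1 + (x \<bullet> b)\<^sup>2))" by (intro prod_pos) (simp add: add_pos_nonneg)
      have "1 / jap x ^ M \<le> 1 / (\<Prod>b\<in>Basis. (1 + (x \<bullet> b)\<^sup>2))"
        using le pos by (intro divide_left_mono) auto
      also have "\<dots> = (\<Prod>b\<in>Basis. 1 / (1 + (x \<bullet> b)\<^sup>2))" by (simp add: prod_dividef)
      finally show "norm (1 / jap x ^ M) \<le> norm (\<Prod>b\<in>Basis. 1 / (1 + (x \<bullet> b)\<^sup>2))"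
        by (simp add: less_imp_le)
    qed
  qed measurable
qed

lemma iter_deriv_append: "iter_deriv (vs @ ws) f = iter_deriv vs (iter_deriv ws f)"
  by (induction vs) auto

lemma schwartz_iter_deriv:
  assumes "u \<in> schwartz" "vs \<in> lists Basis"
  shows "iter_deriv vs u \<in> schwartz"
proof -
  have "ws @ vs \<in> lists Basis" if "ws \<in> lists Basis" for ws using that assms by simp
  then show ?thesis
    using assms(1) by (simp add: schwartz_def smooth_on_def flip: iter_deriv_append)
qed

text \<open>Two seminorms suffice: inside the unit ball \<open>jap x \<le> 2\<close>, outside it
  \<open>jap x \<le> 2 * (norm x)\<^sup>2\<close>, so the orders 0 and \<open>2 * M\<close> control
  the weight. The summand 1 in the constant makes it strictly positive.\<close>

lemma schwartz_bound:
  fixes u :: "'a::euclidean_space \<Rightarrow> real"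
  assumes "u \<in> schwartz"
  shows "\<exists>C>0. \<forall>x. \<bar>u x\<bar> \<le> C / jap x ^ M"
proof -
  have *: "\<exists>C. \<forall>x. norm x ^ k * \<bar>u x\<bar> \<le> C" for k
    using assms by (auto simp: schwartz_def dest!: bspec[where x = "[]"])
  obtain C0 where C0: "\<And>x. \<bar>u x\<bar> \<le> C0" using *[of 0] by auto
  obtain C1 where C1: "\<And>x. norm x ^ (2*M) * \<bar>u x\<bar> \<le> C1" using *[of "2*M"] by auto
  have nn: "0 \<le> C0" "0 \<le> C1"
    using order_trans[OF abs_ge_zero C0[of 0]] order_trans[OF mult_nonneg_nonneg C1[of 0]] by auto
  have "jap x ^ M * \<bar>u x\<bar> \<le> 2 ^ M * (C0 + C1) + 1" for x
  proof (cases "norm x \<le> 1")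
    case True
    then have "(norm x)\<^sup>2 \<le> 1" by (simp add: power_le_one)
    then have "jap x ^ M \<le> 2 ^ M" by (intro power_mono) auto
    then have "jap x ^ M * \<bar>u x\<bar> \<le> 2 ^ M * C0" using C0 nn by (intro mult_mono) auto
    moreover have "2 ^ M * C1 \<ge> 0" using nn by simp
    ultimately show ?thesis by (simp add: distrib_left)
  next
    case False
    then have "1 \<le> (norm x)\<^sup>2" by (simp add: one_le_power)
    then have "jap x ^ M \<le> (2 * (norm x)\<^sup>2) ^ M" by (intro power_mono) auto
    also have "\<dots> = 2 ^ M * norm x ^ (2 * M)" by (simp add: power_mult_distrib power_mult)
    finally have "jap x ^ M * \<bar>u x\<bar> \<le> 2 ^ M * (norm x ^ (2*M) * \<bar>u x\<bar>)"
      by (simp add: mult_right_mono mult.assoc[symmetric])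
    also have "\<dots> \<le> 2 ^ M * C1" using C1 by (intro mult_left_mono) auto
    finally show ?thesis using nn by (simp add: distrib_left) (smt (verit) mult_nonneg_nonneg zero_le_power)
  qed
  then have "\<bar>u x\<bar> \<le> (2 ^ M * (C0 + C1) + 1) / jap x ^ M" for x
    by (simp add: pos_le_divide_eq mult.commute)
  moreover have "2 ^ M * (C0 + C1) + 1 > 0"
    using nn by (intro add_nonneg_pos mult_nonneg_nonneg add_nonneg_nonneg) auto
  ultimately show ?thesis by blast
qed

lemma schwartz_has_derivative:
  assumes "u \<in> schwartz"
  shows "(u has_derivative (\<lambda>h. \<Sum>b\<in>Basis. (h \<bullet> b) * iter_deriv [b] u x)) (at x)"
proof -
  have d: "(u has_derivative frechet_derivative u (at x)) (at x)"
    using assms by (auto simp: schwartz_def smooth_on_def frechet_derivative_works dest!: bspec[where x = "[]"])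
  have "frechet_derivative u (at x) = (\<lambda>h. \<Sum>b\<in>Basis. (h \<bullet> b) * iter_deriv [b] u x)"
  proof (rule ext)
    fix h
    have l: "linear (frechet_derivative u (at x))" using d has_derivative_linear by blast
    have "frechet_derivative u (at x) h = frechet_derivative u (at x) (\<Sum>b\<in>Basis. (h \<bullet> b) *\<^sub>R b)"
      by (simp add: euclidean_representation)
    then show "frechet_derivative u (at x) h = (\<Sum>b\<in>Basis. (h \<bullet> b) * iter_deriv [b] u x)"
      by (simp add: linear_sum[OF l] linear_cmul[OF l])
  qed
  with d show ?thesis by (simp only:)
qed

lemma schwartz_continuous: "u \<in> schwartz \<Longrightarrow> continuous_on UNIV u"
  by (rule continuous_at_imp_continuous_on) (blast intro: has_derivative_continuous schwartz_has_derivative)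

lemma schwartz_measurable [measurable_dest]: "u \<in> schwartz \<Longrightarrow> u \<in> borel_measurable borel"
  by (intro borel_measurable_continuous_onI schwartz_continuous)

lemma schwartz_integrable:
  fixes u :: "'a::euclidean_space \<Rightarrow> real"
  assumes "u \<in> schwartz"
  shows "integrable lborel u"
proof -
  obtain C where C: "C > 0" "\<And>x. \<bar>u x\<bar> \<le> C / jap x ^ DIM('a)" using schwartz_bound[OF assms] by blast
  show ?thesis
    by (rule Bochner_Integration.integrable_bound[OF integrable_mult_right[OF integrable_jap_power[of "DIM('a)"], of C]])
      (use C schwartz_measurable[OF assms] in \<open>auto simp: less_imp_le\<close>)
qed

section \<open>Gaussian densities and linear changes of variables\<close>

lemma Basis_vec_axis: "(Basis :: (real^'n) set) = range (\<lambda>i. axis i 1)"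
  by (auto simp: Basis_vec_def)

lemma inj_axis_one: "inj (\<lambda>i::'n::finite. axis i (1::real))"
  by (rule injI) (simp add: axis_eq_axis)

lemma prod_Basis_vec: "(\<Prod>b\<in>(Basis::(real^'n) set). f b) = (\<Prod>i\<in>UNIV. f (axis i 1))"
  unfolding Basis_vec_axis by (subst prod.reindex[OF inj_axis_one]) simp

lemma sum_Basis_vec: "(\<Sum>b\<in>(Basis::(real^'n) set). f b) = (\<Sum>i\<in>UNIV. f (axis i 1))"
  unfolding Basis_vec_axis by (subst sum.reindex[OF inj_axis_one]) simp

lemma measurable_matrix_vector [measurable]: "(\<lambda>x. (A::real^'n^'m) *v x) \<in> borel_measurable borel"
  by (intro borel_measurable_continuous_onI matrix_vector_mult_linear_continuous_on)

lemma nn_integral_lborel_shear: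
  fixes f :: "real^'n \<Rightarrow> ennreal"
  assumes [measurable]: "f \<in> borel_measurable borel" and mn: "m \<noteq> n"
  shows "(\<integral>\<^sup>+x. f (\<chi> i. if i = m then x$m + x$n else x$i) \<partial>lborel) = (\<integral>\<^sup>+x. f x \<partial>lborel)"
proof -
  define h :: "real^'n \<Rightarrow> real^'n" where "h x = (\<chi> i. if i = m then x$m + x$n else x$i)" for x
  define T :: "(real^'n \<Rightarrow> real) \<Rightarrow> real^'n" where "T \<omega> = (\<Sum>b\<in>Basis. \<omega> b *\<^sub>R b)" for \<omega>
  define e e' :: "real^'n" where "e = axis m 1" and "e' = axis n 1"
  define I where "I = Basis - {e}"
  have ins: "Basis = insert e I" and I: "finite I" "e \<notin> I" and e': "e' \<in> I"
    using mn by (auto simp: I_def e_def e'_def axis_eq_axis axis_in_Basis_iff)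
  interpret product_sigma_finite "\<lambda>_::real^'n. lborel::real measure" by standard
  have [measurable]: "h \<in> borel_measurable borel"
  proof (rule borel_measurable_continuous_onI)
    have "continuous_on UNIV (\<lambda>x::real^'n. if i = m then x$m + x$n else x$i)" for i
      by (cases "i = m") (auto intro!: continuous_intros)
    then show "continuous_on UNIV h" unfolding h_def by (intro continuous_on_vec_lambda)
  qed
  have [measurable]: "T \<in> Pi\<^sub>M Basis (\<lambda>_. lborel) \<rightarrow>\<^sub>M borel" unfolding T_def by measurable
  have Tm: "T \<in> Pi\<^sub>M (insert e I) (\<lambda>_. lborel) \<rightarrow>\<^sub>M borel" unfolding ins[symmetric] by measurable
  note [measurable] = Tm
  have nth: "T \<omega> $ i = \<omega> (axis i 1)" for \<omega> i
  proof -
    have "T \<omega> $ i = T \<omega> \<bullet> axis i 1" by (simp add: inner_axis)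
    also have "\<dots> = \<omega> (axis i 1)" unfolding T_def by (simp add: inner_sum_left_Basis axis_in_Basis_iff)
    finally show ?thesis .
  qed
  have hT: "h (T (fun_upd \<omega> e y)) = T (fun_upd \<omega> e (y + \<omega> e'))" for \<omega> y
  proof -
    have ne: "e' \<noteq> e" using mn by (simp add: e_def e'_def axis_eq_axis)
    have "h (T (fun_upd \<omega> e y)) $ i = T (fun_upd \<omega> e (y + \<omega> e')) $ i" for i
      using ne by (cases "i = m") (simp_all add: h_def nth flip: e_def e'_def, simp_all add: e_def axis_eq_axis)
    then show ?thesis by (simp add: vec_eq_iff)
  qed
  have eq: "(\<integral>\<^sup>+x. g x \<partial>lborel) = (\<integral>\<^sup>+\<omega>. (\<integral>\<^sup>+y. g (T (fun_upd \<omega> e y)) \<partial>lborel) \<partial>Pi\<^sub>M I (\<lambda>_. lborel))"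
    if [measurable]: "g \<in> borel_measurable borel" for g :: "real^'n \<Rightarrow> ennreal"
  proof -
    have "(\<integral>\<^sup>+x. g x \<partial>lborel) = (\<integral>\<^sup>+\<omega>. g (T \<omega>) \<partial>Pi\<^sub>M Basis (\<lambda>_. lborel))"
      by (subst lborel_eq) (simp add: nn_integral_distr T_def[abs_def, symmetric])
    also have "\<dots> = (\<integral>\<^sup>+\<omega>. (\<integral>\<^sup>+y. g (T (fun_upd \<omega> e y)) \<partial>lborel) \<partial>Pi\<^sub>M I (\<lambda>_. lborel))"
      unfolding ins using I by (subst product_nn_integral_insert) auto
    finally show ?thesis .
  qed
  have "(\<integral>\<^sup>+x. f (h x) \<partial>lborel) = (\<integral>\<^sup>+\<omega>. (\<integral>\<^sup>+y. f (T (fun_upd \<omega> e (y + \<omega> e'))) \<partial>lborel) \<partial>Pi\<^sub>M I (\<lambda>_. lborel))"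
    by (subst eq) (auto simp: hT)
  also have "\<dots> = (\<integral>\<^sup>+\<omega>. (\<integral>\<^sup>+y. f (T (fun_upd \<omega> e y)) \<partial>lborel) \<partial>Pi\<^sub>M I (\<lambda>_. lborel))"
  proof (rule nn_integral_cong)
    fix \<omega> assume w: "\<omega> \<in> space (Pi\<^sub>M I (\<lambda>_. lborel::real measure))"
    have meas: "(\<lambda>y. f (T (fun_upd \<omega> e y))) \<in> borel_measurable borel"
    proof -
      have "(\<lambda>y. fun_upd \<omega> e y) \<in> borel \<rightarrow>\<^sub>M Pi\<^sub>M (insert e I) (\<lambda>_. lborel)"
        using w I by (intro measurable_fun_upd[where J = I]) auto
      then have "(\<lambda>y. T (fun_upd \<omega> e y)) \<in> borel_measurable borel" using Tm by measurable
      then show ?thesis by measurable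
    qed
    show "(\<integral>\<^sup>+y. f (T (fun_upd \<omega> e (y + \<omega> e'))) \<partial>lborel) = (\<integral>\<^sup>+y. f (T (fun_upd \<omega> e y)) \<partial>lborel)"
      using nn_integral_real_affine[OF meas, of 1 "\<omega> e'"] by (simp add: add.commute)
  qed
  also have "\<dots> = (\<integral>\<^sup>+x. f x \<partial>lborel)" by (subst eq) auto
  finally show ?thesis by (simp add: h_def)
qed

text \<open>A permutation of the coordinates maps boxes to boxes of the same volume, and the volumes
  of boxes determine Lebesgue measure.\<close>

lemma nn_integral_lborel_swap:
  fixes f :: "real^'n \<Rightarrow> ennreal"
  assumes [measurable]: "f \<in> borel_measurable borel"
  shows "(\<integral>\<^sup>+x. f (\<chi> i. x $ Transposition.transpose m n i) \<partial>lborel) = (\<integral>\<^sup>+x. f x \<partial>lborel)"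
proof -
  define h :: "real^'n \<Rightarrow> real^'n" where "h x = (\<chi> i. x $ Transposition.transpose m n i)" for x
  have [measurable]: "h \<in> borel_measurable borel"
    unfolding h_def by (intro borel_measurable_continuous_onI continuous_intros)
  have "lborel = distr lborel borel h"
  proof (rule lborel_eqI)
    fix l u :: "real^'n" assume le: "\<And>b. b \<in> Basis \<Longrightarrow> l \<bullet> b \<le> u \<bullet> b"
    have le': "l $ i \<le> u $ i" for i using le[of "axis i 1"] by (simp add: axis_in_Basis_iff inner_axis)
    have box: "h -` box l u = box (h l) (h u)"
      unfolding h_def by (auto simp: mem_box_cart) (metis transpose_involutory)+
    have "emeasure (distr lborel borel h) (box l u) = emeasure lborel (box (h l) (h u))"
      by (simp add: emeasure_distr box)
    also have "\<dots> = (\<Prod>b\<in>Basis. (h u - h l) \<bullet> b)"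
      using le' by (subst emeasure_lborel_box_eq) (auto simp: Basis_vec_axis inner_axis h_def)
    also have "\<dots> = (\<Prod>i\<in>UNIV. (u - l) $ Transposition.transpose m n i)"
      by (simp add: prod_Basis_vec inner_axis h_def)
    also have "(\<Prod>i\<in>UNIV. (u - l) $ Transposition.transpose m n i) = (\<Prod>i\<in>UNIV. (u - l) $ i)"
      using prod.permute[OF permutes_swap_id, of m UNIV n "\<lambda>i. (u - l) $ i"] by (simp add: comp_def)
    finally show "emeasure (distr lborel borel h) (box l u) = (\<Prod>b\<in>Basis. (u - l) \<bullet> b)"
      by (simp add: prod_Basis_vec inner_axis)
  qed simp
  then have "(\<integral>\<^sup>+x. f x \<partial>lborel) = (\<integral>\<^sup>+x. f x \<partial>distr lborel borel h)" by simp
  then show ?thesis by (simp add: nn_integral_distr h_def)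
qed

text \<open>Not obtained from \<open>measure_linear_image\<close>, which needs a wellordered index type.\<close>

lemma nn_integral_lborel_matrix:
  fixes A :: "real^'n^'n" and f :: "real^'n \<Rightarrow> ennreal"
  assumes "det A \<noteq> 0" and "f \<in> borel_measurable borel"
  shows "(\<integral>\<^sup>+x. f (A *v x) \<partial>lborel) * ennreal \<bar>det A\<bar> = (\<integral>\<^sup>+x. f x \<partial>lborel)"
proof -
  \<comment> \<open>The condition \<open>det A \<noteq> 0\<close> is part of the induction predicate
    because the induction over elementary matrices also passes through singular ones, such as those
    with a zero row; there \<open>P\<close> holds vacuously.\<close>
  define P where "P A \<longleftrightarrow> (det A \<noteq> 0 \<longrightarrow> (\<forall>f\<in>borel_measurable borel.
    (\<integral>\<^sup>+x. f (A *v x) \<partial>lborel) * ennreal \<bar>det A\<bar> = (\<integral>\<^sup>+x. f x \<partial>lborel)))" for A :: "real^'n^'n"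
  have "P A"
  proof (rule induct_matrix_elementary_alt[of P])
    fix A B :: "real^'n^'n" assume AB: "P A" "P B"
    show "P (A ** B)"
      unfolding P_def
    proof (intro impI ballI)
      fix f :: "real^'n \<Rightarrow> ennreal" assume "det (A ** B) \<noteq> 0" and [measurable]: "f \<in> borel_measurable borel"
      then have nz: "det A \<noteq> 0" "det B \<noteq> 0" by (auto simp: det_mul)
      have "(\<integral>\<^sup>+x. f ((A ** B) *v x) \<partial>lborel) * ennreal \<bar>det (A ** B)\<bar>
          = (\<integral>\<^sup>+x. f (A *v (B *v x)) \<partial>lborel) * ennreal \<bar>det B\<bar> * ennreal \<bar>det A\<bar>"
        by (simp add: det_mul abs_mult ennreal_mult matrix_vector_mul_assoc mult_ac)
      also have "(\<integral>\<^sup>+x. f (A *v (B *v x)) \<partial>lborel) * ennreal \<bar>det B\<bar> = (\<integral>\<^sup>+x. f (A *v x) \<partial>lborel)"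
        using AB(2) nz unfolding P_def by (auto dest!: bspec[where x = "\<lambda>x. f (A *v x)"])
      also have "(\<integral>\<^sup>+x. f (A *v x) \<partial>lborel) * ennreal \<bar>det A\<bar> = (\<integral>\<^sup>+x. f x \<partial>lborel)"
        using AB(1) nz unfolding P_def by auto
      finally show "(\<integral>\<^sup>+x. f ((A ** B) *v x) \<partial>lborel) * ennreal \<bar>det (A ** B)\<bar> = (\<integral>\<^sup>+x. f x \<partial>lborel)" .
    qed
  next
    fix A :: "real^'n^'n" and i assume "row i A = 0"
    then show "P A" unfolding P_def using det_zero_row(1)[of i A] by simp
  next
    fix A :: "real^'n^'n" assume diag: "\<And>i j. i \<noteq> j \<Longrightarrow> A$i$j = 0"
    show "P A"
      unfolding P_def
    proof (intro impI ballI)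
      fix f :: "real^'n \<Rightarrow> ennreal" assume nz: "det A \<noteq> 0" and [measurable]: "f \<in> borel_measurable borel"
      have det: "det A = (\<Prod>i\<in>UNIV. A$i$i)" by (rule det_diagonal[OF diag])
      \<comment> \<open>The diagonal entries as a function on basis vectors, the form in which
        \<open>lborel_affine_euclidean\<close> expects coordinatewise scalings.\<close>
      define c where "c b = (A *v b) \<bullet> b" for b
      have c: "c (axis i 1) = A$i$i" for i
        by (simp add: c_def inner_axis matrix_vector_mult_basis column_def)
      have cnz: "c b \<noteq> 0" if "b \<in> Basis" for b
        using that nz by (auto simp: Basis_vec_axis c det)
      have T: "0 + (\<Sum>j\<in>Basis. (c j * (x \<bullet> j)) *\<^sub>R j) = A *v x" for x
      proof -
        have "(A *v x) $ i = A$i$i * x$i" for i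
        proof -
          have "(A *v x) $ i = (\<Sum>j\<in>UNIV. A$i$j * x$j)" by (simp add: matrix_vector_mult_def)
          also have "\<dots> = (\<Sum>j\<in>UNIV. if j = i then A$i$i * x$i else 0)"
            by (intro sum.cong refl) (simp add: diag)
          finally have "(A *v x) $ i = (\<Sum>j\<in>UNIV. if j = i then A$i$i * x$i else 0)" .
          then show ?thesis by simp
        qed
        then show ?thesis
          by (simp add: sum_Basis_vec c inner_axis vec_eq_iff)
             (simp add: axis_def if_distrib cong: if_cong)
      qed
      have "lborel = density (distr lborel borel (\<lambda>x. A *v x)) (\<lambda>_. (\<Prod>j\<in>Basis. \<bar>c j\<bar>))"
        using lborel_affine_euclidean[of c 0, OF cnz] unfolding T .
      also have "(\<Prod>j\<in>Basis. \<bar>c j\<bar>) = \<bar>det A\<bar>" by (simp add: prod_Basis_vec c det abs_prod)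
      finally have lb: "lborel = density (distr lborel borel (\<lambda>x. A *v x)) (\<lambda>_. ennreal \<bar>det A\<bar>)" .
      have "(\<integral>\<^sup>+x. f x \<partial>lborel) = (\<integral>\<^sup>+x. f x \<partial>density (distr lborel borel (\<lambda>x. A *v x)) (\<lambda>_. ennreal \<bar>det A\<bar>))"
        using lb by simp
      also have "\<dots> = (\<integral>\<^sup>+x. f (A *v x) \<partial>lborel) * ennreal \<bar>det A\<bar>"
        by (simp add: nn_integral_density nn_integral_distr nn_integral_cmult mult.commute)
      finally show "(\<integral>\<^sup>+x. f (A *v x) \<partial>lborel) * ennreal \<bar>det A\<bar> = (\<integral>\<^sup>+x. f x \<partial>lborel)" ..
    qed
  next
    fix m n :: 'n assume mn: "m \<noteq> n"
    let ?S = "(\<chi> i j. mat 1 $ i $ Transposition.transpose m n j) :: real^'n^'n"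
    have "det ?S = of_int (sign (Transposition.transpose m n)) * det (mat 1 :: real^'n^'n)"
      by (rule det_permute_columns) (rule permutes_swap_id, auto)
    then have d: "\<bar>det ?S\<bar> = 1" using mn by (simp add: sign_swap_id)
    have v: "?S *v x = (\<chi> i. x $ Transposition.transpose m n i)" for x :: "real^'n"
    proof -
      have "(\<Sum>j\<in>UNIV. (if i = Transposition.transpose m n j then 1 else 0) * x $ j) = x $ Transposition.transpose m n i" for i
      proof -
        have "i = Transposition.transpose m n j \<longleftrightarrow> j = Transposition.transpose m n i" for j
          by (metis transpose_involutory)
        then show ?thesis by (simp add: if_distrib[of "\<lambda>y. y * _"] cong: if_cong)
      qed
      then show ?thesis by (simp add: matrix_vector_mult_def mat_def vec_eq_iff)
    qed
    show "P ?S" unfolding P_def d v using nn_integral_lborel_swap[of _ m n] by auto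
  next
    fix m n :: 'n assume mn: "m \<noteq> n"
    let ?S = "(\<chi> i j. of_bool (i = m \<and> j = n \<or> i = j)) :: real^'n^'n"
    have "?S = (\<chi> k. if k = m then row m (mat 1) + 1 *s row n (mat 1) else row k (mat 1))"
      using mn by (auto simp: vec_eq_iff row_def mat_def)
    then have d: "det ?S = 1" using det_row_operation[OF mn, of "mat 1 :: real^'n^'n" 1] by (simp add: det_I)
    have v: "?S *v x = (\<chi> i. if i = m then x$m + x$n else x$i)" for x :: "real^'n"
    proof -
      have "(\<Sum>j\<in>UNIV. of_bool (i = m \<and> j = n \<or> i = j) * x $ j) = (if i = m then x$m + x$n else x$i)" for i
      proof -
        have "(\<Sum>j\<in>UNIV. of_bool (i = m \<and> j = n \<or> i = j) * x $ j)
          = (\<Sum>j\<in>UNIV. (if j = i then x$i else 0) + (if j = n then (if i = m then x$n else 0) else 0))"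
          using mn by (intro sum.cong) auto
        then show ?thesis by (simp add: sum.distrib)
      qed
      then show ?thesis by (simp add: matrix_vector_mult_def)
    qed
    show "P ?S" unfolding P_def d v using nn_integral_lborel_shear[OF _ mn] by auto
  qed
  then show ?thesis using assms unfolding P_def by blast
qed

text \<open>The change of variables as an identity of measures, which carries over to Bochner
  integrals.\<close>

lemma lborel_matrix:
  fixes A :: "real^'n^'n"
  assumes "det A \<noteq> 0"
  shows "lborel = density (distr lborel borel (\<lambda>x. A *v x)) (\<lambda>_. ennreal \<bar>det A\<bar>)" (is "_ = ?D")
proof (rule measure_eqI)
  fix S :: "(real^'n) set" assume S: "S \<in> sets lborel"
  have "emeasure lborel S = (\<integral>\<^sup>+x. indicator S x \<partial>lborel)" using S by simp
  also have "\<dots> = (\<integral>\<^sup>+x. indicator S (A *v x) \<partial>lborel) * ennreal \<bar>det A\<bar>"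
    using S by (intro nn_integral_lborel_matrix[symmetric] assms) auto
  also have "\<dots> = emeasure ?D S"
    using S by (subst emeasure_density) (auto simp: nn_integral_distr nn_integral_cmult mult.commute)
  finally show "emeasure lborel S = emeasure ?D S" .
qed simp

lemma
  fixes A :: "real^'n^'n" and f :: "real^'n \<Rightarrow> 'b::{banach,second_countable_topology}"
  assumes d: "det A \<noteq> 0" and f: "f \<in> borel_measurable borel"
  shows integral_lborel_matrix: "(LINT x|lborel. f x) = \<bar>det A\<bar> *\<^sub>R (LINT x|lborel. f (A *v x))"
    and integrable_lborel_matrix: "integrable lborel f \<longleftrightarrow> integrable lborel (\<lambda>x. f (A *v x))"
proof -
  note [measurable] = f
  have "(LINT x|lborel. f x) = (LINT x|density (distr lborel borel (\<lambda>x. A *v x)) (\<lambda>_. ennreal \<bar>det A\<bar>). f x)"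
    using lborel_matrix[OF d] by simp
  also have "\<dots> = \<bar>det A\<bar> *\<^sub>R (LINT x|lborel. f (A *v x))"
    by (simp add: integral_density integral_distr)
  finally show "(LINT x|lborel. f x) = \<bar>det A\<bar> *\<^sub>R (LINT x|lborel. f (A *v x))" .
  have "integrable lborel f \<longleftrightarrow> integrable (density (distr lborel borel (\<lambda>x. A *v x)) (\<lambda>_. ennreal \<bar>det A\<bar>)) f"
    using lborel_matrix[OF d] by simp
  also have "\<dots> \<longleftrightarrow> integrable lborel (\<lambda>x. f (A *v x))"
  proof -
    have "integrable lborel (\<lambda>x. f (A *v x))" if "integrable lborel (\<lambda>x. \<bar>det A\<bar> *\<^sub>R f (A *v x))"
      using integrable_scaleR_right[OF that, of "1 / \<bar>det A\<bar>"] d by simp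
    then show ?thesis by (auto simp add: integrable_density integrable_distr_eq)
  qed
  finally show "integrable lborel f \<longleftrightarrow> integrable lborel (\<lambda>x. f (A *v x))" .
qed

section \<open>Factorisation of positive definite matrices\<close>

text \<open>Gram-Schmidt for the inner product given by \<open>C\<close>. Families orthonormal for
  it are linearly independent, hence of bounded cardinality, so one of maximal size exists. If it
  did not span, the normalised residual \<open>z\<close> of a missing vector would enlarge it. Its
  members are the columns of \<open>P\<close>.\<close>

lemma pos_def_congruence:
  fixes C :: "real^'n^'n"
  assumes sym: "transpose C = C" and pd: "pos_def C"
  shows "\<exists>P::real^'n^'n. transpose P ** C ** P = mat 1"
proof -
  have symi: "(C *v x) \<bullet> y = x \<bullet> (C *v y)" for x y
    using sym by (metis dot_lmul_matrix inner_commute transpose_matrix_vector)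
  define orth where "orth S \<longleftrightarrow> finite S \<and> (\<forall>b\<in>S. \<forall>b'\<in>S. (C *v b) \<bullet> b' = (if b = b' then 1 else 0))"
    for S :: "(real^'n) set"
  have card: "card S \<le> CARD('n)" if "orth S" for S
  proof -
    have "independent S"
      unfolding independent_explicit_finite_subsets
    proof (intro allI impI ballI)
      fix T u v assume T: "T \<subseteq> S" "finite T" "(\<Sum>v\<in>T. u v *\<^sub>R v) = 0" "v \<in> T"
      have "0 = (C *v v) \<bullet> (\<Sum>v\<in>T. u v *\<^sub>R v)" using T by simp
      also have "\<dots> = (\<Sum>w\<in>T. if w = v then u v else 0)"
        unfolding inner_sum_right using that T by (intro sum.cong) (auto simp: orth_def subset_eq)
      also have "\<dots> = u v" using T by simp
      finally show "u v = 0" by simp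
    qed
    then show ?thesis using independent_bound[of S] by simp
  qed
  have "\<exists>S. orth S \<and> (\<forall>T. orth T \<longrightarrow> card T \<le> card S)"
  proof -
    have "orth {}" by (simp add: orth_def)
    then show ?thesis using ex_has_greatest_nat[of orth "{}" card "Suc CARD('n)"] card by (simp add: less_Suc_eq_le)
  qed
  then obtain S where S: "orth S" and max: "\<And>T. orth T \<Longrightarrow> card T \<le> card S" by blast
  have fin: "finite S" using S by (simp add: orth_def)
  have "span S = UNIV"
  proof (rule ccontr)
    assume "span S \<noteq> UNIV"
    then obtain x where x: "x \<notin> span S" by blast
    define y where "y = x - (\<Sum>b\<in>S. ((C *v x) \<bullet> b) *\<^sub>R b)"
    have "(\<Sum>b\<in>S. ((C *v x) \<bullet> b) *\<^sub>R b) \<in> span S" by (intro span_sum span_scale span_base)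
    then have "y \<noteq> 0" using x unfolding y_def by auto
    then have pos: "(C *v y) \<bullet> y > 0" using pd by (simp add: pos_def_def)
    have ortho: "(C *v b) \<bullet> y = 0" if b: "b \<in> S" for b
    proof -
      have "(C *v b) \<bullet> (\<Sum>c\<in>S. ((C *v x) \<bullet> c) *\<^sub>R c) = (\<Sum>c\<in>S. if c = b then (C *v x) \<bullet> b else 0)"
        unfolding inner_sum_right using S b by (intro sum.cong) (auto simp: orth_def)
      also have "\<dots> = (C *v x) \<bullet> b" using b fin by simp
      also have "\<dots> = (C *v b) \<bullet> x" by (metis symi inner_commute)
      finally show ?thesis by (simp add: y_def inner_diff_right)
    qed
    define z where "z = (1 / sqrt ((C *v y) \<bullet> y)) *\<^sub>R y"
    have z1: "(C *v z) \<bullet> z = 1"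
      using pos by (simp add: z_def matrix_vector_mult_scaleR field_simps)
    have z0: "(C *v b) \<bullet> z = 0" "(C *v z) \<bullet> b = 0" if "b \<in> S" for b
      using ortho[OF that] by (simp_all add: z_def symi matrix_vector_mult_scaleR) (metis inner_commute symi)
    have "z \<notin> S" using z0 z1 by auto
    have "orth (insert z S)" using S z0 z1 \<open>z \<notin> S\<close> by (auto simp: orth_def)
    from max[OF this] \<open>z \<notin> S\<close> fin show False by simp
  qed
  then have "CARD('n) \<le> card S"
    using dim_le_card[of UNIV S] fin by simp
  with card[OF S] have "card S = CARD('n)" by simp
  then obtain f where f: "bij_betw f (UNIV :: 'n set) S"
    using finite_same_card_bij[of "UNIV :: 'n set" S] fin by auto
  define P :: "real^'n^'n" where "P = (\<chi> i j. f j $ i)"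
  have "(transpose P ** C ** P) $ i $ j = (C *v f j) \<bullet> f i" for i j
  proof -
    have "(transpose P ** (C ** P)) $ i $ j = (\<Sum>k\<in>UNIV. f i $ k * (C *v f j) $ k)"
      by (simp add: P_def matrix_matrix_mult_def transpose_def matrix_vector_mult_def)
    then show ?thesis by (simp add: matrix_mul_assoc inner_vec_def mult.commute)
  qed
  also have "(C *v f j) \<bullet> f i = (if i = j then 1 else 0)" for i j
    using S f unfolding orth_def bij_betw_def by (auto simp: inj_on_def)
  finally have "transpose P ** C ** P = mat 1" by (simp add: vec_eq_iff mat_def)
  then show ?thesis by blast
qed

lemma
  fixes A :: "real^'n^'n"
  assumes "det A \<noteq> 0"
  shows matrix_inv_right_det: "A ** matrix_inv A = mat 1" and matrix_inv_left_det: "matrix_inv A ** A = mat 1"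
proof -
  have "\<exists>A'. A ** A' = mat 1 \<and> A' ** A = mat 1"
    using assms invertible_det_nz[of A] by (auto simp: invertible_def)
  then have "A ** matrix_inv A = mat 1 \<and> matrix_inv A ** A = mat 1"
    unfolding matrix_inv_def by (rule someI_ex)
  then show "A ** matrix_inv A = mat 1" "matrix_inv A ** A = mat 1" by auto
qed

lemma matrix_inv_eqI:
  fixes A B :: "real^'n^'n"
  assumes "A ** B = mat 1"
  shows "matrix_inv A = B"
proof -
  have "det A \<noteq> 0" using assms by (metis det_I det_mul mult_zero_left zero_neq_one)
  then have "matrix_inv A = matrix_inv A ** (A ** B)" using assms by simp
  also have "\<dots> = B" using \<open>det A \<noteq> 0\<close> by (simp add: matrix_mul_assoc matrix_inv_left_det)
  finally show ?thesis .
qed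

text \<open>With \<open>R\<close> the inverse of the congruence matrix \<open>P\<close>, the
  congruence is undone as \<open>C = transpose R ** R\<close>; the factor \<open>M\<close> is the
  transpose of \<open>R\<close>.\<close>

lemma pos_def_factorization:
  fixes C :: "real^'n^'n"
  assumes sym: "transpose C = C" and pd: "pos_def C"
  shows "\<exists>M::real^'n^'n. C = M ** transpose M \<and> det M \<noteq> 0"
proof -
  obtain P :: "real^'n^'n" where P: "transpose P ** C ** P = mat 1" using pos_def_congruence[OF assms] by blast
  have "det (transpose P ** C ** P) = 1" unfolding P by simp
  then have nz: "det P \<noteq> 0" by (auto simp: det_mul)
  define R where "R = matrix_inv P"
  have inv: "P ** R = mat 1" "R ** P = mat 1"
    using nz by (simp_all add: R_def matrix_inv_right_det matrix_inv_left_det)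
  have "transpose R ** (transpose P ** C ** P) ** R = (transpose R ** transpose P) ** C ** (P ** R)"
    by (simp add: matrix_mul_assoc)
  also have "transpose R ** transpose P = mat 1"
    using inv by (simp flip: matrix_transpose_mul)
  finally have C: "C = transpose R ** transpose (transpose R)" by (simp add: P inv)
  have "det R \<noteq> 0" using inv(1) by (metis det_I det_mul mult_zero_right zero_neq_one)
  then show ?thesis using C by (intro exI[of _ "transpose R"]) simp
qed

section \<open>Gaussian densities and their Fourier transforms\<close>

text \<open>Normalised like the heat kernel, with 1/4 instead of 1/2 in the exponent: in the sense
  of probability theory the covariance matrix is twice \<open>C\<close>.\<close>

definition gauss_density :: "real^'n^'n \<Rightarrow> real^'n \<Rightarrow> real" where
  "gauss_density C w = (4 * pi) powr (- real CARD('n) / 2) * det C powr (- 1 / 2) *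
     exp (- ((matrix_inv C *v w) \<bullet> w) / 4)"

lemma powr_neg_half_card:
  fixes c :: real
  assumes c: "0 < c"
  shows "c powr (- real n / 2) = (1 / sqrt c) ^ n"
proof -
  have "c powr (- real n / 2) = (c powr (- (1 / 2))) powr real n" by (simp add: powr_powr)
  also have "\<dots> = (c powr (- (1 / 2))) ^ n" using c by (intro powr_realpow) simp
  finally show ?thesis using c by (simp add: powr_minus powr_half_sqrt inverse_eq_divide)
qed

abbreviation std_gauss :: "'a::euclidean_space \<Rightarrow> real" where
  "std_gauss y \<equiv> (4 * pi) powr (- real DIM('a) / 2) * exp (- (norm y)\<^sup>2 / 4)"

lemma measurable_gauss_density [measurable]: "gauss_density C \<in> borel_measurable borel"
  unfolding gauss_density_def by measurable

lemma gauss_density_even: "gauss_density C (- w) = gauss_density C w"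
  unfolding gauss_density_def by (simp add: linear_neg[OF matrix_vector_mul_linear])

text \<open>The inverse of \<open>C\<close> is \<open>transpose R ** R\<close> with \<open>R\<close>
  the inverse of \<open>M\<close>. Hence the quadratic form at \<open>M *v y\<close> is the squared
  norm of \<open>y\<close>, while \<open>\<bar>det M\<bar>\<close> cancels
  \<open>det C powr (- 1 / 2)\<close>.\<close>

lemma gauss_density_image:
  fixes M :: "real^'n^'n"
  assumes M: "C = M ** transpose M" "det M \<noteq> 0"
  shows "\<bar>det M\<bar> * gauss_density C (M *v y) = std_gauss y"
proof -
  define R where "R = matrix_inv M"
  have inv: "M ** R = mat 1" "R ** M = mat 1"
    using M by (simp_all add: R_def matrix_inv_right_det matrix_inv_left_det)
  have t: "transpose M ** transpose R = mat 1" "transpose R ** transpose M = mat 1"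
    using inv by (simp_all flip: matrix_transpose_mul)
  have "C ** (transpose R ** R) = M ** (transpose M ** transpose R) ** R"
    unfolding M by (simp add: matrix_mul_assoc)
  then have 1: "C ** (transpose R ** R) = mat 1" by (simp add: t inv)
  have "matrix_inv C = transpose R ** R"
    by (rule matrix_inv_eqI[OF 1])
  then have "matrix_inv C *v (M *v y) = transpose R *v y"
    by (simp add: matrix_vector_mul_assoc matrix_mul_assoc[symmetric] inv)
  then have "(matrix_inv C *v (M *v y)) \<bullet> (M *v y) = y \<bullet> (R *v (M *v y))"
    by (metis dot_lmul_matrix transpose_matrix_vector)
  also have "\<dots> = (norm y)\<^sup>2" by (simp add: matrix_vector_mul_assoc inv power2_norm_eq_inner)
  finally have e: "(matrix_inv C *v (M *v y)) \<bullet> (M *v y) = (norm y)\<^sup>2" .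
  have "det C = (det M)\<^sup>2" unfolding M by (simp add: det_mul power2_eq_square)
  then have "det C powr (- 1 / 2) = 1 / \<bar>det M\<bar>"
    using M powr_neg_half_card[of "det C" 1] by simp
  then show ?thesis using M unfolding gauss_density_def e by simp
qed

text \<open>The characteristic function of the standard normal law at \<open>v / sqrt 2\<close>,
  after the substitution of \<open>sqrt 2 * x\<close> for \<open>x\<close>.\<close>

lemma fourier_gauss_real:
  fixes v :: real
  shows "integrable lborel (\<lambda>x. exp (\<i> * of_real (x * v) - of_real (x\<^sup>2)))"
    and "(LINT x|lborel. exp (\<i> * of_real (x * v) - of_real (x\<^sup>2))) = of_real (sqrt pi * exp (- v\<^sup>2 / 4))"
proof -
  define s where "s = v / sqrt 2"
  let ?g = "\<lambda>x. std_normal_density x *\<^sub>R iexp (s * x)"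
  have int: "integrable lborel ?g"
    by (rule Bochner_Integration.integrable_bound[of _ std_normal_density]) auto
  have val: "(LINT x|lborel. ?g x) = of_real (exp (- (s\<^sup>2) / 2))"
    using char_std_normal_distribution by (auto simp: char_def integral_density fun_eq_iff)
  have eq: "?g (sqrt 2 * x) = of_real (1 / sqrt (2 * pi)) * exp (\<i> * of_real (x * v) - of_real (x\<^sup>2))" for x
    by (simp add: std_normal_density_def s_def scaleR_conv_of_real exp_diff exp_minus exp_of_real[symmetric]
        power_mult_distrib field_simps)
  have a: "integrable lborel (\<lambda>x. ?g (0 + sqrt 2 * x))"
    by (rule lborel_integrable_real_affine[OF int]) simp
  then have "integrable lborel (\<lambda>x. of_real (sqrt (2 * pi)) * ?g (sqrt 2 * x))" by (simp only: add_0_left integrable_mult_right)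
  then show "integrable lborel (\<lambda>x. exp (\<i> * of_real (x * v) - of_real (x\<^sup>2)))"
    unfolding eq by (simp add: field_simps)
  have "of_real (exp (- (s\<^sup>2) / 2)) = \<bar>sqrt 2\<bar> *\<^sub>R (LINT x|lborel. ?g (0 + sqrt 2 * x))"
    unfolding val[symmetric] by (rule lborel_integral_real_affine) simp
  also have "\<dots> = of_real (sqrt 2 / sqrt (2 * pi)) * (LINT x|lborel. exp (\<i> * of_real (x * v) - of_real (x\<^sup>2)))"
    unfolding add_0_left eq by (simp add: scaleR_conv_of_real)
  finally show "(LINT x|lborel. exp (\<i> * of_real (x * v) - of_real (x\<^sup>2))) = of_real (sqrt pi * exp (- v\<^sup>2 / 4))"
    by (simp add: real_sqrt_mult field_simps s_def power_divide)
qed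

text \<open>Both terms of the exponent are sums over the coordinates, so the integrand factors and
  the one-dimensional transforms multiply.\<close>

lemma fourier_std_gauss:
  fixes v :: "'a::euclidean_space"
  shows "integrable lborel (\<lambda>x. exp (\<i> * of_real (x \<bullet> v) - of_real ((norm x)\<^sup>2)))" (is ?I)
    and "(LINT x|lborel. exp (\<i> * of_real (x \<bullet> v) - of_real ((norm x)\<^sup>2)))
       = of_real (sqrt pi ^ DIM('a) * exp (- (norm v)\<^sup>2 / 4))" (is ?E)
proof -
  interpret product_sigma_finite "\<lambda>_::'a. lborel::real measure" ..
  define T :: "('a \<Rightarrow> real) \<Rightarrow> 'a" where "T \<omega> = (\<Sum>b\<in>Basis. \<omega> b *\<^sub>R b)" for \<omega>
  have [measurable]: "T \<in> Pi\<^sub>M Basis (\<lambda>_. lborel) \<rightarrow>\<^sub>M borel" unfolding T_def by measurable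
  define g where "g b x = exp (\<i> * of_real (x * (v \<bullet> b)) - of_real (x\<^sup>2))" for b x
  have prod: "exp (\<i> * of_real (T \<omega> \<bullet> v) - of_real ((norm (T \<omega>))\<^sup>2)) = (\<Prod>b\<in>Basis. g b (\<omega> b))" for \<omega>
  proof -
    have 1: "T \<omega> \<bullet> v = (\<Sum>b\<in>Basis. \<omega> b * (v \<bullet> b))"
      unfolding T_def by (simp add: inner_sum_left inner_commute[of v])
    have 2: "(norm (T \<omega>))\<^sup>2 = (\<Sum>b\<in>Basis. (\<omega> b)\<^sup>2)"
      by (subst power2_norm_eq_inner, subst euclidean_inner) (simp add: T_def power2_eq_square)
    have "\<i> * of_real (T \<omega> \<bullet> v) - of_real ((norm (T \<omega>))\<^sup>2)
      = (\<Sum>b\<in>Basis. \<i> * of_real (\<omega> b * (v \<bullet> b)) - of_real ((\<omega> b)\<^sup>2))"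
      unfolding 1 2 by (simp add: sum_distrib_left sum_subtractf)
    then show ?thesis by (simp add: g_def exp_sum)
  qed
  have int: "integrable lborel (g b)" for b
    unfolding g_def by (rule fourier_gauss_real)
  have meas [measurable]: "(\<lambda>x::'a. exp (\<i> * of_real (x \<bullet> v) - of_real ((norm x)\<^sup>2))) \<in> borel_measurable borel"
    by measurable
  have "integrable (Pi\<^sub>M Basis (\<lambda>_. lborel)) (\<lambda>\<omega>. \<Prod>b\<in>Basis. g b (\<omega> b))"
    by (rule product_integrable_prod) (auto intro: int)
  then show ?I
    by (subst lborel_eq) (simp add: integrable_distr_eq T_def[abs_def, symmetric] prod del: of_real_power)
  have "(LINT x|lborel. exp (\<i> * of_real (x \<bullet> v) - of_real ((norm x)\<^sup>2)))
      = (LINT \<omega>|Pi\<^sub>M Basis (\<lambda>_. lborel). (\<Prod>b\<in>Basis. g b (\<omega> b)))"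
    by (subst lborel_eq) (simp add: integral_distr T_def[abs_def, symmetric] prod del: of_real_power)
  also have "\<dots> = (\<Prod>b\<in>Basis. LINT x|lborel. g b x)"
    by (rule product_integral_prod) (auto intro: int)
  also have "\<dots> = (\<Prod>b\<in>Basis. of_real (sqrt pi * exp (- (v \<bullet> b)\<^sup>2 / 4)))"
    unfolding g_def fourier_gauss_real(2) ..
  also have "\<dots> = of_real (sqrt pi ^ DIM('a) * exp (\<Sum>b\<in>Basis. - (v \<bullet> b)\<^sup>2 / 4))"
    by (simp add: prod.distrib exp_sum)
  also have "(\<Sum>b\<in>Basis. - (v \<bullet> b)\<^sup>2 / 4) = - (norm v)\<^sup>2 / 4"
    by (subst power2_norm_eq_inner, subst euclidean_inner) (simp add: power2_eq_square sum_divide_distrib sum_negf)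
  finally show ?E .
qed

lemma
  shows integrable_std_gauss: "integrable lborel (\<lambda>y::'a::euclidean_space. std_gauss y)"
    and integral_std_gauss: "(LINT y|lborel. std_gauss (y::'a)) = 1"
proof -
  have eq: "std_gauss y = (\<Prod>b\<in>Basis. normal_density 0 (sqrt 2) (y \<bullet> b))" for y :: 'a
  proof -
    have "(norm y)\<^sup>2 = (\<Sum>b\<in>Basis. (y \<bullet> b)\<^sup>2)"
      by (subst power2_norm_eq_inner, subst euclidean_inner) (simp add: power2_eq_square)
    then have "exp (- (norm y)\<^sup>2 / 4) = (\<Prod>b\<in>Basis. exp (- (y \<bullet> b)\<^sup>2 / 4))"
      by (simp add: sum_divide_distrib sum_negf flip: exp_sum)
    moreover have "(4 * pi) powr (- real DIM('a) / 2) = (1 / sqrt (4 * pi)) ^ DIM('a)"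
      by (rule powr_neg_half_card) simp
    ultimately show ?thesis by (simp add: normal_density_def prod_dividef power_one_over)
  qed
  have nn: "(\<integral>\<^sup>+y. ennreal (std_gauss (y::'a)) \<partial>lborel) = 1"
  proof -
    have "(\<integral>\<^sup>+y. ennreal (std_gauss (y::'a)) \<partial>lborel)
        = (\<integral>\<^sup>+y. (\<Prod>b\<in>Basis. ennreal (normal_density 0 (sqrt 2) ((y::'a) \<bullet> b))) \<partial>lborel)"
      unfolding eq by (simp add: prod_ennreal)
    also have "\<dots> = (\<Prod>b\<in>(Basis::'a set). (\<integral>\<^sup>+y. ennreal (normal_density 0 (sqrt 2) y) \<partial>lborel))"
      by (rule nn_integral_lborel_prod) auto
    also have "(\<integral>\<^sup>+y. ennreal (normal_density 0 (sqrt 2) y) \<partial>lborel) = 1"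
      by (subst nn_integral_eq_integral) (auto simp: integral_normal_density)
    finally show ?thesis by simp
  qed
  show int: "integrable lborel (\<lambda>y::'a. std_gauss y)"
    by (rule integrableI_nonneg) (use nn in auto)
  show "(LINT y|lborel. std_gauss (y::'a)) = 1"
    using nn int by (simp add: nn_integral_eq_integral)
qed

text \<open>With \<open>C = M ** transpose M\<close> and \<open>w = M *v v\<close>, the variable
  \<open>transpose M *v \<xi>\<close> reduces the integral to the standard Gaussian. Read from right
  to left, the second claim is Fourier inversion for the density; it will turn the kernel into a
  superposition of characters.\<close>

lemma fourier_gauss_density:
  fixes C :: "real^'n^'n"
  assumes sym: "transpose C = C" and pd: "pos_def C"
  shows "integrable lborel (\<lambda>\<xi>. exp (\<i> * of_real (\<xi> \<bullet> w) - of_real ((C *v \<xi>) \<bullet> \<xi>)))" (is ?I)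
    and "(LINT \<xi>|lborel. exp (\<i> * of_real (\<xi> \<bullet> w) - of_real ((C *v \<xi>) \<bullet> \<xi>)))
       = of_real ((2 * pi) ^ CARD('n) * gauss_density C w)" (is ?E)
proof -
  obtain M where M: "C = M ** transpose M" "det M \<noteq> 0" using pos_def_factorization[OF assms] by blast
  define R where "R = matrix_inv M"
  have inv: "M ** R = mat 1" "R ** M = mat 1"
    using M by (simp_all add: R_def matrix_inv_right_det matrix_inv_left_det)
  have det: "det (transpose M) \<noteq> 0" using M by simp
  define v where "v = R *v w"
  have w: "w = M *v v" by (simp add: v_def matrix_vector_mul_assoc inv)
  let ?f = "\<lambda>\<eta>. exp (\<i> * of_real (\<eta> \<bullet> v) - of_real ((norm \<eta>)\<^sup>2))"
  have [measurable]: "?f \<in> borel_measurable borel" by measurable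
  have eq: "?f (transpose M *v \<xi>) = exp (\<i> * of_real (\<xi> \<bullet> w) - of_real ((C *v \<xi>) \<bullet> \<xi>))" for \<xi>
  proof -
    have "(transpose M *v \<xi>) \<bullet> v = \<xi> \<bullet> w" by (metis w dot_lmul_matrix transpose_matrix_vector)
    moreover have "(norm (transpose M *v \<xi>))\<^sup>2 = (C *v \<xi>) \<bullet> \<xi>"
      unfolding M power2_norm_eq_inner
      by (metis dot_lmul_matrix inner_commute matrix_vector_mul_assoc transpose_matrix_vector)
    ultimately show ?thesis by simp
  qed
  show ?I
    using fourier_std_gauss(1)[of v] integrable_lborel_matrix[OF det, of ?f] unfolding eq by simp
  have a: "\<bar>det M\<bar> * gauss_density C w = std_gauss v" unfolding w by (rule gauss_density_image[OF M])
  have "(LINT x|lborel. ?f x) = \<bar>det (transpose M)\<bar> *\<^sub>R (LINT \<xi>|lborel. exp (\<i> * of_real (\<xi> \<bullet> w) - of_real ((C *v \<xi>) \<bullet> \<xi>)))"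
    using integral_lborel_matrix[OF det, of ?f] unfolding eq by simp
  then have b: "of_real \<bar>det M\<bar> * (LINT \<xi>|lborel. exp (\<i> * of_real (\<xi> \<bullet> w) - of_real ((C *v \<xi>) \<bullet> \<xi>)))
     = of_real (sqrt pi ^ CARD('n) * exp (- (norm v)\<^sup>2 / 4))"
    unfolding fourier_std_gauss(2) by (simp add: scaleR_conv_of_real)
  \<comment> \<open>Each coordinate contributes \<open>sqrt pi = 2 * pi / sqrt (4 * pi)\<close>,
    which is the origin of the factor \<open>(2 * pi) ^ CARD('n)\<close>.\<close>
  have c: "sqrt pi ^ CARD('n) = (2 * pi) ^ CARD('n) * (4 * pi) powr (- real CARD('n) / 2)"
  proof -
    have "(4 * pi) powr (- real CARD('n) / 2) = (1 / sqrt (4 * pi)) ^ CARD('n)"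
      by (rule powr_neg_half_card) simp
    moreover have "(2 * pi) * (1 / sqrt (4 * pi)) = sqrt pi"
      by (simp add: real_sqrt_mult real_div_sqrt)
    ultimately show ?thesis by (metis power_mult_distrib)
  qed
  have "of_real \<bar>det M\<bar> * (LINT \<xi>|lborel. exp (\<i> * of_real (\<xi> \<bullet> w) - of_real ((C *v \<xi>) \<bullet> \<xi>)))
    = of_real ((2 * pi) ^ CARD('n) * (\<bar>det M\<bar> * gauss_density C w))"
    unfolding a b c by simp
  then have "of_real \<bar>det M\<bar> * (LINT \<xi>|lborel. exp (\<i> * of_real (\<xi> \<bullet> w) - of_real ((C *v \<xi>) \<bullet> \<xi>)))
    = of_real \<bar>det M\<bar> * of_real ((2 * pi) ^ CARD('n) * gauss_density C w)"
    by (simp only: of_real_mult mult.left_commute)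
  then show ?E using M by (simp only: mult_cancel_left of_real_eq_0_iff abs_eq_0 simp_thms)
qed

lemma
  fixes C M :: "real^'n^'n" and f :: "real^'n \<Rightarrow> real"
  assumes M: "C = M ** transpose M" "det M \<noteq> 0" and f [measurable]: "f \<in> borel_measurable borel"
  shows integral_gauss_density: "(LINT w|lborel. gauss_density C w * f w) = (LINT y|lborel. std_gauss y * f (M *v y))"
    and integrable_gauss_density: "integrable lborel (\<lambda>w. gauss_density C w * f w) \<longleftrightarrow>
      integrable lborel (\<lambda>y. std_gauss y * f (M *v y))"
proof -
  have eq: "\<bar>det M\<bar> * (gauss_density C (M *v y) * f (M *v y)) = std_gauss y * f (M *v y)" for y
    using gauss_density_image[OF M, of y] by simp
  show "(LINT w|lborel. gauss_density C w * f w) = (LINT y|lborel. std_gauss y * f (M *v y))"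
    by (subst integral_lborel_matrix[OF M(2)]) (simp_all flip: integral_mult_right_zero add: eq)
  have "integrable lborel (\<lambda>w. gauss_density C w * f w) \<longleftrightarrow>
    integrable lborel (\<lambda>y. \<bar>det M\<bar> * (gauss_density C (M *v y) * f (M *v y)))"
    by (subst integrable_lborel_matrix[OF M(2)]) (use M in simp_all)
  then show "integrable lborel (\<lambda>w. gauss_density C w * f w) \<longleftrightarrow>
      integrable lborel (\<lambda>y. std_gauss y * f (M *v y))"
    unfolding eq .
qed

section \<open>The matrix exponential\<close>

lemma has_vector_derivative_matrixI:
  fixes f :: "real \<Rightarrow> real^'n^'m"
  assumes "\<And>i j. ((\<lambda>t. f t $ i $ j) has_real_derivative f' $ i $ j) (at t)"
  shows "(f has_vector_derivative f') (at t)"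
  unfolding has_vector_derivative_def has_derivative_componentwise_within[of f]
proof
  fix b :: "real^'n^'m" assume "b \<in> Basis"
  then obtain i j where b: "b = axis i (axis j 1)" by (auto simp: Basis_vec_def)
  have "x \<bullet> b = x $ i $ j" for x :: "real^'n^'m" by (simp add: b inner_axis)
  then show "((\<lambda>x. f x \<bullet> b) has_derivative (\<lambda>x. (x *\<^sub>R f') \<bullet> b)) (at t)"
    using assms[of i j] by (simp add: has_field_derivative_def mult_commute_abs)
qed

lemma bounded_bilinear_matrix_mult: "bounded_bilinear ((**) :: real^'n^'m \<Rightarrow> real^'p^'n \<Rightarrow> real^'p^'m)"
  unfolding bilinear_conv_bounded_bilinear[symmetric] bilinear_def
  by (intro conjI allI linearI)
     (simp_all add: matrix_matrix_mult_def vec_eq_iff algebra_simps sum.distrib sum_distrib_left)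

lemma bounded_bilinear_matrix_vector_mult: "bounded_bilinear ((*v) :: real^'n^'m \<Rightarrow> real^'n \<Rightarrow> real^'m)"
  unfolding bilinear_conv_bounded_bilinear[symmetric] bilinear_def
  by (intro conjI allI linearI)
     (simp_all add: matrix_vector_mult_def vec_eq_iff algebra_simps sum.distrib sum_distrib_left)

lemmas has_vector_derivative_matrix_mult = bounded_bilinear.has_vector_derivative[OF bounded_bilinear_matrix_mult]
lemmas continuous_on_matrix_mult = bounded_bilinear.continuous_on[OF bounded_bilinear_matrix_mult]
lemmas continuous_on_matrix_vector_mult = bounded_bilinear.continuous_on[OF bounded_bilinear_matrix_vector_mult]

lemma bounded_linear_transpose: "bounded_linear (transpose :: real^'n^'m \<Rightarrow> real^'m^'n)"
  by (intro linear_conv_bounded_linear[THEN iffD1] linearI)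
     (simp_all add: transpose_def vec_eq_iff)

text \<open>A crude majorant, the sum of all absolute entries, already compares every entry of the
  exponential series with a scalar exponential series.\<close>

lemma matrix_power_entry_bound:
  fixes A :: "real^'n^'n"
  shows "\<bar>matrix_power A k $ i $ j\<bar> \<le> (\<Sum>i\<in>UNIV. \<Sum>j\<in>UNIV. \<bar>A $ i $ j\<bar>) ^ k"
proof (induction k arbitrary: i j)
  case 0
  then show ?case by (simp add: mat_def)
next
  case (Suc k)
  let ?M = "\<Sum>i\<in>UNIV. \<Sum>j\<in>UNIV. \<bar>A $ i $ j\<bar>"
  have "\<bar>matrix_power A (Suc k) $ i $ j\<bar> \<le> (\<Sum>l\<in>UNIV. \<bar>A $ i $ l * matrix_power A k $ l $ j\<bar>)"
    by (simp add: matrix_matrix_mult_def sum_abs)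
  also have "\<dots> \<le> (\<Sum>l\<in>UNIV. \<bar>A $ i $ l\<bar> * ?M ^ k)"
    using Suc by (intro sum_mono) (simp add: abs_mult mult_left_mono)
  also have "\<dots> = (\<Sum>l\<in>UNIV. \<bar>A $ i $ l\<bar>) * ?M ^ k" by (simp add: sum_distrib_right)
  also have "\<dots> \<le> ?M * ?M ^ k"
    by (intro mult_right_mono member_le_sum[of i UNIV "\<lambda>i. \<Sum>j\<in>UNIV. \<bar>A $ i $ j\<bar>"] zero_le_power sum_nonneg) auto
  finally show ?case by simp
qed

lemma matrix_power_scaleR: "matrix_power (c *\<^sub>R A) k = c ^ k *\<^sub>R matrix_power A k"
proof (induction k)
  case (Suc k)
  then show ?case
    by (simp add: matrix_matrix_mult_def vec_eq_iff sum_distrib_left mult_ac)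
qed simp

lemma matrix_power_commute: "A ** matrix_power A k = matrix_power A k ** A"
proof (induction k)
  case (Suc k)
  then show ?case by (metis matrix_mul_assoc matrix_power.simps(2))
qed simp

lemma transpose_entry [simp]: "transpose A $ i $ j = A $ j $ i"
  by (simp add: transpose_def)

lemma transpose_matrix_power: "transpose (matrix_power A k) = matrix_power (transpose A) k"
proof (induction k)
  case (Suc k)
  then show ?case by (simp add: matrix_transpose_mul flip: matrix_power_commute)
qed (simp add: transpose_mat)

lemma summable_matrix_power_entry:
  fixes A :: "real^'n^'n"
  shows "summable (\<lambda>k. matrix_power A k $ i $ j / fact k * t ^ k)"
proof (rule summable_comparison_test')
  let ?M = "\<Sum>i\<in>UNIV. \<Sum>j\<in>UNIV. \<bar>A $ i $ j\<bar>"
  show "summable (\<lambda>k. inverse (fact k) * (?M * \<bar>t\<bar>) ^ k)" by (rule summable_exp)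
  show "norm (matrix_power A k $ i $ j / fact k * t ^ k) \<le> inverse (fact k) * (?M * \<bar>t\<bar>) ^ k" if "0 \<le> k" for k
    using mult_right_mono[OF matrix_power_entry_bound[of A k i j], of "inverse (fact k) * \<bar>t\<bar> ^ k"]
    by (simp add: abs_mult power_abs divide_inverse power_mult_distrib mult_ac)
qed

text \<open>Entry by entry the exponential along a line is a real power series in \<open>t\<close>
  that converges everywhere, so termwise differentiation becomes available.\<close>

lemma matrix_exp_entry:
  fixes A :: "real^'n^'n"
  shows "matrix_exp (t *\<^sub>R A) $ i $ j = (\<Sum>k. matrix_power A k $ i $ j / fact k * t ^ k)"
proof -
  have "(\<lambda>k. matrix_power (t *\<^sub>R A) k /\<^sub>R fact k) sums (\<chi> i j. \<Sum>k. matrix_power A k $ i $ j / fact k * t ^ k)"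
    unfolding sums_def
  proof (intro vec_tendstoI)
    fix i j
    have "(\<lambda>n. \<Sum>k<n. matrix_power A k $ i $ j / fact k * t ^ k) \<longlonglongrightarrow> (\<Sum>k. matrix_power A k $ i $ j / fact k * t ^ k)"
      using summable_matrix_power_entry[of A i j t] by (simp add: summable_LIMSEQ)
    then show "(\<lambda>n. (\<Sum>k<n. matrix_power (t *\<^sub>R A) k /\<^sub>R fact k) $ i $ j)
      \<longlonglongrightarrow> (\<chi> i j. \<Sum>k. matrix_power A k $ i $ j / fact k * t ^ k) $ i $ j"
      by (simp add: matrix_power_scaleR divide_inverse mult_ac)
  qed
  then show ?thesis by (simp add: matrix_exp_def sums_iff)
qed

lemma matrix_exp_0 [simp]: "matrix_exp (0 :: real^'n^'n) = mat 1"
proof -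
  have "matrix_exp (0 :: real^'n^'n) $ i $ j = mat 1 $ i $ j" for i j
    using matrix_exp_entry[of 0 "0 :: real^'n^'n" i j] powser_zero[of "\<lambda>k. matrix_power (0 :: real^'n^'n) k $ i $ j / fact k"]
    by simp
  then show ?thesis by (simp add: vec_eq_iff)
qed

lemma matrix_exp_entry_deriv:
  fixes A :: "real^'n^'n"
  shows "((\<lambda>t. matrix_exp (t *\<^sub>R A) $ i $ j) has_real_derivative (\<Sum>k. matrix_power A (Suc k) $ i $ j / fact k * t ^ k)) (at t)"
proof -
  have "diffs (\<lambda>k. matrix_power A k $ i $ j / fact k) = (\<lambda>k. matrix_power A (Suc k) $ i $ j / fact k)"
    by (simp add: diffs_def fun_eq_iff field_simps del: of_nat_Suc matrix_power.simps)
  then show ?thesis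
    using termdiffs_strong_converges_everywhere[OF summable_matrix_power_entry[of A i j], of t]
    unfolding matrix_exp_entry by simp
qed

text \<open>Termwise differentiation shifts the series by one. The additional factor
  \<open>A\<close> in \<open>matrix_power A (Suc k)\<close> can be split off on the left or on the
  right: the first gives the derivative, the comparison of the two gives the commutation.\<close>

lemma has_vector_derivative_matrix_exp:
  fixes A :: "real^'n^'n"
  shows "((\<lambda>t. matrix_exp (t *\<^sub>R A)) has_vector_derivative A ** matrix_exp (t *\<^sub>R A)) (at t)"
    and matrix_exp_commute: "A ** matrix_exp (t *\<^sub>R A) = matrix_exp (t *\<^sub>R A) ** A"
proof -
  have *: "(\<Sum>k. (\<Sum>l\<in>UNIV. c l * (matrix_power A k $ p l $ q l / fact k * t ^ k))) = (\<Sum>l\<in>UNIV. c l * matrix_exp (t *\<^sub>R A) $ p l $ q l)"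
    for c :: "'n \<Rightarrow> real" and p q
  proof -
    have "summable (\<lambda>k. c l * (matrix_power A k $ p l $ q l / fact k * t ^ k))" for l
      by (intro summable_mult summable_matrix_power_entry)
    then show ?thesis
      unfolding matrix_exp_entry by (simp only: suminf_sum suminf_mult[OF summable_matrix_power_entry])
  qed
  have 1: "(\<Sum>k. matrix_power A (Suc k) $ i $ j / fact k * t ^ k) = (A ** matrix_exp (t *\<^sub>R A)) $ i $ j" for i j
  proof -
    have "matrix_power A (Suc k) $ i $ j / fact k * t ^ k
        = (\<Sum>l\<in>UNIV. A $ i $ l * (matrix_power A k $ l $ j / fact k * t ^ k))" for k
      unfolding matrix_power.simps matrix_matrix_mult_def vec_lambda_beta sum_divide_distrib sum_distrib_right
      by (simp add: mult_ac)
    then show ?thesis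
      using *[of "\<lambda>l. A $ i $ l" "\<lambda>l. l" "\<lambda>l. j"] by (simp only:) (simp add: matrix_matrix_mult_def)
  qed
  have 2: "(\<Sum>k. matrix_power A (Suc k) $ i $ j / fact k * t ^ k) = (matrix_exp (t *\<^sub>R A) ** A) $ i $ j" for i j
  proof -
    have "matrix_power A (Suc k) $ i $ j / fact k * t ^ k
        = (\<Sum>l\<in>UNIV. A $ l $ j * (matrix_power A k $ i $ l / fact k * t ^ k))" for k
    proof -
      have "matrix_power A (Suc k) = matrix_power A k ** A" by (simp add: matrix_power_commute)
      then show ?thesis
        by (simp only: matrix_matrix_mult_def vec_lambda_beta sum_divide_distrib sum_distrib_right) (simp add: mult_ac)
    qed
    then show ?thesis
      using *[of "\<lambda>l. A $ l $ j" "\<lambda>l. i" "\<lambda>l. l"]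
      by (simp only:) (simp add: matrix_matrix_mult_def mult.commute)
  qed
  show "((\<lambda>t. matrix_exp (t *\<^sub>R A)) has_vector_derivative A ** matrix_exp (t *\<^sub>R A)) (at t)"
    by (rule has_vector_derivative_matrixI) (subst 1[symmetric], rule matrix_exp_entry_deriv)
  show "A ** matrix_exp (t *\<^sub>R A) = matrix_exp (t *\<^sub>R A) ** A"
    using 1 2 by (simp add: vec_eq_iff)
qed

lemma transpose_matrix_exp:
  fixes A :: "real^'n^'n"
  shows "transpose (matrix_exp (t *\<^sub>R A)) = matrix_exp (t *\<^sub>R transpose A)"
proof -
  have "matrix_power (transpose A) k $ i $ j = matrix_power A k $ j $ i" for k i j
    unfolding transpose_matrix_power[symmetric] by simp
  then show ?thesis
    by (simp add: vec_eq_iff matrix_exp_entry)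
qed

lemma continuous_on_matrix_exp:
  fixes A :: "real^'n^'n"
  shows "continuous_on S (\<lambda>t. matrix_exp (t *\<^sub>R A))"
  by (intro continuous_at_imp_continuous_on ballI has_vector_derivative_continuous)
     (rule has_vector_derivative_matrix_exp)

text \<open>The product of the exponentials at \<open>s + t\<close> and at \<open>- t\<close> has
  derivative zero in \<open>t\<close>, because \<open>A\<close> commutes with both, so it equals the
  exponential at \<open>s\<close>. The case \<open>s = 0\<close> shows that the exponentials at
  \<open>t\<close> and \<open>- t\<close> are inverse to each other.\<close>

lemma matrix_exp_add:
  fixes A :: "real^'n^'n"
  shows "matrix_exp ((s + t) *\<^sub>R A) = matrix_exp (s *\<^sub>R A) ** matrix_exp (t *\<^sub>R A)"
proof -
  let ?E = "\<lambda>t. matrix_exp (t *\<^sub>R A)"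
  have const: "?E (s + t) ** ?E (- t) = ?E s" for s t
  proof -
    have "((\<lambda>t. ?E (s + t) ** ?E (- t)) has_vector_derivative 0) (at t)" for t
    proof -
      have 1: "((\<lambda>t. ?E (s + t)) has_vector_derivative (1 *\<^sub>R (A ** ?E (s + t)))) (at t)"
      proof -
        have "((\<lambda>t. s + t) has_vector_derivative 1) (at t)"
          by (auto intro!: derivative_eq_intros simp flip: has_real_derivative_iff_has_vector_derivative)
        from vector_diff_chain_at[OF this, of ?E "A ** ?E (s + t)"] has_vector_derivative_matrix_exp(1)[of A "s + t"]
        show ?thesis by (simp add: comp_def)
      qed
      have 2: "((\<lambda>t. ?E (- t)) has_vector_derivative ((-1) *\<^sub>R (A ** ?E (- t)))) (at t)"
      proof -
        have "((\<lambda>t. - t) has_vector_derivative (-1)) (at t)"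
          by (auto intro!: derivative_eq_intros simp flip: has_real_derivative_iff_has_vector_derivative)
        from vector_diff_chain_at[OF this, of ?E "A ** ?E (- t)"] has_vector_derivative_matrix_exp(1)[of A "- t"]
        show ?thesis by (simp add: comp_def)
      qed
      have neg: "X ** (- Y) = - (X ** Y)" for X Y :: "real^'n^'n"
        by (rule bounded_bilinear.minus_right[OF bounded_bilinear_matrix_mult])
      have "?E (s + t) ** ((-1) *\<^sub>R (A ** ?E (- t))) + (1 *\<^sub>R (A ** ?E (s + t))) ** ?E (- t) = 0"
        by (simp add: neg) (simp add: matrix_exp_commute matrix_mul_assoc)
      then show ?thesis using has_vector_derivative_matrix_mult[OF 1 2] by simp
    qed
    then obtain c where "\<And>t. ?E (s + t) ** ?E (- t) = c"
      using has_vector_derivative_zero_constant[of UNIV "\<lambda>t. ?E (s + t) ** ?E (- t)"] by auto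
    from this[of t] this[of 0] show ?thesis by simp
  qed
  have "?E (- t) ** ?E t = mat 1" using const[of 0 "- t"] by simp
  then have "?E (s + t) = (?E (s + t) ** ?E (- t)) ** ?E t"
    by (simp add: matrix_mul_assoc[symmetric])
  then show ?thesis by (simp only: const)
qed

text \<open>A permutation other than the identity moves at least two points, \<open>k\<close> and
  \<open>p k\<close>. After one factor is dropped, the product of entries of the identity matrix
  still contains a zero.\<close>

lemma prod_permutation_derivative_at_identity:
  fixes D :: "real^'n^'n"
  assumes "p permutes (UNIV::'n set)"
  shows "(\<Sum>i\<in>UNIV. D $ i $ p i * (\<Prod>j\<in>UNIV - {i}. (mat 1 :: real^'n^'n) $ j $ p j)) = (if p = id then trace D else 0)"
proof (cases "p = id")
  case True
  then show ?thesis by (simp add: mat_def trace_def)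
next
  case False
  have "(\<Prod>j\<in>UNIV - {i}. (mat 1 :: real^'n^'n) $ j $ p j) = 0" for i
  proof -
    obtain k where k: "p k \<noteq> k" using False by (auto simp: fun_eq_iff)
    have "p (p k) \<noteq> p k" using k assms by (metis permutes_def)
    then obtain j where "j \<noteq> i" "p j \<noteq> j" using k by metis
    then show ?thesis by (intro prod_zero) (auto simp: mat_def intro!: bexI[of _ j])
  qed
  then show ?thesis using False by (simp only: mult_zero_right sum.neutral_const if_False)
qed

text \<open>Liouville's formula. The derivative of the determinant at 0 is read off the permutation
  expansion, the group law transports it to every \<open>t\<close>, and the determinant times
  \<open>exp (- (t * trace A))\<close> is then constant.\<close>

lemma det_matrix_exp:
  fixes A :: "real^'n^'n"
  shows "det (matrix_exp (t *\<^sub>R A)) = exp (t * trace A)"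
proof -
  let ?E = "\<lambda>t. matrix_exp (t *\<^sub>R A)"
  let ?g = "\<lambda>t. det (?E t)"
  have e: "((\<lambda>t. ?E t $ i $ j) has_real_derivative A $ i $ j) (at 0)" for i j
    using matrix_exp_entry_deriv[of A i j 0] powser_zero[of "\<lambda>k. matrix_power A (Suc k) $ i $ j / fact k"] by simp
  have 0: "(?g has_real_derivative trace A) (at 0)"
  proof -
    have "(?g has_real_derivative (\<Sum>p\<in>{p. p permutes (UNIV::'n set)}.
        of_int (sign p) * (\<Sum>i\<in>UNIV. A $ i $ p i * (\<Prod>j\<in>UNIV - {i}. ?E 0 $ j $ p j)))) (at 0)"
      unfolding det_def by (intro DERIV_sum DERIV_cmult has_field_derivative_prod e)
    also have "(\<Sum>p\<in>{p. p permutes (UNIV::'n set)}. of_int (sign p) * (\<Sum>i\<in>UNIV. A $ i $ p i * (\<Prod>j\<in>UNIV - {i}. ?E 0 $ j $ p j)))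
        = (\<Sum>p\<in>{p. p permutes (UNIV::'n set)}. if p = id then trace A else 0)"
      unfolding scaleR_zero_left matrix_exp_0
      by (intro sum.cong refl) (auto simp: prod_permutation_derivative_at_identity sign_id)
    also have "\<dots> = trace A" by (simp add: finite_permutations permutes_id)
    finally show ?thesis .
  qed
  have d: "(?g has_real_derivative ?g t * trace A) (at t)" for t
  proof -
    have "((\<lambda>s. ?g t * ?g (s - t)) has_real_derivative ?g t * trace A) (at t)"
      by (rule DERIV_cmult) (use 0 DERIV_shift[of ?g "trace A" t "- t"] in simp)
    moreover have "?g t * ?g (s - t) = ?g s" for s
      using matrix_exp_add[of t "s - t" A] by (simp add: det_mul)
    ultimately show ?thesis by simp
  qed
  have "((\<lambda>t. ?g t * exp (- (t * trace A))) has_real_derivative 0) (at t)" for t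
    by (rule derivative_eq_intros d refl | simp add: algebra_simps)+
  then obtain c where c: "\<And>t. ?g t * exp (- (t * trace A)) = c"
    using has_field_derivative_zero_constant[of UNIV "\<lambda>t. ?g t * exp (- (t * trace A))"] by auto
  have "c = 1" using c[of 0] by simp
  with c[of t] show ?thesis by (simp add: exp_minus field_simps)
qed

text \<open>The minimum of the form on the unit sphere is attained, hence positive, and extends to
  all vectors by homogeneity.\<close>

lemma pos_def_lower_bound:
  fixes A :: "real^'n^'n"
  assumes "pos_def A"
  obtains l where "l > 0" "\<And>x. l * (norm x)\<^sup>2 \<le> (A *v x) \<bullet> x"
proof -
  let ?q = "\<lambda>x. (A *v x) \<bullet> x"
  have "continuous_on (sphere 0 1) ?q"
    by (intro continuous_intros matrix_vector_mult_linear_continuous_on)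
  moreover have "sphere (0::real^'n) 1 \<noteq> {}" by simp
  ultimately obtain x0 where x0: "x0 \<in> sphere 0 1" "\<And>y. y \<in> sphere 0 1 \<Longrightarrow> ?q x0 \<le> ?q y"
    using continuous_attains_inf[of "sphere 0 1" ?q] by auto
  have "?q x0 > 0" using assms x0(1) unfolding pos_def_def by (metis mem_sphere_0 norm_zero zero_neq_one)
  moreover have "?q x0 * (norm x)\<^sup>2 \<le> ?q x" for x
  proof (cases "x = 0")
    case False
    then have "?q x0 \<le> ?q ((1 / norm x) *\<^sub>R x)" by (intro x0) simp
    also have "\<dots> = ?q x / (norm x)\<^sup>2" by (simp add: matrix_vector_mult_scaleR power2_eq_square)
    finally show ?thesis using False by (simp add: field_simps)
  qed simp
  ultimately show ?thesis by (rule that)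
qed

text \<open>One term of the exponential series is at most its sum:
  \<open>y ^ k / fact k \<le> exp y\<close> at \<open>y = l * (1 + x)\<close>. This gives the
  constant \<open>fact k / l ^ k * exp l\<close>.\<close>

lemma exp_dominates_power:
  fixes l :: real
  assumes "l > 0"
  obtains K where "K > 0" "\<And>x. 0 \<le> x \<Longrightarrow> (1 + x) ^ k * exp (- (l * x)) \<le> K"
proof
  show "fact k / l ^ k * exp l > 0" using assms by simp
  fix x :: real assume x: "0 \<le> x"
  define y where "y = l * (1 + x)"
  have "y \<ge> 0" using x assms by (simp add: y_def)
  then have "y ^ k / fact k \<le> exp y"
    using sum_le_suminf[OF summable_exp_generic[of y], of "{k}"] by (simp add: exp_def divide_inverse mult.commute)
  moreover have "y ^ k = l ^ k * (1 + x) ^ k" by (simp add: y_def power_mult_distrib)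
  moreover have "exp y = exp l * exp (l * x)" by (simp add: y_def distrib_left exp_add)
  ultimately have "(1 + x) ^ k \<le> fact k / l ^ k * exp l * exp (l * x)"
    using assms by (simp add: pos_divide_le_eq pos_le_divide_eq mult_ac)
  then show "(1 + x) ^ k * exp (- (l * x)) \<le> fact k / l ^ k * exp l"
    by (simp add: exp_minus pos_divide_le_eq flip: divide_inverse)
qed

section \<open>The flow and the covariance of the Kolmogorov operator\<close>

lemma one_plus_square [simp]: "0 < 1 + (x::real)\<^sup>2" "1 + (x::real)\<^sup>2 \<noteq> 0" "0 \<le> 1 + (x::real)\<^sup>2"
  using zero_le_power2[of x] by linarith+

text \<open>\<open>trace_B\<close> acts through \<open>det_flow_ge_1\<close>, the source of the
  contraction of L1; \<open>Q_psd\<close> acts through \<open>covq_nonneg\<close>, which keeps the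
  Gaussian factor of the modes at most 1.\<close>

locale kolmogorov =
  fixes Q B :: "real^'n^'n"
  assumes Q_sym: "transpose Q = Q"
    and Q_psd: "pos_semidef Q"
    and K_pos: "\<And>t. t > 0 \<Longrightarrow> pos_def (K_mat Q B t)"
    and trace_B: "trace B \<ge> 0"
begin

definition flow :: "real \<Rightarrow> real^'n^'n" where
  "flow \<tau> = matrix_exp (\<tau> *\<^sub>R B)"

definition cov_rate :: "real \<Rightarrow> real^'n^'n" where
  "cov_rate \<tau> = flow \<tau> ** Q ** transpose (flow \<tau>)"

text \<open>An oriented interval integral, so that \<open>cov\<close> is differentiable on the whole
  line, including at 0; for \<open>\<tau> > 0\<close> it is \<open>\<tau>\<close> times
  \<open>K_mat Q B \<tau>\<close>.\<close>

definition cov :: "real \<Rightarrow> real^'n^'n" where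
  "cov \<tau> = (LBINT \<sigma>=0..ereal \<tau>. cov_rate \<sigma>)"

definition freq :: "real \<Rightarrow> real^'n \<Rightarrow> real^'n" where
  "freq \<tau> \<xi> = transpose (flow \<tau>) *v \<xi>"

definition covq :: "real \<Rightarrow> real^'n \<Rightarrow> real" where
  "covq \<tau> \<xi> = (cov \<tau> *v \<xi>) \<bullet> \<xi>"

lemma flow_0 [simp]: "flow 0 = mat 1"
  by (simp add: flow_def)

lemma flow_add: "flow (s + t) = flow s ** flow t"
  by (simp add: flow_def matrix_exp_add)

lemma flow_deriv: "(flow has_vector_derivative B ** flow \<tau>) (at \<tau>)"
  unfolding flow_def using has_vector_derivative_matrix_exp(1)[of B \<tau>] .

lemma flow_commute: "B ** flow \<tau> = flow \<tau> ** B"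
  unfolding flow_def by (rule matrix_exp_commute)

lemma continuous_on_flow: "continuous_on S flow"
  unfolding flow_def by (rule continuous_on_matrix_exp)

lemma flow_inverse: "flow \<tau> ** flow (- \<tau>) = mat 1"
  by (simp flip: flow_add)

lemma det_flow_ge_1: "0 \<le> \<tau> \<Longrightarrow> 1 \<le> det (flow \<tau>)"
  using trace_B by (simp add: flow_def det_matrix_exp)

lemma continuous_on_cov_rate: "continuous_on S cov_rate"
  unfolding cov_rate_def
  by (intro continuous_on_matrix_mult continuous_on_flow continuous_on_const
      bounded_linear.continuous_on[OF bounded_linear_transpose])

lemma cov_0 [simp]: "cov 0 = 0"
  by (simp add: cov_def zero_ereal_def[symmetric])

lemma cov_deriv: "(cov has_vector_derivative cov_rate \<tau>) (at \<tau>)"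
proof -
  \<comment> \<open>An interval with 0 and \<open>\<tau>\<close> in its interior, whatever the sign
    of \<open>\<tau>\<close>.\<close>
  let ?a = "min 0 \<tau> - 1" and ?b = "max 0 \<tau> + 1"
  have "((\<lambda>u. LBINT y=ereal 0..ereal u. cov_rate y) has_vector_derivative cov_rate \<tau>) (at \<tau> within {?a..?b})"
    by (rule interval_integral_FTC2) (auto intro: continuous_on_cov_rate)
  moreover have "at \<tau> within {?a..?b} = at \<tau>"
    by (rule at_within_interior) auto
  ultimately show ?thesis by (simp add: cov_def[abs_def] zero_ereal_def)
qed

lemma continuous_on_cov: "continuous_on S cov"
  by (intro continuous_at_imp_continuous_on ballI has_vector_derivative_continuous) (rule cov_deriv)

lemma cov_eq_K_mat: "0 < \<tau> \<Longrightarrow> \<tau> *\<^sub>R K_mat Q B \<tau> = cov \<tau>"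
  unfolding K_mat_def cov_def zero_ereal_def
  by (subst interval_integral_Icc) (simp_all add: cov_rate_def[abs_def] flow_def transpose_matrix_exp)

lemma pos_def_cov: "0 < \<tau> \<Longrightarrow> pos_def (cov \<tau>)"
  using K_pos[of \<tau>] unfolding pos_def_def
  by (auto simp flip: cov_eq_K_mat simp: scaleR_matrix_vector_assoc[symmetric])

text \<open>The difference between \<open>cov\<close> and its transpose has derivative zero, because
  the rate is symmetric, and vanishes at 0.\<close>

lemma transpose_cov: "transpose (cov \<tau>) = cov \<tau>"
proof -
  have sym: "transpose (cov_rate t) = cov_rate t" for t
    unfolding cov_rate_def by (simp add: matrix_transpose_mul Q_sym matrix_mul_assoc)
  have "((\<lambda>t. transpose (cov t) - cov t) has_vector_derivative transpose (cov_rate t) - cov_rate t) (at t)" for t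
    by (intro has_vector_derivative_diff cov_deriv bounded_linear.has_vector_derivative[OF bounded_linear_transpose])
  then obtain c where "\<And>t. transpose (cov t) - cov t = c"
    using has_vector_derivative_zero_constant[of UNIV "\<lambda>t. transpose (cov t) - cov t"] by (auto simp: sym)
  from this[of \<tau>] this[of 0] show ?thesis by (simp add: linear_0[OF bounded_linear.linear[OF bounded_linear_transpose]])
qed

lemma freq_add: "freq (s + t) \<xi> = freq t (freq s \<xi>)"
  unfolding freq_def flow_add matrix_transpose_mul by (simp only: matrix_vector_mul_assoc)

lemma freq_inner: "freq \<tau> \<xi> \<bullet> X = \<xi> \<bullet> (flow \<tau> *v X)"
  unfolding freq_def by (metis dot_lmul_matrix transpose_matrix_vector)

lemma continuous_on_freq [continuous_intros]:
  assumes "continuous_on S f" "continuous_on S g"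
  shows "continuous_on S (\<lambda>x. freq (f x) (g x))"
  unfolding freq_def
  by (intro continuous_on_matrix_vector_mult assms bounded_linear.continuous_on[OF bounded_linear_transpose]
      continuous_on_compose2[OF continuous_on_flow[of UNIV] assms(1)]) auto

lemma continuous_on_covq [continuous_intros]:
  assumes "continuous_on S f" "continuous_on S g"
  shows "continuous_on S (\<lambda>x. covq (f x) (g x))"
  unfolding covq_def
  by (intro continuous_on_inner continuous_on_matrix_vector_mult assms
      continuous_on_compose2[OF continuous_on_cov[of UNIV] assms(1)]) auto

text \<open>Because \<open>B\<close> commutes with the flow, the derivative can be placed on
  \<open>X\<close>: it becomes the pairing of the frequency with the drift
  \<open>B *v X\<close>.\<close>

lemma freq_inner_deriv: "((\<lambda>\<tau>. freq \<tau> \<xi> \<bullet> X) has_real_derivative freq \<tau> \<xi> \<bullet> (B *v X)) (at \<tau>)"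
proof -
  have "bounded_linear (\<lambda>M::real^'n^'n. \<xi> \<bullet> (M *v X))"
    by (intro bounded_linear_inner_right_comp bounded_bilinear.bounded_linear_left[OF bounded_bilinear_matrix_vector_mult])
  from bounded_linear.has_vector_derivative[OF this flow_deriv[of \<tau>]] show ?thesis
    by (simp add: has_real_derivative_iff_has_vector_derivative freq_inner flow_commute matrix_vector_mul_assoc)
qed

lemma covq_deriv: "((\<lambda>\<tau>. covq \<tau> \<xi>) has_real_derivative (Q *v freq \<tau> \<xi>) \<bullet> freq \<tau> \<xi>) (at \<tau>)"
proof -
  have "bounded_linear (\<lambda>M::real^'n^'n. (M *v \<xi>) \<bullet> \<xi>)"
    by (intro bounded_linear_inner_left_comp bounded_bilinear.bounded_linear_left[OF bounded_bilinear_matrix_vector_mult])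
  from bounded_linear.has_vector_derivative[OF this cov_deriv[of \<tau>]]
  have "((\<lambda>\<tau>. covq \<tau> \<xi>) has_real_derivative (cov_rate \<tau> *v \<xi>) \<bullet> \<xi>) (at \<tau>)"
    by (simp add: has_real_derivative_iff_has_vector_derivative covq_def)
  moreover have "(cov_rate \<tau> *v \<xi>) \<bullet> \<xi> = (Q *v freq \<tau> \<xi>) \<bullet> freq \<tau> \<xi>"
    unfolding cov_rate_def freq_def
    by (metis dot_lmul_matrix inner_commute matrix_vector_mul_assoc transpose_matrix_vector)
  ultimately show ?thesis by simp
qed

lemma covq_nonneg: assumes "0 \<le> \<tau>" shows "0 \<le> covq \<tau> \<xi>"
proof -
  have "covq 0 \<xi> \<le> covq \<tau> \<xi>"
  proof (rule DERIV_nonneg_imp_nondecreasing[OF assms])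
    fix x
    show "\<exists>y. ((\<lambda>\<tau>. covq \<tau> \<xi>) has_real_derivative y) (at x) \<and> 0 \<le> y"
      using covq_deriv[of \<xi> x] Q_psd unfolding pos_semidef_def by blast
  qed
  then show ?thesis by (simp add: covq_def)
qed

text \<open>The cocycle identity of the covariance along the flow: both sides have the same
  derivative in \<open>t\<close> and agree at \<open>t = 0\<close>. It is what isolates the last
  unit of time in \<open>freq_decay\<close>.\<close>

lemma covq_add: "covq (s + t) \<xi> = covq s \<xi> + covq t (freq s \<xi>)"
proof -
  have "((\<lambda>t. covq (s + t) \<xi> - covq t (freq s \<xi>)) has_real_derivative 0) (at t)" for t
  proof -
    have "((\<lambda>t. covq (t + s) \<xi>) has_real_derivative (Q *v freq (t + s) \<xi>) \<bullet> freq (t + s) \<xi>) (at t)"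
      using covq_deriv[of \<xi> "t + s"] unfolding DERIV_shift .
    then have "((\<lambda>t. covq (s + t) \<xi>) has_real_derivative (Q *v freq (s + t) \<xi>) \<bullet> freq (s + t) \<xi>) (at t)"
      by (simp only: add.commute)
    from DERIV_diff[OF this covq_deriv[of "freq s \<xi>" t]] show ?thesis by (simp add: freq_add)
  qed
  then obtain c where "\<And>t. covq (s + t) \<xi> - covq t (freq s \<xi>) = c"
    using has_field_derivative_zero_constant[of UNIV "\<lambda>t. covq (s + t) \<xi> - covq t (freq s \<xi>)"] by auto
  from this[of t] this[of 0] show ?thesis by (simp add: covq_def)
qed

lemma flow_bounded:
  obtains L where "L \<ge> 1" "\<And>\<tau> x. \<bar>\<tau>\<bar> \<le> 1 \<Longrightarrow> norm (flow \<tau> *v x) \<le> L * norm x"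
    "\<And>\<tau> x. \<bar>\<tau>\<bar> \<le> 1 \<Longrightarrow> norm (freq \<tau> x) \<le> L * norm x"
proof -
  obtain K1 where K1: "K1 > 0" "\<And>(M::real^'n^'n) (x::real^'n). norm (M *v x) \<le> norm M * norm x * K1"
    using bounded_bilinear.pos_bounded[OF bounded_bilinear_matrix_vector_mult] by blast
  have bd: "\<exists>D>0. \<forall>\<tau>\<in>{-1..1}. norm (f \<tau>) \<le> D" if "continuous_on {-1..1} f" for f :: "real \<Rightarrow> real^'n^'n"
    using compact_imp_bounded[OF compact_continuous_image[OF that compact_Icc]] unfolding bounded_pos by auto
  obtain D1 where D1: "D1 > 0" "\<And>\<tau>. \<tau> \<in> {-1..1} \<Longrightarrow> norm (flow \<tau>) \<le> D1"
    using bd[OF continuous_on_flow] by blast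
  obtain D2 where D2: "D2 > 0" "\<And>\<tau>. \<tau> \<in> {-1..1} \<Longrightarrow> norm (transpose (flow \<tau>)) \<le> D2"
    using bd[OF bounded_linear.continuous_on[OF bounded_linear_transpose continuous_on_flow]] by blast
  let ?L = "1 + (D1 + D2) * K1"
  have le: "norm ((M::real^'n^'n) *v x) \<le> ?L * norm x" if "norm M \<le> D1 + D2" for M x
  proof -
    have "norm (M *v x) \<le> (norm M * K1) * norm x" using K1(2)[of M x] by (simp add: mult_ac)
    also have "\<dots> \<le> ?L * norm x"
      using that K1 by (intro mult_right_mono order_trans[OF mult_right_mono[OF that]]) auto
    finally show ?thesis .
  qed
  show ?thesis
  proof (rule that[of ?L])
    show "1 \<le> ?L" using K1 D1 D2 by simp
    show "norm (flow \<tau> *v x) \<le> ?L * norm x" if "\<bar>\<tau>\<bar> \<le> 1" for \<tau> x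
      using D1(2)[of \<tau>] D2(1) that by (intro le) (auto simp: abs_le_iff)
    show "norm (freq \<tau> x) \<le> ?L * norm x" if "\<bar>\<tau>\<bar> \<le> 1" for \<tau> x
      unfolding freq_def using D2(2)[of \<tau>] D1(1) that by (intro le) (auto simp: abs_le_iff)
  qed
qed

text \<open>The growth of the flow is harmless: for \<open>\<tau> \<ge> 1\<close> the part of \<open>covq \<tau> \<xi>\<close> that comes from the
  last unit of time already dominates the square of \<open>freq \<tau> \<xi>\<close>.\<close>

lemma freq_decay:
  obtains K where "K > 0"
    "\<And>\<tau> \<xi>. 0 \<le> \<tau> \<Longrightarrow> jap (freq \<tau> \<xi>) ^ k * exp (- covq \<tau> \<xi>) \<le> K * jap \<xi> ^ k"
proof -
  obtain L where L: "L \<ge> 1" "\<And>\<tau> x. \<bar>\<tau>\<bar> \<le> 1 \<Longrightarrow> norm (freq \<tau> x) \<le> L * norm x"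
    using flow_bounded by metis
  obtain l where l: "l > 0" "\<And>x. l * (norm x)\<^sup>2 \<le> (cov 1 *v x) \<bullet> x"
    using pos_def_lower_bound[OF pos_def_cov[of 1]] by auto
  obtain K where K: "K > 0" "\<And>x. 0 \<le> x \<Longrightarrow> (1 + x) ^ k * exp (- (l * x)) \<le> K"
    using exp_dominates_power[OF l(1)] by metis
  have japL: "jap (freq \<tau> x) ^ k \<le> L ^ (2 * k) * jap x ^ k" if "\<bar>\<tau>\<bar> \<le> 1" for \<tau> x
  proof -
    have "(norm (freq \<tau> x))\<^sup>2 \<le> (L * norm x)\<^sup>2" by (intro power_mono L that) simp
    moreover have "1 \<le> L\<^sup>2" using L by (simp add: one_le_power)
    ultimately have "jap (freq \<tau> x) \<le> L\<^sup>2 * jap x" by (simp add: distrib_left power_mult_distrib)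
    then have "jap (freq \<tau> x) ^ k \<le> (L\<^sup>2 * jap x) ^ k" by (intro power_mono) auto
    then show ?thesis by (simp add: power_mult_distrib power_mult)
  qed
  show ?thesis
  \<comment> \<open>In \<open>1 + K\<close> the 1 serves \<open>\<tau> \<le> 1\<close>, where
    \<open>freq\<close> stretches by at most \<open>L\<close>, and \<open>K\<close> serves
    \<open>\<tau> > 1\<close>, where the Gaussian factor is spent.\<close>
  proof (rule that[of "L ^ (2 * k) * (1 + K)"])
    show "0 < L ^ (2 * k) * (1 + K)" using L K by (intro mult_pos_pos) auto
    fix \<tau> :: real and \<xi> :: "real^'n" assume \<tau>: "0 \<le> \<tau>"
    have jk: "1 \<le> jap \<xi> ^ k" by (intro one_le_power jap_ge_1)
    show "jap (freq \<tau> \<xi>) ^ k * exp (- covq \<tau> \<xi>) \<le> L ^ (2 * k) * (1 + K) * jap \<xi> ^ k"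
    proof (cases "\<tau> \<le> 1")
      case True
      have "jap (freq \<tau> \<xi>) ^ k * exp (- covq \<tau> \<xi>) \<le> L ^ (2 * k) * jap \<xi> ^ k * 1"
        using True \<tau> L by (intro mult_mono japL) (auto simp: covq_nonneg intro!: mult_nonneg_nonneg)
      also have "\<dots> \<le> L ^ (2 * k) * (1 + K) * jap \<xi> ^ k"
        using K L by (simp add: mult.assoc distrib_left distrib_right)
      finally show ?thesis .
    next
      case False
      define \<zeta> where "\<zeta> = freq (\<tau> - 1) \<xi>"
      have f: "freq \<tau> \<xi> = freq 1 \<zeta>" using freq_add[of "\<tau> - 1" 1 \<xi>] by (simp add: \<zeta>_def)
      have c: "covq \<tau> \<xi> = covq (\<tau> - 1) \<xi> + covq 1 \<zeta>" using covq_add[of "\<tau> - 1" 1 \<xi>] by (simp add: \<zeta>_def)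
      have "covq \<tau> \<xi> \<ge> l * (norm \<zeta>)\<^sup>2"
        using l(2)[of \<zeta>] covq_nonneg[of "\<tau> - 1" \<xi>] False unfolding c by (simp add: covq_def)
      then have "jap (freq \<tau> \<xi>) ^ k * exp (- covq \<tau> \<xi>) \<le> (L ^ (2 * k) * jap \<zeta> ^ k) * exp (- (l * (norm \<zeta>)\<^sup>2))"
        unfolding f using L by (intro mult_mono japL) (auto intro!: mult_nonneg_nonneg)
      also have "\<dots> \<le> L ^ (2 * k) * K"
        unfolding mult.assoc using L by (intro mult_left_mono K) auto
      also have "\<dots> \<le> L ^ (2 * k) * (1 + K) * 1" using L by simp
      also have "\<dots> \<le> L ^ (2 * k) * (1 + K) * jap \<xi> ^ k"
        using L K jk by (intro mult_left_mono) auto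
      finally show ?thesis .
    qed
  qed
qed

text \<open>The inverse of \<open>K_mat Q B \<tau>\<close> is \<open>\<tau>\<close> times the
  inverse of \<open>cov \<tau>\<close>, and this factor cancels the \<open>\<tau>\<close> in the
  denominator of the exponent.\<close>

lemma kol_kernel_eq:
  assumes "0 < \<tau>"
  shows "kol_kernel Q B X Y \<tau> = gauss_density (cov \<tau>) (Y - flow \<tau> *v X)"
proof -
  have K: "K_mat Q B \<tau> = (1 / \<tau>) *\<^sub>R cov \<tau>" using cov_eq_K_mat[OF assms, symmetric] assms by simp
  have "det (cov \<tau>) \<noteq> 0"
  proof -
    obtain M where M: "cov \<tau> = M ** transpose M" "det M \<noteq> 0"
      using pos_def_factorization[OF transpose_cov pos_def_cov[OF assms]] by auto
    then show ?thesis by (simp add: det_mul)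
  qed
  then have "K_mat Q B \<tau> ** (\<tau> *\<^sub>R matrix_inv (cov \<tau>)) = mat 1"
    using assms unfolding K
    by (simp add: bounded_bilinear.scaleR_left[OF bounded_bilinear_matrix_mult]
        bounded_bilinear.scaleR_right[OF bounded_bilinear_matrix_mult] matrix_inv_right_det)
  then have "matrix_inv (K_mat Q B \<tau>) = \<tau> *\<^sub>R matrix_inv (cov \<tau>)" by (rule matrix_inv_eqI)
  then show ?thesis
    using assms unfolding kol_kernel_def gauss_density_def cov_eq_K_mat[OF assms]
    by (simp add: Let_def flow_def scaleR_matrix_vector_assoc[symmetric])
qed

end

section \<open>The partial Fourier transform of a Schwartz function\<close>

text \<open>Only the space variable is transformed: on the time variable the semigroup acts by the
  mere shift to \<open>t - \<tau>\<close>.\<close>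

definition partial_FT :: "('a::euclidean_space \<times> real \<Rightarrow> real) \<Rightarrow> real \<Rightarrow> 'a \<Rightarrow> complex" where
  "partial_FT v r \<xi> = (LINT Y|lborel. exp (- (\<i> * of_real (\<xi> \<bullet> Y))) * of_real (v (Y, r)))"

lemma jap_fst_le: "jap (fst p) \<le> jap p" and jap_snd_le: "jap (snd p) \<le> jap p"
  by (cases p; simp add: norm_Pair)+

text \<open>Of the \<open>Suc DIM('a)\<close> powers of the weight in space-time,
  \<open>DIM('a)\<close> go to space and one to time. The latter survives the Fourier transform and
  later makes the integral over \<open>\<tau>\<close> converge.\<close>

lemma schwartz_slice_bound:
  fixes v :: "'a::euclidean_space \<times> real \<Rightarrow> real"
  assumes "v \<in> schwartz"
  obtains C where "C > 0" "\<And>Y r. \<bar>v (Y, r)\<bar> \<le> C / (jap Y ^ DIM('a) * jap r)"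
proof -
  obtain C where C: "C > 0" "\<And>x. \<bar>v x\<bar> \<le> C / jap x ^ Suc DIM('a)" using schwartz_bound[OF assms] by blast
  have "\<bar>v (Y, r)\<bar> \<le> C / (jap Y ^ DIM('a) * jap r)" for Y r
  proof -
    have "jap Y ^ DIM('a) * jap r \<le> jap (Y, r) ^ DIM('a) * jap (Y, r)"
      using jap_fst_le[of "(Y, r)"] jap_snd_le[of "(Y, r)"] by (intro mult_mono power_mono) auto
    then have "C / jap (Y, r) ^ Suc DIM('a) \<le> C / (jap Y ^ DIM('a) * jap r)"
      using C by (intro divide_left_mono) (auto simp: mult.commute intro!: mult_pos_pos zero_less_power)
    with C(2)[of "(Y, r)"] show ?thesis by linarith
  qed
  with C(1) show ?thesis by (rule that)
qed

lemma schwartz_slice_integrable: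
  fixes v :: "'a::euclidean_space \<times> real \<Rightarrow> real"
  assumes "v \<in> schwartz"
  shows "integrable lborel (\<lambda>Y. v (Y, r))"
proof -
  obtain C where C: "C > 0" "\<And>Y r. \<bar>v (Y, r)\<bar> \<le> C / (jap Y ^ DIM('a) * jap r)"
    using schwartz_slice_bound[OF assms] by blast
  note [measurable] = schwartz_measurable[OF assms]
  show ?thesis
  proof (rule Bochner_Integration.integrable_bound[OF integrable_mult_right[OF integrable_jap_power[OF order_refl], of "C / jap r"]])
    show "AE Y in lborel. norm (v (Y, r)) \<le> norm (C / jap r * (1 / jap Y ^ DIM('a)))"
      using C by (auto simp: mult.commute less_imp_le)
  qed measurable
qed

lemma norm_exp_ii [simp]: "norm (exp (- (\<i> * of_real x))) = 1" "norm (exp (\<i> * of_real x)) = 1"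
  by (simp_all add: norm_exp_eq_Re)

lemma partial_FT_integrable:
  fixes v :: "'a::euclidean_space \<times> real \<Rightarrow> real"
  assumes "v \<in> schwartz"
  shows "integrable lborel (\<lambda>Y. exp (- (\<i> * of_real (\<xi> \<bullet> Y))) * of_real (v (Y, r)))"
proof -
  note [measurable] = schwartz_measurable[OF assms]
  show ?thesis
    by (rule Bochner_Integration.integrable_bound[OF schwartz_slice_integrable[OF assms, of r]])
       (auto simp: norm_mult)
qed

lemma measurable_partial_FT [measurable (raw)]:
  fixes v :: "'a::euclidean_space \<times> real \<Rightarrow> real"
  assumes v: "v \<in> schwartz" and [measurable]: "f \<in> borel_measurable M" "g \<in> borel_measurable M"
  shows "(\<lambda>w. partial_FT v (f w) (g w)) \<in> borel_measurable M"
proof -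
  note [measurable] = schwartz_measurable[OF v]
  show ?thesis unfolding partial_FT_def by measurable
qed

lemma partial_FT_bound_0:
  fixes v :: "'a::euclidean_space \<times> real \<Rightarrow> real"
  assumes "v \<in> schwartz"
  obtains K where "K \<ge> 0" "\<And>r \<xi>. norm (partial_FT v r \<xi>) \<le> K / jap r"
proof -
  obtain C where C: "C > 0" "\<And>Y r. \<bar>v (Y, r)\<bar> \<le> C / (jap Y ^ DIM('a) * jap r)"
    using schwartz_slice_bound[OF assms] by blast
  let ?K = "C * (LINT Y::'a|lborel. 1 / jap Y ^ DIM('a))"
  have "norm (partial_FT v r \<xi>) \<le> ?K / jap r" for r \<xi>
  proof -
    have "norm (partial_FT v r \<xi>) \<le> (LINT Y|lborel. norm (exp (- (\<i> * of_real (\<xi> \<bullet> Y))) * of_real (v (Y, r))))"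
      unfolding partial_FT_def by (rule integral_norm_bound)
    also have "\<dots> \<le> (LINT Y|lborel. C / jap r * (1 / jap (Y::'a) ^ DIM('a)))"
      using C(2) by (intro integral_mono integrable_norm partial_FT_integrable assms integrable_mult_right integrable_jap_power)
        (auto simp: norm_mult mult.commute)
    finally show ?thesis unfolding integral_mult_right_zero by (simp only: times_divide_eq_left times_divide_eq_right mult_1_right)
  qed
  moreover have "?K \<ge> 0" using C by (intro mult_nonneg_nonneg integral_nonneg_AE) auto
  ultimately show ?thesis using that by blast
qed

lemma Basis_pairI: "b \<in> Basis \<Longrightarrow> (b, 0) \<in> Basis" "b \<in> Basis \<Longrightarrow> (0, b) \<in> Basis"
  by (auto simp: Basis_prod_def)

lemma schwartz_line_deriv:
  assumes v: "v \<in> schwartz" and b: "b \<in> Basis"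
  shows "((\<lambda>h. v (x + h *\<^sub>R b)) has_real_derivative iter_deriv [b] v (x + h *\<^sub>R b)) (at h)"
proof -
  have "((\<lambda>h. x + h *\<^sub>R b) has_derivative (\<lambda>h. h *\<^sub>R b)) (at h)"
    by (auto intro!: derivative_eq_intros)
  from has_derivative_compose[OF this schwartz_has_derivative[OF v]]
  have "((\<lambda>h. v (x + h *\<^sub>R b)) has_derivative (\<lambda>k. \<Sum>c\<in>Basis. ((k *\<^sub>R b) \<bullet> c) * iter_deriv [c] v (x + h *\<^sub>R b))) (at h)" .
  also have "(\<lambda>k. \<Sum>c\<in>Basis. ((k *\<^sub>R b) \<bullet> c) * iter_deriv [c] v (x + h *\<^sub>R b)) = (*) (iter_deriv [b] v (x + h *\<^sub>R b))"
  proof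
    fix k
    have "(\<Sum>c\<in>Basis. ((k *\<^sub>R b) \<bullet> c) * iter_deriv [c] v (x + h *\<^sub>R b))
      = (\<Sum>c\<in>Basis. if c = b then k * iter_deriv [b] v (x + h *\<^sub>R b) else 0)"
      using b by (intro sum.cong refl) (auto simp: inner_Basis)
    then show "(\<Sum>c\<in>Basis. ((k *\<^sub>R b) \<bullet> c) * iter_deriv [c] v (x + h *\<^sub>R b)) = iter_deriv [b] v (x + h *\<^sub>R b) * k"
      using b by (simp add: mult.commute)
  qed
  finally show ?thesis by (simp add: has_field_derivative_def)
qed

lemma partial_FT_time_deriv:
  fixes v :: "'a::euclidean_space \<times> real \<Rightarrow> real"
  assumes v: "v \<in> schwartz"
  shows "((\<lambda>r. partial_FT v r \<xi>) has_vector_derivative partial_FT (iter_deriv [(0, 1)] v) r \<xi>) (at r)"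
proof -
  let ?w = "iter_deriv [(0, 1)] v" and ?e = "\<lambda>Y. exp (- (\<i> * of_real (\<xi> \<bullet> Y)))"
  have b: "(0::'a, 1::real) \<in> Basis" by (simp add: Basis_pairI)
  have w: "?w \<in> schwartz" using b by (intro schwartz_iter_deriv v) auto
  note [measurable] = schwartz_measurable[OF v] schwartz_measurable[OF w]
  obtain C where C: "C > 0" "\<And>Y r. \<bar>?w (Y, r)\<bar> \<le> C / (jap Y ^ DIM('a) * jap r)"
    using schwartz_slice_bound[OF w] by blast
  have "((\<lambda>r. LINT Y|lborel. ?e Y * of_real (v (Y, r))) has_derivative
      (\<lambda>h. LINT Y|lborel. ?e Y * of_real (?w (Y, r) * h))) (at r)"
  proof (rule has_derivative_lebesgue_integral[where S = UNIV and f' = "\<lambda>r Y h. ?e Y * of_real (?w (Y, r) * h)"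
        and g = "\<lambda>Y. C * (1 / jap Y ^ DIM('a))"])
    fix r Y
    have "((\<lambda>r. v (Y, r)) has_real_derivative ?w (Y, r)) (at r)"
      using schwartz_line_deriv[OF v b, of "(Y, 0)" r] by simp
    then have "((\<lambda>r. v (Y, r)) has_derivative (\<lambda>h. ?w (Y, r) * h)) (at r)"
      by (simp add: has_field_derivative_def)
    then show "((\<lambda>r. ?e Y * of_real (v (Y, r))) has_derivative (\<lambda>h. ?e Y * of_real (?w (Y, r) * h))) (at r)"
      by (intro has_derivative_mult_right has_derivative_of_real)
  next
    fix r Y h
    have "\<bar>?w (Y, r)\<bar> \<le> C / (jap Y ^ DIM('a) * jap r)" by (rule C)
    also have "\<dots> \<le> C / (jap Y ^ DIM('a) * 1)"
      using C(1) by (intro divide_left_mono mult_left_mono jap_ge_1 mult_pos_pos) auto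
    finally have "\<bar>?w (Y, r)\<bar> \<le> C * (1 / jap Y ^ DIM('a))" by (simp del: iter_deriv.simps)
    from mult_right_mono[OF this abs_ge_zero[of h]]
    show "norm (?e Y * of_real (?w (Y, r) * h)) \<le> C * (1 / jap Y ^ DIM('a)) * norm h"
      by (simp add: norm_mult abs_mult del: iter_deriv.simps)
  next
    show "(\<lambda>Y. ?e Y * of_real (?w (Y, r) * h)) \<in> borel_measurable lborel" for h by measurable
    show "integrable lborel (\<lambda>Y. ?e Y * of_real (v (Y, r)))" for r by (rule partial_FT_integrable[OF v])
    show "integrable lborel (\<lambda>Y::'a. C * (1 / jap Y ^ DIM('a)))"
      by (intro integrable_mult_right integrable_jap_power order_refl)
  qed auto
  moreover have "(LINT Y|lborel. ?e Y * of_real (?w (Y, r) * h)) = h *\<^sub>R partial_FT ?w r \<xi>" for h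
    unfolding partial_FT_def by (simp add: scaleR_conv_of_real mult_ac flip: integral_mult_right_zero)
  ultimately show ?thesis
    unfolding has_vector_derivative_def partial_FT_def[of v] by simp
qed

text \<open>Integration by parts carried out through translations. \<open>H h\<close>, the transform
  of \<open>v\<close> shifted by \<open>h\<close> along \<open>b\<close>, is a character in
  \<open>h\<close> times the transform of \<open>v\<close>; differentiating the integral and the
  product at \<open>h = 0\<close> gives the two sides.\<close>

lemma partial_FT_space_deriv:
  fixes v :: "'a::euclidean_space \<times> real \<Rightarrow> real"
  assumes v: "v \<in> schwartz" and b: "b \<in> Basis"
  shows "partial_FT (iter_deriv [(b, 0)] v) r \<xi> = \<i> * of_real (\<xi> \<bullet> b) * partial_FT v r \<xi>"
proof -
  let ?w = "iter_deriv [(b, 0)] v" and ?e = "\<lambda>Y. exp (- (\<i> * of_real (\<xi> \<bullet> Y)))"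
  have b': "(b, 0::real) \<in> Basis" using b by (simp add: Basis_pairI)
  have w: "?w \<in> schwartz" using b' by (intro schwartz_iter_deriv v) auto
  note [measurable] = schwartz_measurable[OF v] schwartz_measurable[OF w]
  obtain C where C: "C > 0" "\<And>Y r. \<bar>?w (Y, r)\<bar> \<le> C / (jap Y ^ DIM('a) * jap r)"
    using schwartz_slice_bound[OF w] by blast
  define H where "H h = (LINT Y|lborel. ?e Y * of_real (v (Y + h *\<^sub>R b, r)))" for h
  have tr: "(\<lambda>Y. ?e Y * of_real (v (Y + h *\<^sub>R b, r))) = (\<lambda>Y. exp (\<i> * of_real (h * (\<xi> \<bullet> b))) * (?e (h *\<^sub>R b + Y) * of_real (v (h *\<^sub>R b + Y, r))))" for h
  proof -
    have "exp (\<i> * of_real (h * (\<xi> \<bullet> b))) * ?e (h *\<^sub>R b + Y) = ?e Y" for Y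
      unfolding mult_exp_exp by (simp add: inner_add_right distrib_left)
    then show ?thesis by (simp add: fun_eq_iff add.commute flip: mult.assoc)
  qed
  have int_shift: "integrable lborel f \<longleftrightarrow> integrable lborel (\<lambda>Y. f (c + Y))" "(LINT Y|lborel. f Y) = (LINT Y|lborel. f (c + Y))"
    if [measurable]: "f \<in> borel_measurable borel" for f :: "'a \<Rightarrow> complex" and c
    by (subst lborel_distr_plus[symmetric, of c], subst integrable_distr_eq integral_distr, auto)+
  have Hval: "H h = exp (\<i> * of_real (h * (\<xi> \<bullet> b))) * partial_FT v r \<xi>" for h
  proof -
    have "partial_FT v r \<xi> = (LINT Y|lborel. ?e (h *\<^sub>R b + Y) * of_real (v (h *\<^sub>R b + Y, r)))"
      unfolding partial_FT_def by (rule int_shift(2)) measurable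
    then show ?thesis unfolding H_def tr integral_mult_right_zero by simp
  qed
  have Hint: "integrable lborel (\<lambda>Y. ?e Y * of_real (v (Y + h *\<^sub>R b, r)))" for h
    unfolding tr by (intro integrable_mult_right int_shift(1)[THEN iffD1] partial_FT_integrable v) measurable
  have "(H has_derivative (\<lambda>h. LINT Y|lborel. ?e Y * of_real (?w (Y + 0 *\<^sub>R b, r) * h))) (at 0)"
    unfolding H_def
  proof (rule has_derivative_lebesgue_integral[where S = "ball 0 1" and f' = "\<lambda>h Y k. ?e Y * of_real (?w (Y + h *\<^sub>R b, r) * k)"
        and g = "\<lambda>Y. C * 4 ^ DIM('a) * (1 / jap Y ^ DIM('a))"])
    fix h Y
    have "((\<lambda>h. v (Y + h *\<^sub>R b, r)) has_real_derivative ?w (Y + h *\<^sub>R b, r)) (at h)"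
      using schwartz_line_deriv[OF v b', of "(Y, r)" h] by simp
    then have "((\<lambda>h. v (Y + h *\<^sub>R b, r)) has_derivative (\<lambda>k. ?w (Y + h *\<^sub>R b, r) * k)) (at h)"
      by (simp add: has_field_derivative_def)
    then show "((\<lambda>h. ?e Y * of_real (v (Y + h *\<^sub>R b, r))) has_derivative (\<lambda>k. ?e Y * of_real (?w (Y + h *\<^sub>R b, r) * k))) (at h)"
      by (intro has_derivative_mult_right has_derivative_of_real)
  next
    fix h Y k assume h: "h \<in> ball (0::real) 1"
    let ?Z = "Y + h *\<^sub>R b"
    \<comment> \<open>For shifts shorter than 1 the total factor in Peetre's inequality is at most
      4, so the majorant with \<open>4 ^ DIM('a)\<close> is independent of \<open>h\<close>.\<close>
    have "(norm (h *\<^sub>R b))\<^sup>2 \<le> 1\<^sup>2" using h b by (intro power_mono) auto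
    then have "jap (- (h *\<^sub>R b)) \<le> 2" by simp
    have "jap Y \<le> 2 * jap ?Z * jap (- (h *\<^sub>R b))" using jap_add_le[of ?Z "- (h *\<^sub>R b)"] by simp
    also have "\<dots> \<le> 2 * jap ?Z * 2" using \<open>jap (- (h *\<^sub>R b)) \<le> 2\<close> by (intro mult_left_mono) auto
    also have "\<dots> = 4 * jap ?Z" by simp
    finally have "jap Y ^ DIM('a) \<le> (4 * jap ?Z) ^ DIM('a)" by (intro power_mono less_imp_le[OF jap_pos])
    then have le: "jap Y ^ DIM('a) \<le> 4 ^ DIM('a) * jap ?Z ^ DIM('a)" by (simp only: power_mult_distrib)
    have "\<bar>?w (?Z, r)\<bar> \<le> C / (jap ?Z ^ DIM('a) * jap r)" by (rule C)
    also have "\<dots> \<le> C / (jap ?Z ^ DIM('a) * 1)"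
      using C(1) by (intro divide_left_mono mult_left_mono jap_ge_1 mult_pos_pos) auto
    also have "\<dots> \<le> C * 4 ^ DIM('a) * (1 / jap Y ^ DIM('a))"
      using le C(1) by (simp add: divide_simps mult_ac)
    finally have "\<bar>?w (?Z, r)\<bar> \<le> C * 4 ^ DIM('a) * (1 / jap Y ^ DIM('a))" .
    from mult_right_mono[OF this abs_ge_zero[of k]]
    show "norm (?e Y * of_real (?w (Y + h *\<^sub>R b, r) * k)) \<le> C * 4 ^ DIM('a) * (1 / jap Y ^ DIM('a)) * norm k"
      by (simp add: norm_mult abs_mult del: iter_deriv.simps)
  next
    show "(\<lambda>Y. ?e Y * of_real (?w (Y + 0 *\<^sub>R b, r) * h)) \<in> borel_measurable lborel" for h by measurable
    show "integrable lborel (\<lambda>Y. ?e Y * of_real (v (Y + h *\<^sub>R b, r)))" for h by (rule Hint)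
    show "integrable lborel (\<lambda>Y::'a. C * 4 ^ DIM('a) * (1 / jap Y ^ DIM('a)))"
      by (intro integrable_mult_right integrable_jap_power order_refl)
  qed auto
  moreover have "(LINT Y|lborel. ?e Y * of_real (?w (Y + 0 *\<^sub>R b, r) * h)) = h *\<^sub>R partial_FT ?w r \<xi>" for h
    unfolding partial_FT_def by (simp add: scaleR_conv_of_real mult_ac flip: integral_mult_right_zero)
  ultimately have "(H has_vector_derivative partial_FT ?w r \<xi>) (at 0)"
    by (simp add: has_vector_derivative_def)
  moreover have "(H has_vector_derivative (\<i> * of_real (\<xi> \<bullet> b)) * partial_FT v r \<xi>) (at 0)"
  proof -
    have "((\<lambda>z. exp (\<i> * (z * of_real (\<xi> \<bullet> b))) * partial_FT v r \<xi>) has_field_derivative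
        (\<i> * of_real (\<xi> \<bullet> b)) * partial_FT v r \<xi>) (at (of_real 0))"
      by (auto intro!: derivative_eq_intros)
    from has_vector_derivative_real_field[OF this] show ?thesis by (simp add: Hval[abs_def])
  qed
  ultimately show ?thesis by (rule vector_derivative_unique_at)
qed

text \<open>One power of the weight costs two derivatives: the second derivative along
  \<open>b\<close> multiplies the transform by \<open>- (\<xi> \<bullet> b)\<^sup>2\<close>, and the
  moduli of these factors, summed over the basis and added to 1, give
  \<open>jap \<xi>\<close>.\<close>

lemma partial_FT_bound:
  fixes v :: "'a::euclidean_space \<times> real \<Rightarrow> real"
  assumes "v \<in> schwartz"
  shows "\<exists>K\<ge>0. \<forall>r \<xi>. norm (partial_FT v r \<xi>) * jap \<xi> ^ k \<le> K / jap r"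
  using assms
proof (induction k arbitrary: v)
  case 0
  then show ?case using partial_FT_bound_0[OF 0] by (metis mult.right_neutral power_0)
next
  case (Suc k)
  let ?d = "\<lambda>b. iter_deriv [(b, 0::real), (b, 0)] v"
  have d: "?d b \<in> schwartz" if "b \<in> Basis" for b
    using that by (intro schwartz_iter_deriv Suc) (auto simp: Basis_pairI)
  have "\<forall>b\<in>Basis. \<exists>K\<ge>0. \<forall>r \<xi>. norm (partial_FT (?d b) r \<xi>) * jap \<xi> ^ k \<le> K / jap r"
    using Suc.IH d by blast
  then obtain K where K: "\<And>b. b \<in> Basis \<Longrightarrow> K b \<ge> 0"
    "\<And>b r \<xi>. b \<in> Basis \<Longrightarrow> norm (partial_FT (?d b) r \<xi>) * jap \<xi> ^ k \<le> K b / jap r"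
    by metis
  obtain K0 where K0: "K0 \<ge> 0" "\<And>r \<xi>. norm (partial_FT v r \<xi>) * jap \<xi> ^ k \<le> K0 / jap r"
    using Suc.IH[OF Suc.prems] by blast
  have eq: "norm (partial_FT (?d b) r \<xi>) = (\<xi> \<bullet> b)\<^sup>2 * norm (partial_FT v r \<xi>)" if b: "b \<in> Basis" for b r \<xi>
  proof -
    have "iter_deriv [(b, 0::real)] v \<in> schwartz" using b by (intro schwartz_iter_deriv Suc) (auto simp: Basis_pairI)
    from partial_FT_space_deriv[OF this b] partial_FT_space_deriv[OF Suc.prems b]
    have "partial_FT (?d b) r \<xi> = (\<i> * \<i>) * ((of_real (\<xi> \<bullet> b) * of_real (\<xi> \<bullet> b)) * partial_FT v r \<xi>)"
      by (simp only: iter_deriv.simps mult_ac)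
    then have "partial_FT (?d b) r \<xi> = - ((of_real (\<xi> \<bullet> b))\<^sup>2 * partial_FT v r \<xi>)"
      by (simp add: power2_eq_square del: iter_deriv.simps)
    then show ?thesis by (simp add: norm_mult norm_power)
  qed
  have "norm (partial_FT v r \<xi>) * jap \<xi> ^ Suc k \<le> (K0 + sum K Basis) / jap r" for r \<xi>
  proof -
    let ?N = "norm (partial_FT v r \<xi>) * jap \<xi> ^ k"
    have "(norm \<xi>)\<^sup>2 = (\<Sum>b\<in>Basis. (\<xi> \<bullet> b)\<^sup>2)"
      by (subst power2_norm_eq_inner, subst euclidean_inner) (simp add: power2_eq_square)
    then have "norm (partial_FT v r \<xi>) * jap \<xi> ^ Suc k = ?N + (\<Sum>b\<in>Basis. (\<xi> \<bullet> b)\<^sup>2) * ?N"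
      by (simp add: algebra_simps)
    moreover have "(\<Sum>b\<in>Basis. (\<xi> \<bullet> b)\<^sup>2) * ?N = (\<Sum>b\<in>Basis. norm (partial_FT (?d b) r \<xi>) * jap \<xi> ^ k)"
      unfolding sum_distrib_right by (intro sum.cong refl) (simp only: eq mult_ac)
    ultimately have "norm (partial_FT v r \<xi>) * jap \<xi> ^ Suc k
      = ?N + (\<Sum>b\<in>Basis. norm (partial_FT (?d b) r \<xi>) * jap \<xi> ^ k)"
      by (simp only:)
    also have "\<dots> \<le> K0 / jap r + (\<Sum>b\<in>Basis. K b / jap r)"
      by (intro add_mono K0 sum_mono K)
    finally show ?thesis by (simp add: add_divide_distrib sum_divide_distrib)
  qed
  moreover have "K0 + sum K Basis \<ge> 0" using K0 K by (simp add: sum_nonneg)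
  ultimately show ?case by blast
qed

section \<open>Superpositions of Fourier modes\<close>

lemma measurable_fst_borel [measurable]: "(fst :: 'a::topological_space \<times> 'b::topological_space \<Rightarrow> 'a) \<in> borel_measurable borel"
  and measurable_snd_borel [measurable]: "(snd :: 'a::topological_space \<times> 'b::topological_space \<Rightarrow> 'b) \<in> borel_measurable borel"
  by (intro borel_measurable_continuous_onI continuous_intros)+

text \<open>Both exponents are free because derivatives in \<open>z\<close> and
  \<open>\<tau>\<close> and multiplication by \<open>z\<close> merely shift them. The extension
  itself uses \<open>\<alpha> = 2 * s\<close> and \<open>\<beta> = 1 + s\<close>.\<close>

definition weight :: "real \<Rightarrow> real \<Rightarrow> real \<Rightarrow> real \<Rightarrow> real" where
  "weight \<alpha> \<beta> \<tau> z = z powr \<alpha> * \<tau> powr (- \<beta>) * exp (- z\<^sup>2 / (4 * \<tau>))"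

lemma weight_nonneg: "0 \<le> weight \<alpha> \<beta> \<tau> z"
  by (simp add: weight_def)

lemma measurable_weight [measurable]: "(\<lambda>\<tau>. weight \<alpha> \<beta> \<tau> z) \<in> borel_measurable borel"
  unfolding weight_def by measurable

text \<open>Away from \<open>z = 0\<close> the exponential beats
  \<open>\<tau> powr (- \<beta>)\<close> for small \<open>\<tau>\<close>, and
  \<open>\<beta> \<ge> 0\<close> controls large \<open>\<tau>\<close>; both are visible in the
  variable \<open>1 / \<tau>\<close>. The sum \<open>z1 powr \<alpha> + z2 powr \<alpha>\<close>
  covers both signs of \<open>\<alpha>\<close>.\<close>

lemma weight_bound:
  assumes z: "0 < z1" "z1 \<le> z2" and \<beta>: "0 \<le> \<beta>"
  obtains K where "0 \<le> K" "\<And>\<tau> z. 0 < \<tau> \<Longrightarrow> z1 \<le> z \<Longrightarrow> z \<le> z2 \<Longrightarrow> weight \<alpha> \<beta> \<tau> z \<le> K"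
proof -
  obtain n :: nat where n: "\<beta> \<le> real n" using real_arch_simple by blast
  define l where "l = z1\<^sup>2 / 4"
  have l: "l > 0" using z by (simp add: l_def)
  obtain K where K: "K > 0" "\<And>x. 0 \<le> x \<Longrightarrow> (1 + x) ^ n * exp (- (l * x)) \<le> K"
    using exp_dominates_power[OF l] by metis
  have "weight \<alpha> \<beta> \<tau> z \<le> (z1 powr \<alpha> + z2 powr \<alpha>) * K" if \<tau>: "0 < \<tau>" and zz: "z1 \<le> z" "z \<le> z2" for \<tau> z
  proof -
    have a: "z powr \<alpha> \<le> z1 powr \<alpha> + z2 powr \<alpha>"
    proof (cases "\<alpha> \<ge> 0")
      case True
      then have "z powr \<alpha> \<le> z2 powr \<alpha>" using z zz by (intro powr_mono2) auto
      then show ?thesis by (simp add: add_increasing)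
    next
      case False
      then have "z powr \<alpha> \<le> z1 powr \<alpha>" using z zz by (intro powr_mono2') auto
      then show ?thesis by (simp add: add_increasing2)
    qed
    have "\<tau> powr (- \<beta>) = (1 / \<tau>) powr \<beta>" using \<tau> by (simp add: powr_minus powr_divide inverse_eq_divide)
    also have "\<dots> \<le> (1 + 1 / \<tau>) powr \<beta>" using \<tau> \<beta> by (intro powr_mono2) auto
    also have "\<dots> \<le> (1 + 1 / \<tau>) powr real n" using \<tau> n by (intro powr_mono) auto
    also have "\<dots> = (1 + 1 / \<tau>) ^ n" using \<tau> by (intro powr_realpow) (simp add: add_pos_pos)
    finally have b: "\<tau> powr (- \<beta>) \<le> (1 + 1 / \<tau>) ^ n" .
    have "z1\<^sup>2 \<le> z\<^sup>2" using z zz by (intro power_mono) auto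
    then have c: "exp (- z\<^sup>2 / (4 * \<tau>)) \<le> exp (- (l * (1 / \<tau>)))"
      using \<tau> by (simp add: l_def divide_right_mono)
    have "\<tau> powr (- \<beta>) * exp (- z\<^sup>2 / (4 * \<tau>)) \<le> (1 + 1 / \<tau>) ^ n * exp (- (l * (1 / \<tau>)))"
      using \<tau> by (intro mult_mono b c) auto
    also have "\<dots> \<le> K" using \<tau> by (intro K) auto
    finally show ?thesis unfolding weight_def mult.assoc using a by (intro mult_mono) (auto intro: add_nonneg_nonneg)
  qed
  moreover have "0 \<le> (z1 powr \<alpha> + z2 powr \<alpha>) * K" using K by simp
  ultimately show ?thesis using that by blast
qed

lemma weight_deriv:
  assumes "0 < z" "0 < \<tau>"
  shows "((\<lambda>z. weight \<alpha> \<beta> \<tau> z) has_real_derivative \<alpha> * weight (\<alpha> - 1) \<beta> \<tau> z - weight (\<alpha> + 1) (\<beta> + 1) \<tau> z / 2) (at z)"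
proof -
  have a: "((\<lambda>z. z powr \<alpha>) has_real_derivative \<alpha> * z powr (\<alpha> - 1)) (at z)"
    using assms by (intro has_real_derivative_powr)
  have b: "((\<lambda>z. exp (- z\<^sup>2 / (4 * \<tau>))) has_real_derivative exp (- z\<^sup>2 / (4 * \<tau>)) * (- z / (2 * \<tau>))) (at z)"
    using assms by (auto intro!: derivative_eq_intros)
  have "z powr (\<alpha> + 1) = z powr \<alpha> * z" using assms by (simp add: powr_add)
  moreover have "\<tau> powr (- (\<beta> + 1)) = \<tau> powr (- \<beta>) / \<tau>"
    using assms by (simp add: powr_diff)
  ultimately have eq: "\<alpha> * z powr (\<alpha> - 1) * (\<tau> powr (- \<beta>) * exp (- z\<^sup>2 / (4 * \<tau>)))
     + \<tau> powr (- \<beta>) * (exp (- z\<^sup>2 / (4 * \<tau>)) * (- z / (2 * \<tau>))) * z powr \<alpha>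
     = \<alpha> * weight (\<alpha> - 1) \<beta> \<tau> z - weight (\<alpha> + 1) (\<beta> + 1) \<tau> z / 2"
    by (simp add: weight_def mult_ac)
  show ?thesis
    using DERIV_cong[OF DERIV_mult[OF a DERIV_cmult[OF b, of "\<tau> powr (- \<beta>)"]] eq]
    by (simp only: weight_def mult.assoc)
qed

text \<open>The Fourier multiplier by which the partial derivatives along \<open>bs\<close> act on
  the character of frequency \<open>\<theta>\<close>.\<close>

definition symb :: "'a::euclidean_space list \<Rightarrow> 'a \<Rightarrow> complex" where
  "symb bs \<theta> = (\<Prod>b\<leftarrow>bs. \<i> * of_real (\<theta> \<bullet> b))"

lemma symb_simps [simp]: "symb [] \<theta> = 1" "symb (b # bs) \<theta> = \<i> * of_real (\<theta> \<bullet> b) * symb bs \<theta>"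
  by (simp_all add: symb_def)

lemma continuous_on_symb [continuous_intros]: "continuous_on S f \<Longrightarrow> continuous_on S (\<lambda>x. symb bs (f x))"
  by (induction bs) (auto intro!: continuous_intros)

lemma norm_symb_le: "set bs \<subseteq> Basis \<Longrightarrow> norm (symb bs \<theta>) \<le> jap \<theta> ^ length bs"
proof (induction bs)
  case (Cons b bs)
  have "norm \<theta> \<le> jap \<theta>"
    using zero_le_power2[of "norm \<theta> - 1/2"] by (simp add: power2_diff power2_eq_square algebra_simps)
  then have "\<bar>\<theta> \<bullet> b\<bar> \<le> jap \<theta>" using Cons Basis_le_norm[of b \<theta>] by auto
  then have "\<bar>\<theta> \<bullet> b\<bar> * norm (symb bs \<theta>) \<le> jap \<theta> * jap \<theta> ^ length bs"
    using Cons by (intro mult_mono) auto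
  then show ?case by (simp add: norm_mult)
qed simp

lemma integrable_pair_product:
  fixes f :: "'a::euclidean_space \<Rightarrow> real" and g :: "'b::euclidean_space \<Rightarrow> real"
  assumes f: "integrable lborel f" and g: "integrable lborel g"
  shows "integrable lborel (\<lambda>p. f (fst p) * g (snd p))"
proof -
  have [measurable]: "f \<in> borel_measurable borel" "g \<in> borel_measurable borel"
    using f g by auto
  have "integrable (lborel \<Otimes>\<^sub>M lborel) (\<lambda>p::'a \<times> 'b. f (fst p) * g (snd p))"
  proof (rule lborel_pair.Fubini_integrable)
    show "integrable lborel (\<lambda>x::'a. LINT y|lborel. norm (f (fst (x, y::'b)) * g (snd (x, y))))"
      unfolding fst_conv snd_conv norm_mult integral_mult_right_zero
      by (intro integrable_mult_left integrable_norm f)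
    show "AE x in lborel. integrable lborel (\<lambda>y. f (fst (x::'a, y::'b)) * g (snd (x, y)))"
      unfolding fst_conv snd_conv by (intro AE_I2 integrable_mult_right g)
  qed measurable
  then show ?thesis by (simp add: lborel_prod)
qed

lemma integrable_jap_product:
  assumes "DIM('a) \<le> M" "DIM('b) \<le> N"
  shows "integrable lborel (\<lambda>p::'a::euclidean_space \<times> 'b::euclidean_space. 1 / (jap (fst p) ^ M * jap (snd p) ^ N))"
  using integrable_pair_product[OF integrable_jap_power[OF assms(1)] integrable_jap_power[OF assms(2)]] by simp

section \<open>Modes, packets and waves\<close>

context kolmogorov
begin

text \<open>With a nonempty list \<open>bs\<close> this is the mode for \<open>[]\<close>
  differentiated in \<open>X\<close> along the members of \<open>bs\<close>.\<close>

definition mode :: "(real^'n) list \<Rightarrow> ((real^'n) \<times> real \<Rightarrow> real) \<Rightarrow> real^'n \<Rightarrow> real \<Rightarrow> real \<Rightarrow> real^'n \<Rightarrow> complex" where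
  "mode bs v X t \<tau> \<xi> = symb bs (freq \<tau> \<xi>) * of_real (exp (- covq \<tau> \<xi>)) *
     exp (\<i> * of_real (freq \<tau> \<xi> \<bullet> X)) * partial_FT v (t - \<tau>) \<xi>"

text \<open>Set to 0 for \<open>\<tau> \<le> 0\<close>, so that all integrals run over the whole
  product space and Fubini applies to plain \<open>lborel\<close>.\<close>

definition packet :: "real \<Rightarrow> real \<Rightarrow> (real^'n) list \<Rightarrow> ((real^'n) \<times> real \<Rightarrow> real) \<Rightarrow>
    ((real^'n) \<times> real) \<times> real \<Rightarrow> real \<times> (real^'n) \<Rightarrow> complex" where
  "packet \<alpha> \<beta> bs v Z p = (if fst p \<le> 0 then 0 else
     of_real (weight \<alpha> \<beta> (fst p) (snd Z)) * mode bs v (fst (fst Z)) (snd (fst Z)) (fst p) (snd p))"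

definition wave :: "real \<Rightarrow> real \<Rightarrow> (real^'n) list \<Rightarrow> ((real^'n) \<times> real \<Rightarrow> real) \<Rightarrow>
    ((real^'n) \<times> real) \<times> real \<Rightarrow> complex" where
  "wave \<alpha> \<beta> bs v Z = (LINT p|lborel. packet \<alpha> \<beta> bs v Z p)"

lemma measurable_mode [measurable]:
  assumes v: "v \<in> schwartz"
  shows "(\<lambda>p. mode bs v X t (fst p) (snd p)) \<in> borel_measurable borel"
proof -
  have [measurable]: "(\<lambda>p. symb bs (freq (fst p) (snd p))) \<in> borel_measurable borel"
    "(\<lambda>p. covq (fst p) (snd p)) \<in> borel_measurable borel"
    "(\<lambda>p. freq (fst p) (snd p)) \<in> borel_measurable borel"
    by (intro borel_measurable_continuous_onI continuous_intros)+
  note [measurable] = measurable_partial_FT[OF v]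
  have [measurable]: "(\<lambda>p::real \<times> (real^'n). partial_FT v (t - fst p) (snd p)) \<in> borel_measurable borel"
    by (intro measurable_partial_FT[OF v] borel_measurable_continuous_onI continuous_intros)
  show ?thesis unfolding mode_def by measurable
qed

text \<open>\<open>freq_decay\<close> spends the Gaussian factor to replace the symbol at the moving
  frequency by a polynomial in \<open>\<xi>\<close>. The decay of \<open>partial_FT\<close> of order
  \<open>length bs + CARD('n)\<close> pays for this polynomial and leaves an integrable function.
  The bound is uniform in \<open>X\<close>, which enters only through a phase.\<close>

lemma mode_bound:
  assumes v: "v \<in> schwartz" and bs: "set bs \<subseteq> Basis"
  obtains K where "0 \<le> K"
    "\<And>\<tau> \<xi> X t. 0 \<le> \<tau> \<Longrightarrow> norm (mode bs v X t \<tau> \<xi>) \<le> K / (jap (t - \<tau>) * jap \<xi> ^ CARD('n))"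
proof -
  obtain K1 where K1: "K1 > 0"
    "\<And>\<tau> \<xi>. 0 \<le> \<tau> \<Longrightarrow> jap (freq \<tau> \<xi>) ^ length bs * exp (- covq \<tau> \<xi>) \<le> K1 * jap \<xi> ^ length bs"
    using freq_decay by metis
  obtain K2 where K2: "K2 \<ge> 0" "\<And>r \<xi>. norm (partial_FT v r \<xi>) * jap \<xi> ^ (length bs + CARD('n)) \<le> K2 / jap r"
    using partial_FT_bound[OF v] by metis
  have "norm (mode bs v X t \<tau> \<xi>) \<le> K1 * K2 / (jap (t - \<tau>) * jap \<xi> ^ CARD('n))" if \<tau>: "0 \<le> \<tau>" for \<tau> \<xi> X t
  proof -
    have "norm (mode bs v X t \<tau> \<xi>) = norm (symb bs (freq \<tau> \<xi>)) * exp (- covq \<tau> \<xi>) * norm (partial_FT v (t - \<tau>) \<xi>)"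
      unfolding mode_def norm_mult norm_exp_ii by simp
    also have "\<dots> \<le> (jap (freq \<tau> \<xi>) ^ length bs * exp (- covq \<tau> \<xi>)) * norm (partial_FT v (t - \<tau>) \<xi>)"
      by (intro mult_right_mono norm_symb_le bs) auto
    also have "\<dots> \<le> (K1 * jap \<xi> ^ length bs) * norm (partial_FT v (t - \<tau>) \<xi>)"
      using \<tau> by (intro mult_right_mono K1) auto
    finally have "norm (mode bs v X t \<tau> \<xi>) * jap \<xi> ^ CARD('n)
        \<le> ((K1 * jap \<xi> ^ length bs) * norm (partial_FT v (t - \<tau>) \<xi>)) * jap \<xi> ^ CARD('n)"
      by (rule mult_right_mono) simp
    also have "\<dots> = K1 * (norm (partial_FT v (t - \<tau>) \<xi>) * jap \<xi> ^ (length bs + CARD('n)))"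
      by (simp only: power_add mult_ac)
    also have "\<dots> \<le> K1 * (K2 / jap (t - \<tau>))" using K1 by (intro mult_left_mono K2) auto
    finally have "norm (mode bs v X t \<tau> \<xi>) * jap \<xi> ^ CARD('n) * jap (t - \<tau>) \<le> K1 * K2"
      by (simp only: times_divide_eq_right pos_le_divide_eq[OF jap_pos])
    moreover have "0 < jap (t - \<tau>) * jap \<xi> ^ CARD('n)" by (intro mult_pos_pos zero_less_power jap_pos)
    ultimately show ?thesis by (simp only: pos_le_divide_eq mult_ac)
  qed
  moreover have "0 \<le> K1 * K2" using K1 K2 by simp
  ultimately show ?thesis using that by blast
qed

lemma measurable_packet [measurable]:
  assumes v: "v \<in> schwartz"
  shows "packet \<alpha> \<beta> bs v Z \<in> borel_measurable borel"
proof -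
  note [measurable] = measurable_mode[OF v]
  show ?thesis unfolding packet_def weight_def by measurable
qed

text \<open>One integrable majorant, up to a constant, for all packets and locally uniform in
  \<open>t\<close> and \<open>z\<close>: it serves both for convergence and for differentiation
  under the integral.\<close>

lemma packet_bound:
  assumes v: "v \<in> schwartz" and bs: "set bs \<subseteq> Basis" and \<beta>: "0 \<le> \<beta>" and z: "0 < z1" "z1 \<le> z2"
  obtains K where "0 \<le> K"
    "\<And>Z p. \<bar>snd (fst Z)\<bar> \<le> R \<Longrightarrow> z1 \<le> snd Z \<Longrightarrow> snd Z \<le> z2 \<Longrightarrow>
      norm (packet \<alpha> \<beta> bs v Z p) \<le> K * (1 / (jap (fst p) ^ 1 * jap (snd p) ^ CARD('n)))"
proof -
  obtain K1 where K1: "0 \<le> K1"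
    "\<And>\<tau> \<xi> X t. 0 \<le> \<tau> \<Longrightarrow> norm (mode bs v X t \<tau> \<xi>) \<le> K1 / (jap (t - \<tau>) * jap \<xi> ^ CARD('n))"
    using mode_bound[OF v bs] by metis
  obtain K2 where K2: "0 \<le> K2" "\<And>\<tau> z. 0 < \<tau> \<Longrightarrow> z1 \<le> z \<Longrightarrow> z \<le> z2 \<Longrightarrow> weight \<alpha> \<beta> \<tau> z \<le> K2"
    using weight_bound[OF z \<beta>] by metis
  let ?K = "K2 * K1 * (2 * (1 + R\<^sup>2))"
  have nn: "0 \<le> ?K" using K1 K2 by (intro mult_nonneg_nonneg) auto
  have "norm (packet \<alpha> \<beta> bs v Z p) \<le> ?K * (1 / (jap (fst p) ^ 1 * jap (snd p) ^ CARD('n)))"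
    if Z: "\<bar>snd (fst Z)\<bar> \<le> R" "z1 \<le> snd Z" "snd Z \<le> z2" for Z p
  proof (cases "fst p \<le> 0")
    case True
    then show ?thesis using nn by (simp add: packet_def)
  next
    case False
    obtain \<tau> \<xi> where p: "p = (\<tau>, \<xi>)" by (cases p)
    obtain X t z where ZZ: "Z = ((X, t), z)" by (metis prod.collapse)
    have \<tau>: "0 < \<tau>" using False p by simp
    have "t\<^sup>2 \<le> R\<^sup>2" using Z(1) ZZ by (simp add: abs_le_square_iff[symmetric])
    \<comment> \<open>Peetre's inequality for this sum trades decay in \<open>t - \<tau>\<close> for
      decay in \<open>\<tau>\<close>, uniformly for \<open>\<bar>t\<bar> \<le> R\<close>.\<close>
    have "t + - (t - \<tau>) = \<tau>" by simp
    then have "jap \<tau> \<le> 2 * jap t * jap (t - \<tau>)"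
      using jap_add_le[of t "- (t - \<tau>)"] by (simp only: norm_minus_cancel)
    also have "\<dots> \<le> 2 * (1 + R\<^sup>2) * jap (t - \<tau>)"
      using \<open>t\<^sup>2 \<le> R\<^sup>2\<close> by (intro mult_mono) auto
    finally have j: "1 / jap (t - \<tau>) \<le> 2 * (1 + R\<^sup>2) / jap \<tau>" by (simp add: field_simps)
    have "norm (packet \<alpha> \<beta> bs v Z p) = weight \<alpha> \<beta> \<tau> z * norm (mode bs v X t \<tau> \<xi>)"
      using False by (simp add: packet_def p ZZ norm_mult weight_nonneg)
    also have "\<dots> \<le> K2 * (K1 / (jap (t - \<tau>) * jap \<xi> ^ CARD('n)))"
      using \<tau> Z ZZ by (intro mult_mono K1 K2) auto
    also have "\<dots> = K2 * K1 / jap \<xi> ^ CARD('n) * (1 / jap (t - \<tau>))" by simp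
    also have "\<dots> \<le> K2 * K1 / jap \<xi> ^ CARD('n) * (2 * (1 + R\<^sup>2) / jap \<tau>)"
      using K1(1) K2(1) by (intro mult_left_mono j) auto
    also have "\<dots> = ?K * (1 / (jap (fst p) ^ 1 * jap (snd p) ^ CARD('n)))" by (simp add: p mult_ac)
    finally show ?thesis .
  qed
  with nn show ?thesis by (rule that)
qed

lemma packet_integrable:
  assumes v: "v \<in> schwartz" and bs: "set bs \<subseteq> Basis" and \<beta>: "0 \<le> \<beta>" and z: "0 < snd Z"
  shows "integrable lborel (packet \<alpha> \<beta> bs v Z)"
proof -
  obtain K where K: "0 \<le> K" "\<And>p. norm (packet \<alpha> \<beta> bs v Z p) \<le> K * (1 / (jap (fst p) ^ 1 * jap (snd p) ^ CARD('n)))"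
    using packet_bound[OF v bs \<beta> z order_refl, of "\<bar>snd (fst Z)\<bar>"] by (metis order_refl)
  note [measurable] = measurable_packet[OF v]
  show ?thesis
  proof (rule Bochner_Integration.integrable_bound)
    show "integrable lborel (\<lambda>p::real \<times> (real^'n). K * (1 / (jap (fst p) ^ 1 * jap (snd p) ^ CARD('n))))"
      by (intro integrable_mult_right integrable_jap_product) auto
    show "AE p in lborel. norm (packet \<alpha> \<beta> bs v Z p) \<le> norm (K * (1 / (jap (fst p) ^ 1 * jap (snd p) ^ CARD('n))))"
      using K by (intro AE_I2 order_trans[OF K(2)]) simp
  qed auto
qed

text \<open>The differential in the direction \<open>h\<close>. A space derivative prepends a basis
  vector to the list, a time derivative falls on \<open>v\<close>, and a derivative in
  \<open>z\<close> shifts the exponents, so only packets occur.\<close>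

definition packet_deriv where
  "packet_deriv \<alpha> \<beta> bs v Z p h =
     (\<Sum>b\<in>Basis. of_real (fst (fst h) \<bullet> b) * packet \<alpha> \<beta> (b # bs) v Z p)
     + of_real (snd (fst h)) * packet \<alpha> \<beta> bs (iter_deriv [(0, 1)] v) Z p
     + of_real (snd h) * (of_real \<alpha> * packet (\<alpha> - 1) \<beta> bs v Z p - packet (\<alpha> + 1) (\<beta> + 1) bs v Z p / 2)"

lemma mode_has_derivative:
  assumes v: "v \<in> schwartz"
  shows "((\<lambda>x. mode bs v (fst x) (snd x) \<tau> \<xi>) has_derivative (\<lambda>h.
     (\<Sum>b\<in>Basis. of_real (fst h \<bullet> b) * mode (b # bs) v (fst x) (snd x) \<tau> \<xi>)
     + of_real (snd h) * mode bs (iter_deriv [(0, 1)] v) (fst x) (snd x) \<tau> \<xi>)) (at x)"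
proof -
  define c where "c = symb bs (freq \<tau> \<xi>) * of_real (exp (- covq \<tau> \<xi>))"
  define \<theta> where "\<theta> = freq \<tau> \<xi>"
  define e where "e x = exp (\<i> * of_real (\<theta> \<bullet> fst x))" for x :: "(real^'n) \<times> real"
  define F where "F w x = partial_FT w (snd x - \<tau>) \<xi>" for w :: "(real^'n) \<times> real \<Rightarrow> real" and x :: "(real^'n) \<times> real"
  let ?w = "iter_deriv [(0, 1)] v"
  have 1: "(e has_derivative (\<lambda>h. e x * (\<i> * of_real (\<theta> \<bullet> fst h)))) (at x)"
  proof -
    have "((\<lambda>x::(real^'n) \<times> real. \<i> * of_real (\<theta> \<bullet> fst x)) has_derivative (\<lambda>h. \<i> * of_real (\<theta> \<bullet> fst h))) (at x)"
      by (intro derivative_intros)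
    from has_derivative_compose[OF this DERIV_exp[unfolded has_field_derivative_def]]
    show ?thesis unfolding e_def .
  qed
  have 2: "(F v has_derivative (\<lambda>h. snd h *\<^sub>R F ?w x)) (at x)"
  proof -
    have "((\<lambda>x::(real^'n) \<times> real. snd x - \<tau>) has_derivative snd) (at x)"
      by (auto intro!: derivative_eq_intros)
    from has_derivative_compose[OF this partial_FT_time_deriv[OF v, unfolded has_vector_derivative_def]]
    show ?thesis unfolding F_def by simp
  qed
  have "((\<lambda>x. c * (e x * F v x)) has_derivative (\<lambda>h. c * (e x * (snd h *\<^sub>R F ?w x) + e x * (\<i> * of_real (\<theta> \<bullet> fst h)) * F v x))) (at x)"
    by (intro has_derivative_mult_right has_derivative_mult 1 2)
  moreover have m: "mode bs v (fst x) (snd x) \<tau> \<xi> = c * (e x * F v x)" for v x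
    by (simp only: mode_def c_def e_def F_def \<theta>_def mult.assoc)
  moreover have "(\<Sum>b\<in>Basis. of_real (y \<bullet> b) * mode (b # bs) v (fst x) (snd x) \<tau> \<xi>) = \<i> * of_real (\<theta> \<bullet> y) * mode bs v (fst x) (snd x) \<tau> \<xi>" for y
  proof -
    have "mode (b # bs) v (fst x) (snd x) \<tau> \<xi> = \<i> * of_real (\<theta> \<bullet> b) * mode bs v (fst x) (snd x) \<tau> \<xi>" for b
      by (simp only: mode_def symb_simps \<theta>_def mult.assoc)
    moreover have "of_real (\<theta> \<bullet> y) = (\<Sum>b\<in>Basis. complex_of_real (y \<bullet> b) * of_real (\<theta> \<bullet> b))"
      by (subst euclidean_inner) (simp add: mult.commute)
    ultimately show ?thesis by (simp only: sum_distrib_left sum_distrib_right mult_ac)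
  qed
  ultimately show ?thesis
    by (simp add: scaleR_conv_of_real algebra_simps del: iter_deriv.simps)
qed

lemma packet_has_derivative:
  assumes v: "v \<in> schwartz" and z: "0 < snd Z"
  shows "((\<lambda>Z. packet \<alpha> \<beta> bs v Z p) has_derivative packet_deriv \<alpha> \<beta> bs v Z p) (at Z)"
proof (cases "fst p \<le> 0")
  case True
  then have "packet_deriv \<alpha> \<beta> bs v Z p = (\<lambda>h. 0)" by (simp add: fun_eq_iff packet_def packet_deriv_def)
  with True show ?thesis by (simp add: packet_def)
next
  case False
  obtain \<tau> \<xi> where p: "p = (\<tau>, \<xi>)" by (cases p)
  with False have \<tau>: "0 < \<tau>" by simp
  let ?m = "\<lambda>bs v Z. mode bs v (fst (fst Z)) (snd (fst Z)) \<tau> \<xi>"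
  let ?d = "\<alpha> * weight (\<alpha> - 1) \<beta> \<tau> (snd Z) - weight (\<alpha> + 1) (\<beta> + 1) \<tau> (snd Z) / 2"
  have 1: "((\<lambda>Z. complex_of_real (weight \<alpha> \<beta> \<tau> (snd Z))) has_derivative (\<lambda>h. of_real (?d * snd h))) (at Z)"
    using has_derivative_compose[OF has_derivative_snd[OF has_derivative_ident] weight_deriv[OF z \<tau>, unfolded has_field_derivative_def]]
    by (intro has_derivative_of_real) simp
  have 2: "((\<lambda>Z. ?m bs v Z) has_derivative (\<lambda>h. (\<Sum>b\<in>Basis. of_real (fst (fst h) \<bullet> b) * ?m (b # bs) v Z)
     + of_real (snd (fst h)) * ?m bs (iter_deriv [(0, 1)] v) Z)) (at Z)"
    using has_derivative_compose[OF has_derivative_fst[OF has_derivative_ident] mode_has_derivative[OF v]] by simp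
  have "packet_deriv \<alpha> \<beta> bs v Z p = (\<lambda>h. of_real (weight \<alpha> \<beta> \<tau> (snd Z)) * ((\<Sum>b\<in>Basis. of_real (fst (fst h) \<bullet> b) * ?m (b # bs) v Z)
     + of_real (snd (fst h)) * ?m bs (iter_deriv [(0, 1)] v) Z) + of_real (?d * snd h) * ?m bs v Z)"
    using \<tau> unfolding packet_deriv_def packet_def p
    by (auto simp: fun_eq_iff distrib_left distrib_right left_diff_distrib right_diff_distrib sum_distrib_left mult_ac simp del: iter_deriv.simps)
  with has_derivative_mult[OF 1 2] show ?thesis using \<tau> by (simp add: packet_def p)
qed

lemma integral_packet_deriv:
  assumes v: "v \<in> schwartz" and bs: "set bs \<subseteq> Basis" and \<beta>: "0 \<le> \<beta>" and z: "0 < snd Z"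
  shows "integrable lborel (\<lambda>p. packet_deriv \<alpha> \<beta> bs v Z p h)"
    and "(LINT p|lborel. packet_deriv \<alpha> \<beta> bs v Z p h) =
     (\<Sum>b\<in>Basis. of_real (fst (fst h) \<bullet> b) * wave \<alpha> \<beta> (b # bs) v Z)
     + of_real (snd (fst h)) * wave \<alpha> \<beta> bs (iter_deriv [(0, 1)] v) Z
     + of_real (snd h) * (of_real \<alpha> * wave (\<alpha> - 1) \<beta> bs v Z - wave (\<alpha> + 1) (\<beta> + 1) bs v Z / 2)"
proof -
  have w: "iter_deriv [(0, 1)] v \<in> schwartz"
    by (intro schwartz_iter_deriv v) (auto simp: Basis_pairI)
  have i1: "integrable lborel (packet \<alpha> \<beta> (b # bs) v Z)" if "b \<in> Basis" for b
    using that bs by (intro packet_integrable v \<beta> z) auto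
  note i2 = packet_integrable[OF w bs \<beta> z, of \<alpha>]
  note i3 = packet_integrable[OF v bs \<beta> z, of "\<alpha> - 1"]
  have i4: "integrable lborel (packet (\<alpha> + 1) (\<beta> + 1) bs v Z)"
    using \<beta> by (intro packet_integrable v bs z) auto
  show "integrable lborel (\<lambda>p. packet_deriv \<alpha> \<beta> bs v Z p h)"
    unfolding packet_deriv_def
    by (intro Bochner_Integration.integrable_add Bochner_Integration.integrable_diff Bochner_Integration.integrable_sum
        integrable_mult_right integrable_divide i1 i2 i3 i4)
  show "(LINT p|lborel. packet_deriv \<alpha> \<beta> bs v Z p h) =
     (\<Sum>b\<in>Basis. of_real (fst (fst h) \<bullet> b) * wave \<alpha> \<beta> (b # bs) v Z)
     + of_real (snd (fst h)) * wave \<alpha> \<beta> bs (iter_deriv [(0, 1)] v) Z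
     + of_real (snd h) * (of_real \<alpha> * wave (\<alpha> - 1) \<beta> bs v Z - wave (\<alpha> + 1) (\<beta> + 1) bs v Z / 2)"
  proof -
    let ?A = "\<lambda>p. \<Sum>b\<in>Basis. of_real (fst (fst h) \<bullet> b) * packet \<alpha> \<beta> (b # bs) v Z p"
    let ?B = "\<lambda>p. of_real (snd (fst h)) * packet \<alpha> \<beta> bs (iter_deriv [(0, 1)] v) Z p"
    let ?C = "\<lambda>p. of_real (snd h) * (of_real \<alpha> * packet (\<alpha> - 1) \<beta> bs v Z p - packet (\<alpha> + 1) (\<beta> + 1) bs v Z p / 2)"
    have A: "integrable lborel ?A" and B: "integrable lborel ?B" and C: "integrable lborel ?C"
      by (intro Bochner_Integration.integrable_diff Bochner_Integration.integrable_sum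
          integrable_mult_right integrable_divide i1 i2 i3 i4; assumption?)+
    have "(LINT p|lborel. ?A p) = (\<Sum>b\<in>Basis. of_real (fst (fst h) \<bullet> b) * wave \<alpha> \<beta> (b # bs) v Z)"
      unfolding wave_def
      by (subst Bochner_Integration.integral_sum) (simp_all only: integral_mult_right_zero integrable_mult_right i1)
    moreover have "(LINT p|lborel. ?C p) = of_real (snd h) * (of_real \<alpha> * wave (\<alpha> - 1) \<beta> bs v Z - wave (\<alpha> + 1) (\<beta> + 1) bs v Z / 2)"
      unfolding wave_def integral_mult_right_zero
      by (subst Bochner_Integration.integral_diff) (simp_all only: integral_mult_right_zero integral_divide_zero integrable_mult_right integrable_divide i3 i4)
    ultimately show ?thesis
      unfolding packet_deriv_def
        Bochner_Integration.integral_add[OF Bochner_Integration.integrable_add[OF A B] C] Bochner_Integration.integral_add[OF A B]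
      by (simp only: integral_mult_right_zero wave_def)
  qed
qed

lemma wave_has_derivative:
  assumes v: "v \<in> schwartz" and bs: "set bs \<subseteq> Basis" and \<beta>: "0 \<le> \<beta>" and z: "0 < snd Z"
  shows "(wave \<alpha> \<beta> bs v has_derivative (\<lambda>h.
     (\<Sum>b\<in>Basis. of_real (fst (fst h) \<bullet> b) * wave \<alpha> \<beta> (b # bs) v Z)
     + of_real (snd (fst h)) * wave \<alpha> \<beta> bs (iter_deriv [(0, 1)] v) Z
     + of_real (snd h) * (of_real \<alpha> * wave (\<alpha> - 1) \<beta> bs v Z - wave (\<alpha> + 1) (\<beta> + 1) bs v Z / 2))) (at Z)"
proof -
  have w: "iter_deriv [(0, 1)] v \<in> schwartz"
    by (intro schwartz_iter_deriv v) (auto simp: Basis_pairI)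
  define R where "R = \<bar>snd (fst Z)\<bar> + 1"
  define z1 where "z1 = snd Z / 2"
  define z2 where "z2 = snd Z * 2"
  have z12: "0 < z1" "z1 \<le> z2" using z by (auto simp: z1_def z2_def)
  \<comment> \<open>A neighbourhood on which one majorant works: \<open>t\<close> is bounded and
    \<open>z\<close> lies between positive bounds, while \<open>X\<close> is unrestricted.\<close>
  define S where "S = {Z :: ((real^'n) \<times> real) \<times> real. \<bar>snd (fst Z)\<bar> < R \<and> z1 < snd Z \<and> snd Z < z2}"
  have S: "open S" "Z \<in> S"
    unfolding S_def using z by (auto simp: R_def z1_def z2_def intro!: open_Collect_conj open_Collect_less continuous_intros)
  define J where "J p = 1 / (jap (fst p) ^ 1 * jap (snd p) ^ CARD('n))" for p :: "real \<times> (real^'n)"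
  have ex: "\<exists>K\<ge>0. \<forall>Z\<in>S. \<forall>p. norm (packet \<alpha>' \<beta>' bs' v' Z p) \<le> K * J p"
    if "v' \<in> schwartz" "set bs' \<subseteq> Basis" "0 \<le> \<beta>'" for \<alpha>' \<beta>' bs' v'
  proof -
    note hyps = that
    obtain K where "0 \<le> K" "\<And>Z p. \<bar>snd (fst Z)\<bar> \<le> R \<Longrightarrow> z1 \<le> snd Z \<Longrightarrow> snd Z \<le> z2 \<Longrightarrow>
        norm (packet \<alpha>' \<beta>' bs' v' Z p) \<le> K * (1 / (jap (fst p) ^ 1 * jap (snd p) ^ CARD('n)))"
      using packet_bound[OF hyps z12] by metis
    then show ?thesis unfolding S_def J_def by (intro exI[of _ K]) auto
  qed
  have "\<forall>b\<in>Basis. \<exists>K\<ge>0. \<forall>Z\<in>S. \<forall>p. norm (packet \<alpha> \<beta> (b # bs) v Z p) \<le> K * J p"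
    using bs by (intro ballI ex v \<beta>) auto
  then obtain K1 where K1: "\<And>b. b \<in> Basis \<Longrightarrow> 0 \<le> K1 b"
    "\<And>b Z p. b \<in> Basis \<Longrightarrow> Z \<in> S \<Longrightarrow> norm (packet \<alpha> \<beta> (b # bs) v Z p) \<le> K1 b * J p" by metis
  obtain K2 where K2: "0 \<le> K2" "\<And>Z p. Z \<in> S \<Longrightarrow> norm (packet \<alpha> \<beta> bs (iter_deriv [(0, 1)] v) Z p) \<le> K2 * J p"
    using ex[OF w bs \<beta>] by metis
  obtain K3 where K3: "0 \<le> K3" "\<And>Z p. Z \<in> S \<Longrightarrow> norm (packet (\<alpha> - 1) \<beta> bs v Z p) \<le> K3 * J p"
    using ex[OF v bs \<beta>] by metis
  obtain K4 where K4: "0 \<le> K4" "\<And>Z p. Z \<in> S \<Longrightarrow> norm (packet (\<alpha> + 1) (\<beta> + 1) bs v Z p) \<le> K4 * J p"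
    using ex[OF v bs, of "\<beta> + 1" "\<alpha> + 1"] \<beta> by auto
  define K where "K = (\<Sum>b\<in>Basis. K1 b) + K2 + (\<bar>\<alpha>\<bar> * K3 + K4 / 2)"
  have "(wave \<alpha> \<beta> bs v has_derivative (\<lambda>h. LINT p|lborel. packet_deriv \<alpha> \<beta> bs v Z p h)) (at Z)"
    unfolding wave_def[abs_def]
  proof (rule has_derivative_lebesgue_integral[OF S, where g = "\<lambda>p. K * J p"])
    show "integrable lborel (packet \<alpha> \<beta> bs v Z')" if "Z' \<in> S" for Z'
      using that z12 by (intro packet_integrable v bs \<beta>) (auto simp: S_def)
    show "((\<lambda>Z. packet \<alpha> \<beta> bs v Z p) has_derivative packet_deriv \<alpha> \<beta> bs v Z' p) (at Z')" if "Z' \<in> S" for Z' p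
      using that z12 by (intro packet_has_derivative v) (auto simp: S_def)
    show "(\<lambda>p. packet_deriv \<alpha> \<beta> bs v Z p h) \<in> borel_measurable lborel" for h
      using integral_packet_deriv(1)[OF v bs \<beta> z] by (rule borel_measurable_integrable)
    show "integrable lborel (\<lambda>p. K * J p)"
      unfolding J_def by (intro integrable_mult_right integrable_jap_product) auto
    show "norm (packet_deriv \<alpha> \<beta> bs v Z' p h) \<le> K * J p * norm h" if Z': "Z' \<in> S" for Z' p h
    proof -
      have J: "0 \<le> J p" by (simp add: J_def)
      obtain x r \<zeta> where h: "h = ((x, r), \<zeta>)" by (metis prod.collapse)
      have "norm x \<le> norm (x, r)" "\<bar>r\<bar> \<le> norm (x, r)" by (auto simp: norm_Pair)
      moreover have "norm (x, r) \<le> norm h" "\<bar>\<zeta>\<bar> \<le> norm h" using norm_fst_le[of "(x, r)" \<zeta>] norm_snd_le[of \<zeta> "(x, r)"] by (auto simp: h)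
      ultimately have n: "norm x \<le> norm h" "\<bar>r\<bar> \<le> norm h" "\<bar>\<zeta>\<bar> \<le> norm h" by auto
      have "norm (\<Sum>b\<in>Basis. of_real (x \<bullet> b) * packet \<alpha> \<beta> (b # bs) v Z' p) \<le> (\<Sum>b\<in>Basis. norm h * (K1 b * J p))"
      proof (intro order_trans[OF norm_sum] sum_mono)
        fix b :: "real^'n" assume b: "b \<in> Basis"
        have "\<bar>x \<bullet> b\<bar> \<le> norm h" using Basis_le_norm[OF b, of x] n(1) by linarith
        from mult_mono[OF this K1(2)[OF b Z', of p]]
        show "norm (of_real (x \<bullet> b) * packet \<alpha> \<beta> (b # bs) v Z' p) \<le> norm h * (K1 b * J p)"
          by (simp add: norm_mult)
      qed
      also have "\<dots> = (\<Sum>b\<in>Basis. K1 b) * J p * norm h" by (simp add: sum_distrib_left sum_distrib_right mult_ac)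
      finally have 1: "norm (\<Sum>b\<in>Basis. of_real (x \<bullet> b) * packet \<alpha> \<beta> (b # bs) v Z' p) \<le> (\<Sum>b\<in>Basis. K1 b) * J p * norm h" .
      have 2: "norm (of_real r * packet \<alpha> \<beta> bs (iter_deriv [(0, 1)] v) Z' p) \<le> K2 * J p * norm h"
        using mult_mono[OF n(2) K2(2)[OF Z', of p]] by (simp add: norm_mult mult_ac)
      have "norm (of_real \<alpha> * packet (\<alpha> - 1) \<beta> bs v Z' p - packet (\<alpha> + 1) (\<beta> + 1) bs v Z' p / 2)
        \<le> \<bar>\<alpha>\<bar> * (K3 * J p) + K4 * J p / 2"
        using K3(2)[OF Z', of p] K4(2)[OF Z', of p]
        by (intro order_trans[OF norm_triangle_ineq4] add_mono) (auto simp: norm_mult norm_divide intro!: mult_left_mono)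
      from mult_mono[OF n(3) this]
      have 3: "norm (of_real \<zeta> * (of_real \<alpha> * packet (\<alpha> - 1) \<beta> bs v Z' p - packet (\<alpha> + 1) (\<beta> + 1) bs v Z' p / 2))
        \<le> (\<bar>\<alpha>\<bar> * K3 + K4 / 2) * J p * norm h"
        unfolding norm_mult by (simp add: algebra_simps)
      show ?thesis
        unfolding packet_deriv_def h fst_conv snd_conv
        by (rule order_trans[OF norm_triangle_ineq], rule order_trans[OF add_mono[OF order_trans[OF norm_triangle_ineq add_mono[OF 1 2]] 3]])
           (simp add: K_def h algebra_simps)
    qed
  qed
  then show ?thesis unfolding integral_packet_deriv(2)[OF v bs \<beta> z] .
qed

section \<open>A class of functions closed under partial derivatives\<close>

text \<open>The family to which \<open>smooth_on_family\<close> is applied. It contains sums because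
  the derivative of one wave in \<open>z\<close> is a combination of two waves.\<close>

inductive_set waves :: "(((real^'n) \<times> real) \<times> real \<Rightarrow> real) set" where
  wave: "v \<in> schwartz \<Longrightarrow> set bs \<subseteq> Basis \<Longrightarrow> 0 \<le> \<beta> \<Longrightarrow> (\<lambda>Z. Re (c * wave \<alpha> \<beta> bs v Z)) \<in> waves"
| add: "f \<in> waves \<Longrightarrow> g \<in> waves \<Longrightarrow> (\<lambda>Z. f Z + g Z) \<in> waves"

lemma Re_wave_has_derivative:
  assumes v: "v \<in> schwartz" and bs: "set bs \<subseteq> Basis" and \<beta>: "0 \<le> \<beta>" and z: "0 < snd Z"
  shows "((\<lambda>Z. Re (c * wave \<alpha> \<beta> bs v Z)) has_derivative (\<lambda>h. Re (c * (
     (\<Sum>b\<in>Basis. of_real (fst (fst h) \<bullet> b) * wave \<alpha> \<beta> (b # bs) v Z)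
     + of_real (snd (fst h)) * wave \<alpha> \<beta> bs (iter_deriv [(0, 1)] v) Z
     + of_real (snd h) * (of_real \<alpha> * wave (\<alpha> - 1) \<beta> bs v Z - wave (\<alpha> + 1) (\<beta> + 1) bs v Z / 2))))) (at Z)"
  by (intro bounded_linear.has_derivative[OF bounded_linear_Re] has_derivative_mult_right wave_has_derivative assms)

lemma waves_differentiable: "f \<in> waves \<Longrightarrow> 0 < snd Z \<Longrightarrow> f differentiable (at Z)"
proof (induction rule: waves.induct)
  case (wave v bs \<beta> c \<alpha>)
  from Re_wave_has_derivative[OF wave] show ?case by (rule differentiableI)
qed (rule differentiable_add)

lemma waves_derivative:
  assumes "f \<in> waves" "b \<in> Basis"
  shows "\<exists>g\<in>waves. \<forall>Z. 0 < snd Z \<longrightarrow> frechet_derivative f (at Z) b = g Z"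
  using assms
proof (induction rule: waves.induct)
  case (wave v bs \<beta> c \<alpha>)
  have w: "iter_deriv [(0, 1)] v \<in> schwartz"
    by (intro schwartz_iter_deriv wave) (auto simp: Basis_pairI)
  have fd: "frechet_derivative (\<lambda>Z. Re (c * wave \<alpha> \<beta> bs v Z)) (at Z) b = Re (c * (
     (\<Sum>b'\<in>Basis. of_real (fst (fst b) \<bullet> b') * wave \<alpha> \<beta> (b' # bs) v Z)
     + of_real (snd (fst b)) * wave \<alpha> \<beta> bs (iter_deriv [(0, 1)] v) Z
     + of_real (snd b) * (of_real \<alpha> * wave (\<alpha> - 1) \<beta> bs v Z - wave (\<alpha> + 1) (\<beta> + 1) bs v Z / 2)))"
    if "0 < snd Z" for Z
    using frechet_derivative_at[OF Re_wave_has_derivative[OF wave(1-3) that], symmetric] by simp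
  from \<open>b \<in> Basis\<close> consider (x) e where "e \<in> Basis" "b = ((e, 0), 0)" | (t) "b = ((0, 1), 0)" | (z) "b = ((0, 0), 1)"
    by (auto simp: Basis_prod_def zero_prod_def)
  then show ?case
  proof cases
    case x
    have "(\<Sum>b'\<in>Basis. of_real (e \<bullet> b') * wave \<alpha> \<beta> (b' # bs) v Z) = wave \<alpha> \<beta> (e # bs) v Z" for Z
    proof -
      have "(\<Sum>b'\<in>Basis. of_real (e \<bullet> b') * wave \<alpha> \<beta> (b' # bs) v Z) = (\<Sum>b'\<in>Basis. if b' = e then wave \<alpha> \<beta> (e # bs) v Z else 0)"
        using x by (intro sum.cong) (auto simp: inner_Basis)
      then show ?thesis using x by simp
    qed
    then show ?thesis
      using fd x wave by (intro bexI[of _ "\<lambda>Z. Re (c * wave \<alpha> \<beta> (e # bs) v Z)"] waves.wave) auto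
  next
    case t
    then show ?thesis
      using fd wave w by (intro bexI[of _ "\<lambda>Z. Re (c * wave \<alpha> \<beta> bs (iter_deriv [(0, 1)] v) Z)"] waves.wave) (auto simp del: iter_deriv.simps)
  next
    case z
    then show ?thesis
      using fd wave
      by (intro bexI[of _ "\<lambda>Z. Re ((c * of_real \<alpha>) * wave (\<alpha> - 1) \<beta> bs v Z) + Re ((- c / 2) * wave (\<alpha> + 1) (\<beta> + 1) bs v Z)"] waves.add waves.wave)
         (auto simp: zero_prod_def right_diff_distrib mult.assoc simp del: iter_deriv.simps)
  qed
next
  case (add f g)
  then obtain f' g' where "f' \<in> waves" "\<And>Z. 0 < snd Z \<Longrightarrow> frechet_derivative f (at Z) b = f' Z"
    "g' \<in> waves" "\<And>Z. 0 < snd Z \<Longrightarrow> frechet_derivative g (at Z) b = g' Z" by metis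
  moreover have "frechet_derivative (\<lambda>Z. f Z + g Z) (at Z) b = frechet_derivative f (at Z) b + frechet_derivative g (at Z) b"
    if "0 < snd Z" for Z
  proof -
    have "f differentiable (at Z)" "g differentiable (at Z)" using add that by (auto intro: waves_differentiable)
    from has_derivative_add[OF this[unfolded frechet_derivative_works]] show ?thesis
      by (simp flip: frechet_derivative_at)
  qed
  ultimately show ?case by (intro bexI[of _ "\<lambda>Z. f' Z + g' Z"] waves.add) auto
qed

lemma smooth_on_waves:
  assumes "g \<in> waves" "\<And>Z. 0 < snd Z \<Longrightarrow> f Z = g Z"
  shows "smooth_on (UNIV \<times> {0<..}) f"
proof (rule smooth_on_family[OF _ assms(1)])
  show "open (UNIV \<times> {0<..} :: (((real^'n) \<times> real) \<times> real) set)" by (intro open_Times) auto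
  show "f Z = g Z" if "Z \<in> UNIV \<times> {0<..}" for Z using assms(2)[of Z] that by (cases Z) auto
  show "f differentiable (at Z)" if "f \<in> waves" "Z \<in> UNIV \<times> {0<..}" for f Z
    using waves_differentiable[OF that(1), of Z] that(2) by (cases Z) auto
  show "\<exists>g\<in>waves. \<forall>Z\<in>UNIV \<times> {0<..}. frechet_derivative f (at Z) b = g Z" if "f \<in> waves" "b \<in> Basis" for f b
    using waves_derivative[OF that] by (auto simp del: split_paired_All)
qed

end

section \<open>The heat equation for superpositions\<close>

lemma weight_mult: "0 < z \<Longrightarrow> z * weight \<alpha> \<beta> \<tau> z = weight (\<alpha> + 1) \<beta> \<tau> z"
  by (simp add: weight_def powr_add)

lemma weight_time_mult: "0 < \<tau> \<Longrightarrow> \<tau> * weight \<alpha> (\<beta> + 1) \<tau> z = weight \<alpha> \<beta> \<tau> z"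
  by (simp add: weight_def powr_diff)

text \<open>For \<open>\<alpha> = 2 * s\<close> and \<open>\<beta> = 1 + s\<close> the right side is
  also the Bessel operator in \<open>z\<close> applied to the weight;
  \<open>extension_equation\<close> carries out this comparison on the level of waves.\<close>

lemma weight_time_deriv:
  assumes "0 < z" "0 < \<tau>"
  shows "((\<lambda>\<tau>. weight \<alpha> \<beta> \<tau> z) has_real_derivative weight (\<alpha> + 2) (\<beta> + 2) \<tau> z / 4 - \<beta> * weight \<alpha> (\<beta> + 1) \<tau> z) (at \<tau>)"
proof -
  have a: "((\<lambda>\<tau>. \<tau> powr (- \<beta>)) has_real_derivative (- \<beta>) * \<tau> powr (- \<beta> - 1)) (at \<tau>)"
    using assms by (intro has_real_derivative_powr)
  have b: "((\<lambda>\<tau>. exp (- z\<^sup>2 / (4 * \<tau>))) has_real_derivative exp (- z\<^sup>2 / (4 * \<tau>)) * (z\<^sup>2 / (4 * \<tau>\<^sup>2))) (at \<tau>)"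
    using assms by (auto intro!: derivative_eq_intros simp: field_simps power2_eq_square)
  have p: "z powr (\<alpha> + 2) = z powr \<alpha> * z\<^sup>2" "\<tau> powr (- (\<beta> + 2)) = \<tau> powr (- \<beta>) / \<tau>\<^sup>2"
    "\<tau> powr (- (\<beta> + 1)) = \<tau> powr (- \<beta>) / \<tau>" "\<tau> powr (- \<beta> - 1) = \<tau> powr (- \<beta>) / \<tau>"
    using assms by (simp_all add: powr_add powr_diff)
  have eq: "z powr \<alpha> * ((- \<beta>) * \<tau> powr (- \<beta> - 1) * exp (- z\<^sup>2 / (4 * \<tau>))
     + exp (- z\<^sup>2 / (4 * \<tau>)) * (z\<^sup>2 / (4 * \<tau>\<^sup>2)) * \<tau> powr (- \<beta>))
     = weight (\<alpha> + 2) (\<beta> + 2) \<tau> z / 4 - \<beta> * weight \<alpha> (\<beta> + 1) \<tau> z"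
    unfolding weight_def p by (simp add: algebra_simps)
  show ?thesis
    using DERIV_cong[OF DERIV_cmult[OF DERIV_mult[OF a b]] eq]
    by (simp only: weight_def mult.assoc)
qed

context kolmogorov
begin

lemma isCont_mode:
  assumes v: "v \<in> schwartz"
  shows "isCont (\<lambda>\<tau>. mode bs v X t \<tau> \<xi>) \<tau>"
proof -
  have c: "continuous_on UNIV (\<lambda>\<tau>. symb bs (freq \<tau> \<xi>) * complex_of_real (exp (- covq \<tau> \<xi>)) * exp (\<i> * of_real (freq \<tau> \<xi> \<bullet> X)))"
    by (intro continuous_intros)
  have "isCont (\<lambda>r. partial_FT v r \<xi>) (t - \<tau>)"
    by (rule has_vector_derivative_continuous[OF partial_FT_time_deriv[OF v]])
  then have "isCont (\<lambda>\<tau>. partial_FT v (t - \<tau>) \<xi>) \<tau>"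
    by (intro isCont_o2[where g = "\<lambda>r. partial_FT v r \<xi>" and f = "\<lambda>\<tau>. t - \<tau>"]) (auto intro!: continuous_intros)
  then show ?thesis
    unfolding mode_def using c by (intro isCont_mult[of _ "\<lambda>\<tau>. symb bs (freq \<tau> \<xi>) * complex_of_real (exp (- covq \<tau> \<xi>)) * exp (\<i> * of_real (freq \<tau> \<xi> \<bullet> X))"])
      (simp_all add: continuous_on_eq_continuous_at)
qed

text \<open>The three factors of the mode produce the three parts of the operator:
  \<open>covq\<close> the second-order symbol, the phase the drift, and the shift
  \<open>t - \<tau>\<close> the time derivative with a minus sign.\<close>

lemma mode_time_deriv:
  assumes v: "v \<in> schwartz"
  shows "((\<lambda>\<tau>. mode [] v X t \<tau> \<xi>) has_vector_derivative
    of_real (- ((Q *v freq \<tau> \<xi>) \<bullet> freq \<tau> \<xi>)) * mode [] v X t \<tau> \<xi>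
    + \<i> * of_real (freq \<tau> \<xi> \<bullet> (B *v X)) * mode [] v X t \<tau> \<xi>
    - mode [] (iter_deriv [(0, 1)] v) X t \<tau> \<xi>) (at \<tau>)"
proof -
  let ?g = "\<lambda>\<tau>. exp (complex_of_real (- covq \<tau> \<xi>) + \<i> * of_real (freq \<tau> \<xi> \<bullet> X))"
  let ?d = "of_real (- ((Q *v freq \<tau> \<xi>) \<bullet> freq \<tau> \<xi>)) + \<i> * of_real (freq \<tau> \<xi> \<bullet> (B *v X))"
  have "((\<lambda>\<tau>. complex_of_real (- covq \<tau> \<xi>) + \<i> * of_real (freq \<tau> \<xi> \<bullet> X)) has_vector_derivative ?d) (at \<tau>)"
    by (intro has_vector_derivative_add has_vector_derivative_mult_right has_vector_derivative_of_real
        DERIV_minus covq_deriv freq_inner_deriv)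
  then have "(?g has_vector_derivative (?d * ?g \<tau>)) (at \<tau>)"
    using field_vector_diff_chain_at[of _ ?d \<tau> exp] by (simp add: comp_def DERIV_exp)
  moreover have "((\<lambda>\<tau>. partial_FT v (t - \<tau>) \<xi>) has_vector_derivative (-1) *\<^sub>R partial_FT (iter_deriv [(0, 1)] v) (t - \<tau>) \<xi>) (at \<tau>)"
  proof -
    have "((\<lambda>\<tau>. t - \<tau>) has_vector_derivative (-1)) (at \<tau>)"
      by (auto intro!: derivative_eq_intros simp flip: has_real_derivative_iff_has_vector_derivative)
    from vector_diff_chain_at[OF this partial_FT_time_deriv[OF v]] show ?thesis by (simp add: comp_def)
  qed
  ultimately have D: "((\<lambda>\<tau>. ?g \<tau> * partial_FT v (t - \<tau>) \<xi>) has_vector_derivative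
     ?g \<tau> * ((-1) *\<^sub>R partial_FT (iter_deriv [(0, 1)] v) (t - \<tau>) \<xi>) + ?d * ?g \<tau> * partial_FT v (t - \<tau>) \<xi>) (at \<tau>)"
    by (rule has_vector_derivative_mult)
  have m: "mode [] w X t \<tau> \<xi> = ?g \<tau> * partial_FT w (t - \<tau>) \<xi>" for w \<tau>
    by (simp only: mode_def symb_simps exp_add exp_of_real mult_1_left)
  show ?thesis
    unfolding m by (rule has_vector_derivative_eq_rhs[OF D]) (simp add: algebra_simps del: iter_deriv.simps)
qed

text \<open>The list has \<open>j\<close> before \<open>i\<close> because the trace of
  \<open>Q ** H\<close> pairs the entry of \<open>Q\<close> at \<open>(i, j)\<close> with that of
  the Hessian \<open>H\<close> at \<open>(j, i)\<close>.\<close>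

lemma quadratic_symbol:
  "(\<Sum>i\<in>UNIV. \<Sum>j\<in>UNIV. of_real (Q $ i $ j) * mode [axis j 1, axis i 1] v X t \<tau> \<xi>)
     = of_real (- ((Q *v freq \<tau> \<xi>) \<bullet> freq \<tau> \<xi>)) * mode [] v X t \<tau> \<xi>"
proof -
  let ?\<theta> = "freq \<tau> \<xi>"
  have "mode [axis j 1, axis i 1] v X t \<tau> \<xi> = of_real (- (?\<theta> $ j * ?\<theta> $ i)) * mode [] v X t \<tau> \<xi>" for i j
    by (simp add: mode_def inner_axis flip: mult.assoc) (simp add: mult_ac)
  then have "(\<Sum>i\<in>UNIV. \<Sum>j\<in>UNIV. of_real (Q $ i $ j) * mode [axis j 1, axis i 1] v X t \<tau> \<xi>)
     = of_real (\<Sum>i\<in>UNIV. \<Sum>j\<in>UNIV. Q $ i $ j * - (?\<theta> $ j * ?\<theta> $ i)) * mode [] v X t \<tau> \<xi>"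
    by (simp add: sum_distrib_right mult.assoc)
  also have "(\<Sum>i\<in>UNIV. \<Sum>j\<in>UNIV. Q $ i $ j * - (?\<theta> $ j * ?\<theta> $ i)) = - ((Q *v ?\<theta>) \<bullet> ?\<theta>)"
    by (simp add: inner_vec_def matrix_vector_mult_def sum_negf sum_distrib_left mult_ac)
  finally show ?thesis .
qed

lemma drift_symbol:
  "(\<Sum>i\<in>UNIV. of_real ((B *v X) $ i) * mode [axis i 1] v X t \<tau> \<xi>)
     = \<i> * of_real (freq \<tau> \<xi> \<bullet> (B *v X)) * mode [] v X t \<tau> \<xi>"
proof -
  have "mode [axis i 1] v X t \<tau> \<xi> = \<i> * of_real (freq \<tau> \<xi> $ i) * mode [] v X t \<tau> \<xi>" for i
    by (simp add: mode_def inner_axis)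
  then show ?thesis
    by (simp add: inner_vec_def sum_distrib_left sum_distrib_right mult_ac)
qed

text \<open>The operator \<open>A_op\<close> minus the time derivative applied to the packet, plus
  the contribution of the weight to the derivative in \<open>\<tau>\<close>. By
  \<open>packet_time_deriv\<close> it is the total derivative in \<open>\<tau>\<close>.\<close>

definition heat_packet :: "real \<Rightarrow> real \<Rightarrow> ((real^'n) \<times> real \<Rightarrow> real) \<Rightarrow> ((real^'n) \<times> real) \<times> real \<Rightarrow> real \<times> (real^'n) \<Rightarrow> complex" where
  "heat_packet \<alpha> \<beta> v Z p =
     (\<Sum>i\<in>UNIV. \<Sum>j\<in>UNIV. of_real (Q $ i $ j) * packet \<alpha> \<beta> [axis j 1, axis i 1] v Z p)
     + (\<Sum>i\<in>UNIV. of_real ((B *v fst (fst Z)) $ i) * packet \<alpha> \<beta> [axis i 1] v Z p)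
     + (packet (\<alpha> + 2) (\<beta> + 2) [] v Z p / 4 - of_real \<beta> * packet \<alpha> (\<beta> + 1) [] v Z p)
     - packet \<alpha> \<beta> [] (iter_deriv [(0, 1)] v) Z p"

lemma packet_time_deriv:
  assumes v: "v \<in> schwartz" and z: "0 < snd Z" and \<tau>: "0 < \<tau>"
  shows "((\<lambda>\<tau>. packet \<alpha> \<beta> [] v Z (\<tau>, \<xi>)) has_vector_derivative heat_packet \<alpha> \<beta> v Z (\<tau>, \<xi>)) (at \<tau>)"
proof -
  obtain X t z where Z: "Z = ((X, t), z)" by (metis prod.collapse)
  have z: "0 < z" using z Z by simp
  let ?w = "\<lambda>\<tau>. weight \<alpha> \<beta> \<tau> z" and ?m = "\<lambda>\<tau>. mode [] v X t \<tau> \<xi>"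
  let ?w' = "weight (\<alpha> + 2) (\<beta> + 2) \<tau> z / 4 - \<beta> * weight \<alpha> (\<beta> + 1) \<tau> z"
  have "((\<lambda>\<tau>. complex_of_real (?w \<tau>)) has_vector_derivative of_real ?w') (at \<tau>)"
    using weight_time_deriv[OF z \<tau>, of \<alpha> \<beta>]
    by (intro has_vector_derivative_of_real) (simp only: has_real_derivative_iff_has_vector_derivative)
  from has_vector_derivative_mult[OF this mode_time_deriv[OF v, of X t \<xi> \<tau>]]
  have "((\<lambda>\<tau>. of_real (?w \<tau>) * ?m \<tau>) has_vector_derivative heat_packet \<alpha> \<beta> v Z (\<tau>, \<xi>)) (at \<tau>)"
  proof (rule has_vector_derivative_eq_rhs)
    show "of_real (?w \<tau>) * (of_real (- ((Q *v freq \<tau> \<xi>) \<bullet> freq \<tau> \<xi>)) * mode [] v X t \<tau> \<xi>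
        + \<i> * of_real (freq \<tau> \<xi> \<bullet> (B *v X)) * mode [] v X t \<tau> \<xi>
        - mode [] (iter_deriv [(0, 1)] v) X t \<tau> \<xi>) + of_real ?w' * ?m \<tau> = heat_packet \<alpha> \<beta> v Z (\<tau>, \<xi>)"
      using \<tau> unfolding quadratic_symbol[symmetric] drift_symbol[symmetric] heat_packet_def packet_def Z
      by (simp add: sum_distrib_left algebra_simps del: iter_deriv.simps)
  qed
  then show ?thesis
  proof (rule has_vector_derivative_transform_within_open[of _ _ _ "{0<..}"])
    show "of_real (?w \<tau>) * ?m \<tau> = packet \<alpha> \<beta> [] v Z (\<tau>, \<xi>)" if "\<tau> \<in> {0<..}" for \<tau>
      using that by (simp add: packet_def Z)
  qed (use \<tau> in auto)
qed

lemma isCont_packet: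
  assumes v: "v \<in> schwartz" and z: "0 < snd Z" and \<tau>: "0 < \<tau>"
  shows "isCont (\<lambda>\<tau>. packet \<alpha> \<beta> bs v Z (\<tau>, \<xi>)) \<tau>"
proof -
  have "isCont (\<lambda>\<tau>. complex_of_real (weight \<alpha> \<beta> \<tau> (snd Z)) * mode bs v (fst (fst Z)) (snd (fst Z)) \<tau> \<xi>) \<tau>"
    using weight_time_deriv[OF z \<tau>, of \<alpha> \<beta>]
    by (intro continuous_mult isCont_mode v continuous_of_real) (auto dest: DERIV_isCont)
  moreover have "\<forall>\<^sub>F \<tau> in nhds \<tau>. complex_of_real (weight \<alpha> \<beta> \<tau> (snd Z)) * mode bs v (fst (fst Z)) (snd (fst Z)) \<tau> \<xi> = packet \<alpha> \<beta> bs v Z (\<tau>, \<xi>)"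
    using eventually_nhds_in_open[of "{0<..}" \<tau>] \<tau> by (auto simp: packet_def elim!: eventually_mono)
  ultimately show ?thesis by (rule iffD1[OF isCont_cong, rotated])
qed

text \<open>Near 0 the packet is \<open>\<tau>\<close> times the one with
  \<open>\<beta> + 1\<close>, which is still bounded; at infinity the majorant of
  \<open>packet_bound\<close> itself decays.\<close>

lemma packet_tendsto_0:
  assumes v: "v \<in> schwartz" and z: "0 < snd Z" and \<beta>: "0 \<le> \<beta>"
  shows "((\<lambda>\<tau>. packet \<alpha> \<beta> [] v Z (\<tau>, \<xi>)) \<longlongrightarrow> 0) (at_right 0)"
    and "((\<lambda>\<tau>. packet \<alpha> \<beta> [] v Z (\<tau>, \<xi>)) \<longlongrightarrow> 0) at_top"
proof -
  have nil: "set [] \<subseteq> (Basis :: (real^'n) set)" and \<beta>1: "0 \<le> \<beta> + 1" using \<beta> by auto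
  obtain K1 where K1: "0 \<le> K1" "\<And>p. norm (packet \<alpha> (\<beta> + 1) [] v Z p) \<le> K1 * (1 / (jap (fst p) ^ 1 * jap (snd p) ^ CARD('n)))"
    using packet_bound[OF v nil \<beta>1 z order_refl, of "\<bar>snd (fst Z)\<bar>" \<alpha>] by (metis order_refl)
  have le1: "1 / (jap r ^ 1 * jap \<xi> ^ CARD('n)) \<le> 1 / jap r" for r :: real
    using mult_mono[OF order_refl one_le_power[OF jap_ge_1[of \<xi>], of "CARD('n)"], of "jap r"]
    by (intro divide_left_mono) auto
  show "((\<lambda>\<tau>. packet \<alpha> \<beta> [] v Z (\<tau>, \<xi>)) \<longlongrightarrow> 0) (at_right 0)"
  proof (rule Lim_null_comparison)
    show "((\<lambda>\<tau>. \<tau> * K1) \<longlongrightarrow> 0) (at_right 0)" by (auto intro!: tendsto_eq_intros)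
    show "\<forall>\<^sub>F \<tau> in at_right 0. norm (packet \<alpha> \<beta> [] v Z (\<tau>, \<xi>)) \<le> \<tau> * K1"
      unfolding eventually_at_right_field
    proof (intro exI[of _ 1] conjI allI impI)
      fix \<tau> :: real assume \<tau>: "0 < \<tau>" "\<tau> < 1"
      have "packet \<alpha> \<beta> [] v Z (\<tau>, \<xi>) = of_real \<tau> * packet \<alpha> (\<beta> + 1) [] v Z (\<tau>, \<xi>)"
        using \<tau> weight_time_mult[of \<tau> \<alpha> \<beta> "snd Z"] by (simp add: packet_def flip: of_real_mult mult.assoc)
      then have "norm (packet \<alpha> \<beta> [] v Z (\<tau>, \<xi>)) = \<tau> * norm (packet \<alpha> (\<beta> + 1) [] v Z (\<tau>, \<xi>))"
        using \<tau> by (simp add: norm_mult)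
      also have "\<dots> \<le> \<tau> * (K1 * 1)"
      proof (intro mult_left_mono order_trans[OF K1(2)])
        show "1 / (jap (fst (\<tau>, \<xi>)) ^ 1 * jap (snd (\<tau>, \<xi>)) ^ CARD('n)) \<le> 1"
          using order_trans[OF le1[of \<tau>], of 1] by simp
      qed (use K1 \<tau> in auto)
      finally show "norm (packet \<alpha> \<beta> [] v Z (\<tau>, \<xi>)) \<le> \<tau> * K1" by simp
    qed simp
  qed
  obtain K2 where K2: "0 \<le> K2" "\<And>p. norm (packet \<alpha> \<beta> [] v Z p) \<le> K2 * (1 / (jap (fst p) ^ 1 * jap (snd p) ^ CARD('n)))"
    using packet_bound[OF v nil \<beta> z order_refl, of "\<bar>snd (fst Z)\<bar>" \<alpha>] by (metis order_refl)
  show "((\<lambda>\<tau>. packet \<alpha> \<beta> [] v Z (\<tau>, \<xi>)) \<longlongrightarrow> 0) at_top"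
  proof (rule Lim_null_comparison)
    show "((\<lambda>\<tau>. K2 * inverse \<tau>) \<longlongrightarrow> 0) at_top"
      by (intro tendsto_mult_right_zero tendsto_inverse_0_at_top filterlim_ident)
    show "\<forall>\<^sub>F \<tau> in at_top. norm (packet \<alpha> \<beta> [] v Z (\<tau>, \<xi>)) \<le> K2 * inverse \<tau>"
      using eventually_gt_at_top[of 0]
    proof eventually_elim
      fix \<tau> :: real assume \<tau>: "0 < \<tau>"
      have "\<tau> \<le> jap \<tau>" using zero_le_power2[of "\<tau> - 1"] \<tau> by (simp add: power2_diff)
      then have "1 / jap \<tau> \<le> inverse \<tau>" using \<tau> by (simp add: inverse_eq_divide frac_le)
      then have "1 / (jap (fst (\<tau>, \<xi>)) ^ 1 * jap (snd (\<tau>, \<xi>)) ^ CARD('n)) \<le> inverse \<tau>" using le1[of \<tau>] by simp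
      from mult_left_mono[OF this K2(1)] show "norm (packet \<alpha> \<beta> [] v Z (\<tau>, \<xi>)) \<le> K2 * inverse \<tau>"
        using K2(2)[of "(\<tau>, \<xi>)"] by linarith
    qed
  qed
qed

lemma integral_heat_packet:
  assumes v: "v \<in> schwartz" and z: "0 < snd Z" and \<beta>: "0 \<le> \<beta>"
  shows "integrable lborel (heat_packet \<alpha> \<beta> v Z)" and "(LINT p|lborel. heat_packet \<alpha> \<beta> v Z p) = 0"
proof -
  have w: "iter_deriv [(0, 1)] v \<in> schwartz"
    by (intro schwartz_iter_deriv v) (auto simp: Basis_pairI)
  show int: "integrable lborel (heat_packet \<alpha> \<beta> v Z)"
    unfolding heat_packet_def[abs_def]
    by (intro Bochner_Integration.integrable_add Bochner_Integration.integrable_diff Bochner_Integration.integrable_sum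
        integrable_mult_right integrable_divide packet_integrable v w z) (use \<beta> in \<open>auto simp: axis_in_Basis_iff\<close>)
  then have int': "integrable (lborel \<Otimes>\<^sub>M lborel) (case_prod (\<lambda>\<tau> \<xi>. heat_packet \<alpha> \<beta> v Z (\<tau>, \<xi>)))"
    by (simp add: lborel_prod)
  \<comment> \<open>Fubini makes \<open>\<tau>\<close> the inner variable, so that for almost every
    frequency the fundamental theorem of calculus applies on the half-line.\<close>
  have "(LINT p|lborel. heat_packet \<alpha> \<beta> v Z p) = (LINT \<xi>|lborel. LINT \<tau>|lborel. heat_packet \<alpha> \<beta> v Z (\<tau>, \<xi>))"
    using lborel_pair.integral_snd[OF int'] by (simp add: lborel_prod)
  also have "\<dots> = (LINT \<xi>|(lborel :: (real^'n) measure). 0)"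
  proof (rule integral_cong_AE)
    show "AE \<xi> in lborel. (LINT \<tau>|lborel. heat_packet \<alpha> \<beta> v Z (\<tau>, \<xi>)) = 0"
      using lborel_pair.AE_integrable_snd[OF int']
    proof eventually_elim
      fix \<xi> assume i: "integrable lborel (\<lambda>\<tau>. heat_packet \<alpha> \<beta> v Z (\<tau>, \<xi>))"
      have neg: "heat_packet \<alpha> \<beta> v Z (\<tau>, \<xi>) = 0" if "\<tau> \<le> 0" for \<tau>
        using that by (simp add: heat_packet_def packet_def)
      have set: "einterval 0 \<infinity> = {0<..}" by (auto simp: einterval_def)
      have "(LBINT \<tau>=0..\<infinity>. heat_packet \<alpha> \<beta> v Z (\<tau>, \<xi>)) = 0 - 0"
      proof (rule interval_integral_FTC_integrable[where F = "\<lambda>\<tau>. packet \<alpha> \<beta> [] v Z (\<tau>, \<xi>)"])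
        show "((\<lambda>\<tau>. packet \<alpha> \<beta> [] v Z (\<tau>, \<xi>)) has_vector_derivative heat_packet \<alpha> \<beta> v Z (\<tau>, \<xi>)) (at \<tau>)" if "0 < ereal \<tau>" for \<tau>
          using that by (intro packet_time_deriv v z) simp
        show "isCont (\<lambda>\<tau>. heat_packet \<alpha> \<beta> v Z (\<tau>, \<xi>)) \<tau>" if "0 < ereal \<tau>" for \<tau>
          using that unfolding heat_packet_def
          by (intro continuous_intros isCont_packet v w z) simp_all
        show "set_integrable lborel (einterval 0 \<infinity>) (\<lambda>\<tau>. heat_packet \<alpha> \<beta> v Z (\<tau>, \<xi>))"
          unfolding set set_integrable_def using i by (intro integrable_mult_indicator) auto
        show "(((\<lambda>\<tau>. packet \<alpha> \<beta> [] v Z (\<tau>, \<xi>)) \<circ> real_of_ereal) \<longlongrightarrow> 0) (at_right 0)"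
          using packet_tendsto_0(1)[OF v z \<beta>] by (simp add: zero_ereal_def ereal_tendsto_simps)
        show "(((\<lambda>\<tau>. packet \<alpha> \<beta> [] v Z (\<tau>, \<xi>)) \<circ> real_of_ereal) \<longlongrightarrow> 0) (at_left \<infinity>)"
          using packet_tendsto_0(2)[OF v z \<beta>] by (simp add: ereal_tendsto_simps)
      qed auto
      moreover have "(LBINT \<tau>=0..\<infinity>. heat_packet \<alpha> \<beta> v Z (\<tau>, \<xi>)) = (LINT \<tau>|lborel. heat_packet \<alpha> \<beta> v Z (\<tau>, \<xi>))"
        unfolding interval_lebesgue_integral_def set set_lebesgue_integral_def
        by (simp, intro Bochner_Integration.integral_cong refl) (auto simp: neg indicator_def)
      ultimately show "(LINT \<tau>|lborel. heat_packet \<alpha> \<beta> v Z (\<tau>, \<xi>)) = 0" by simp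
    qed
  qed (use lborel_pair.integrable_snd[OF int'] in auto)
  finally show "(LINT p|lborel. heat_packet \<alpha> \<beta> v Z p) = 0" by simp
qed

lemma wave_heat_equation:
  assumes v: "v \<in> schwartz" and z: "0 < snd Z" and \<beta>: "0 \<le> \<beta>"
  shows "(\<Sum>i\<in>UNIV. \<Sum>j\<in>UNIV. of_real (Q $ i $ j) * wave \<alpha> \<beta> [axis j 1, axis i 1] v Z)
     + (\<Sum>i\<in>UNIV. of_real ((B *v fst (fst Z)) $ i) * wave \<alpha> \<beta> [axis i 1] v Z)
     + (wave (\<alpha> + 2) (\<beta> + 2) [] v Z / 4 - of_real \<beta> * wave \<alpha> (\<beta> + 1) [] v Z)
     - wave \<alpha> \<beta> [] (iter_deriv [(0, 1)] v) Z = 0" (is "?A + ?D + ?E - ?F = 0")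
proof -
  have w: "iter_deriv [(0, 1)] v \<in> schwartz"
    by (intro schwartz_iter_deriv v) (auto simp: Basis_pairI)
  have has: "has_bochner_integral lborel (packet \<alpha>' \<beta>' bs v' Z) (wave \<alpha>' \<beta>' bs v' Z)"
    if "v' \<in> schwartz" "set bs \<subseteq> Basis" "0 \<le> \<beta>'" for \<alpha>' \<beta>' bs v'
    unfolding wave_def using packet_integrable[OF that z] by (rule has_bochner_integral_integrable)
  have "has_bochner_integral lborel (heat_packet \<alpha> \<beta> v Z) (?A + ?D + ?E - ?F)"
    unfolding heat_packet_def[abs_def]
    by (intro has_bochner_integral_add has_bochner_integral_diff has_bochner_integral_sum
        has_bochner_integral_mult_right has_bochner_integral_divide has v w)
       (use \<beta> in \<open>auto simp: axis_in_Basis_iff\<close>)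
  then have "(LINT p|lborel. heat_packet \<alpha> \<beta> v Z p) = ?A + ?D + ?E - ?F"
    by (rule has_bochner_integral_integral_eq)
  then show ?thesis by (simp only: integral_heat_packet(2)[OF v z \<beta>])
qed

end

section \<open>The extension equation\<close>

lemma sum_Basis_inner_delta:
  assumes "e \<in> Basis"
  shows "(\<Sum>b\<in>Basis. complex_of_real (e \<bullet> b) * f b) = f e"
proof -
  have "(\<Sum>b\<in>Basis. complex_of_real (e \<bullet> b) * f b) = (\<Sum>b\<in>Basis. if b = e then f e else 0)"
    using assms by (intro sum.cong) (auto simp: inner_Basis)
  then show ?thesis using assms by simp
qed

text \<open>The constant of the Poisson kernel at \<open>a = 1 - 2 * s\<close>; it gives the weight
  of \<open>U\<close> total mass 1.\<close>

definition ext_const :: "real \<Rightarrow> real" where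
  "ext_const s = 1 / (2 powr (2 * s) * Gamma s)"

lemma poisson_kernel_eq:
  assumes "0 < z" "0 < \<tau>"
  shows "poisson_kernel (1 - 2 * s) Q B z X Y \<tau> = ext_const s * weight (2 * s) (1 + s) \<tau> z * kol_kernel Q B X Y \<tau>"
proof -
  have "(3 - (1 - 2 * s)) / 2 = 1 + s" by simp
  then have "1 / \<tau> powr ((3 - (1 - 2 * s)) / 2) = \<tau> powr (- (1 + s))"
    by (simp only: powr_minus inverse_eq_divide)
  then have "z powr (1 - (1 - 2 * s)) / \<tau> powr ((3 - (1 - 2 * s)) / 2) = z powr (1 - (1 - 2 * s)) * \<tau> powr (- (1 + s))"
    by (metis mult.right_neutral times_divide_eq_right)
  then show ?thesis
    by (simp add: poisson_kernel_def ext_const_def weight_def)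
qed

context kolmogorov
begin

lemma integrable_exp_covq:
  assumes "0 < \<tau>"
  shows "integrable lborel (\<lambda>\<xi>. exp (- covq \<tau> \<xi>))"
proof -
  have "integrable lborel (\<lambda>\<xi>. complex_of_real (exp (- covq \<tau> \<xi>)))"
    using fourier_gauss_density(1)[OF transpose_cov pos_def_cov[OF assms], of 0]
    by (simp add: covq_def exp_of_real[symmetric])
  then show ?thesis by (simp only: complex_of_real_integrable_eq)
qed

text \<open>One double integral \<open>f\<close> over frequency and space, evaluated in both orders.
  Integration in \<open>Y\<close> yields the mode; integration in \<open>\<xi>\<close> yields the
  kernel by \<open>fourier_gauss_density\<close>. Absolute convergence holds because the modulus is
  a product of a Gaussian in \<open>\<xi>\<close> and a slice of \<open>v\<close>.\<close>

lemma semigroup_eq_Fourier: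
  assumes v: "v \<in> schwartz" and \<tau>: "0 < \<tau>"
  shows "(LINT \<xi>|lborel. mode [] v X t \<tau> \<xi>) = of_real ((2 * pi) ^ CARD('n) * evol_semigroup Q B \<tau> v (X, t))"
proof -
  define r where "r = t - \<tau>"
  note [measurable] = schwartz_measurable[OF v]
  define f where "f \<xi> Y = exp (\<i> * of_real (\<xi> \<bullet> (flow \<tau> *v X - Y)) - of_real ((cov \<tau> *v \<xi>) \<bullet> \<xi>)) * complex_of_real (v (Y, r))" for \<xi> Y
  have nf: "norm (f \<xi> Y) = exp (- covq \<tau> \<xi>) * \<bar>v (Y, r)\<bar>" for \<xi> Y
    by (simp add: f_def norm_mult norm_exp_eq_Re covq_def)
  have "integrable lborel (\<lambda>p. exp (- covq \<tau> (fst p)) * \<bar>v (snd p, r)\<bar>)"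
    by (intro integrable_pair_product[where g = "\<lambda>Y. \<bar>v (Y, r)\<bar>"] integrable_exp_covq \<tau> integrable_abs schwartz_slice_integrable v)
  then have "integrable lborel (\<lambda>p. f (fst p) (snd p))"
  proof (rule Bochner_Integration.integrable_bound)
    have "continuous_on UNIV (\<lambda>p. f (fst p) (snd p))"
      unfolding f_def
      by (intro continuous_intros continuous_on_matrix_vector_mult continuous_on_compose2[OF schwartz_continuous[OF v]]) auto
    then show "(\<lambda>p. f (fst p) (snd p)) \<in> borel_measurable lborel"
      by (simp add: borel_measurable_continuous_onI)
  qed (simp add: nf)
  then have "integrable (lborel \<Otimes>\<^sub>M lborel) (case_prod f)"
    by (simp add: lborel_prod case_prod_beta')
  from lborel_pair.Fubini_integral[OF this]
  have "(LINT \<xi>|lborel. LINT Y|lborel. f \<xi> Y) = (LINT Y|lborel. LINT \<xi>|lborel. f \<xi> Y)" ..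
  moreover have "(LINT Y|lborel. f \<xi> Y) = mode [] v X t \<tau> \<xi>" for \<xi>
  proof -
    have "f \<xi> Y = (of_real (exp (- covq \<tau> \<xi>)) * exp (\<i> * of_real (freq \<tau> \<xi> \<bullet> X))) * (exp (- (\<i> * of_real (\<xi> \<bullet> Y))) * of_real (v (Y, r)))" for Y
    proof -
      have "exp (\<i> * of_real (\<xi> \<bullet> (flow \<tau> *v X - Y)) - of_real ((cov \<tau> *v \<xi>) \<bullet> \<xi>))
        = of_real (exp (- covq \<tau> \<xi>)) * exp (\<i> * of_real (freq \<tau> \<xi> \<bullet> X)) * exp (- (\<i> * of_real (\<xi> \<bullet> Y)))"
        unfolding exp_of_real[symmetric] mult_exp_exp
        by (simp add: freq_inner covq_def inner_diff_right algebra_simps)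
      then show ?thesis by (simp add: f_def mult.assoc)
    qed
    then show ?thesis by (simp only: integral_mult_right_zero) (simp add: mode_def partial_FT_def r_def)
  qed
  moreover have "(LINT \<xi>|lborel. f \<xi> Y) = of_real ((2 * pi) ^ CARD('n) * (kol_kernel Q B X Y \<tau> * v (Y, r)))" for Y
  proof -
    have "(LINT \<xi>|lborel. f \<xi> Y) = of_real ((2 * pi) ^ CARD('n) * gauss_density (cov \<tau>) (flow \<tau> *v X - Y)) * of_real (v (Y, r))"
      unfolding f_def integral_mult_left_zero fourier_gauss_density(2)[OF transpose_cov pos_def_cov[OF \<tau>]] ..
    also have "gauss_density (cov \<tau>) (flow \<tau> *v X - Y) = kol_kernel Q B X Y \<tau>"
      using gauss_density_even[of "cov \<tau>" "flow \<tau> *v X - Y"] by (simp add: kol_kernel_eq[OF \<tau>])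
    finally show ?thesis by (simp only: of_real_mult mult.assoc)
  qed
  ultimately have "(LINT \<xi>|lborel. mode [] v X t \<tau> \<xi>) = (LINT Y|lborel. complex_of_real ((2 * pi) ^ CARD('n) * (kol_kernel Q B X Y \<tau> * v (Y, r))))"
    by simp
  also have "\<dots> = of_real ((2 * pi) ^ CARD('n) * evol_semigroup Q B \<tau> v (X, t))"
    unfolding integral_complex_of_real integral_mult_right_zero by (simp add: evol_semigroup_def r_def)
  finally show ?thesis .
qed

lemma extension_eq_semigroup:
  assumes "0 < z"
  shows "(LBINT \<tau>:{0<..}. LINT Y|lborel. poisson_kernel (1 - 2 * s) Q B z X Y \<tau> * v (Y, t - \<tau>))
     = (LBINT \<tau>:{0<..}. ext_const s * weight (2 * s) (1 + s) \<tau> z * evol_semigroup Q B \<tau> v (X, t))"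
proof (rule set_lebesgue_integral_cong)
  show "\<forall>\<tau>. \<tau> \<in> {0<..} \<longrightarrow> (LINT Y|lborel. poisson_kernel (1 - 2 * s) Q B z X Y \<tau> * v (Y, t - \<tau>))
     = ext_const s * weight (2 * s) (1 + s) \<tau> z * evol_semigroup Q B \<tau> v (X, t)"
    using assms by (simp add: poisson_kernel_eq evol_semigroup_def mult.assoc)
qed simp

text \<open>The integral of the packet over frequency and time, taken in frequency first. The
  constant \<open>c\<close> is divided by \<open>(2 * pi) ^ CARD('n)\<close> to undo the factor in
  \<open>semigroup_eq_Fourier\<close>.\<close>

lemma semigroup_eq_wave:
  assumes v: "v \<in> schwartz" and z: "0 < z" and \<beta>: "0 \<le> \<beta>"
  shows "(LBINT \<tau>:{0<..}. c * weight \<alpha> \<beta> \<tau> z * evol_semigroup Q B \<tau> v (X, t))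
     = Re (of_real (c / (2 * pi) ^ CARD('n)) * wave \<alpha> \<beta> [] v ((X, t), z))"
proof -
  let ?Z = "((X, t), z)"
  have "integrable lborel (packet \<alpha> \<beta> [] v ?Z)" by (rule packet_integrable) (use assms in auto)
  then have int: "integrable (lborel \<Otimes>\<^sub>M lborel) (packet \<alpha> \<beta> [] v ?Z)" by (simp add: lborel_prod)
  have inner: "(LINT \<xi>|lborel. packet \<alpha> \<beta> [] v ?Z (\<tau>, \<xi>))
     = of_real ((2 * pi) ^ CARD('n) * (indicator {0<..} \<tau> * (weight \<alpha> \<beta> \<tau> z * evol_semigroup Q B \<tau> v (X, t))))" for \<tau>
  proof (cases "0 < \<tau>")
    case True
    then show ?thesis
      by (simp add: packet_def semigroup_eq_Fourier[OF v True] mult_ac)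
  qed (simp add: packet_def)
  have "wave \<alpha> \<beta> [] v ?Z = (LINT \<tau>|lborel. LINT \<xi>|lborel. packet \<alpha> \<beta> [] v ?Z (\<tau>, \<xi>))"
    unfolding wave_def using lborel_pair.integral_fst'[OF int] by (simp add: lborel_prod)
  also have "\<dots> = of_real ((2 * pi) ^ CARD('n) * (LINT \<tau>|lborel. indicator {0<..} \<tau> * (weight \<alpha> \<beta> \<tau> z * evol_semigroup Q B \<tau> v (X, t))))"
    unfolding inner integral_complex_of_real integral_mult_right_zero ..
  finally have "Re (of_real (c / (2 * pi) ^ CARD('n)) * wave \<alpha> \<beta> [] v ?Z)
     = c * (LINT \<tau>|lborel. indicator {0<..} \<tau> * (weight \<alpha> \<beta> \<tau> z * evol_semigroup Q B \<tau> v (X, t)))"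
    by (simp only: of_real_mult[symmetric] Re_complex_of_real) simp
  then show ?thesis by (simp add: set_lebesgue_integral_def mult_ac)
qed

lemma wave_space_deriv:
  assumes v: "v \<in> schwartz" and bs: "set bs \<subseteq> Basis" and \<beta>: "0 \<le> \<beta>" and z: "0 < z" and b: "b \<in> Basis"
  shows "frechet_derivative (\<lambda>X. Re (c * wave \<alpha> \<beta> bs v ((X, t), z))) (at X) b = Re (c * wave \<alpha> \<beta> (b # bs) v ((X, t), z))"
proof -
  have "((\<lambda>X. ((X, t), z)) has_derivative (\<lambda>x. ((x, 0), 0))) (at X)"
    by (auto intro!: derivative_eq_intros)
  from has_derivative_compose[OF this Re_wave_has_derivative[OF v bs \<beta>, of "((X, t), z)" c \<alpha>]] z
  have "((\<lambda>X. Re (c * wave \<alpha> \<beta> bs v ((X, t), z))) has_derivative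
     (\<lambda>x. Re (c * (\<Sum>b\<in>Basis. of_real (x \<bullet> b) * wave \<alpha> \<beta> (b # bs) v ((X, t), z))))) (at X)"
    by simp
  from fun_cong[OF frechet_derivative_at[OF this, symmetric], of b] show ?thesis
    by (simp only: sum_Basis_inner_delta[OF b])
qed

lemma wave_time_deriv:
  assumes v: "v \<in> schwartz" and bs: "set bs \<subseteq> Basis" and \<beta>: "0 \<le> \<beta>" and z: "0 < z"
  shows "deriv (\<lambda>t. Re (c * wave \<alpha> \<beta> bs v ((X, t), z))) t = Re (c * wave \<alpha> \<beta> bs (iter_deriv [(0, 1)] v) ((X, t), z))"
proof -
  let ?w = "wave \<alpha> \<beta> bs (iter_deriv [(0, 1)] v) ((X, t), z)"
  have "((\<lambda>t. ((X, t), z)) has_derivative (\<lambda>r. ((0, r), 0))) (at t)"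
    by (auto intro!: derivative_eq_intros)
  from has_derivative_compose[OF this Re_wave_has_derivative[OF v bs \<beta>, of "((X, t), z)" c \<alpha>]] z
  have "((\<lambda>t. Re (c * wave \<alpha> \<beta> bs v ((X, t), z))) has_derivative (\<lambda>r. Re (c * (of_real r * ?w)))) (at t)"
    by (simp del: iter_deriv.simps)
  moreover have "(\<lambda>r. Re (c * (of_real r * ?w))) = (*) (Re (c * ?w))"
    by (simp add: fun_eq_iff algebra_simps del: iter_deriv.simps)
  ultimately have "((\<lambda>t. Re (c * wave \<alpha> \<beta> bs v ((X, t), z))) has_real_derivative Re (c * ?w)) (at t)"
    by (simp only: has_field_derivative_def)
  then show ?thesis by (rule DERIV_imp_deriv)
qed

lemma wave_ext_deriv:
  assumes v: "v \<in> schwartz" and bs: "set bs \<subseteq> Basis" and \<beta>: "0 \<le> \<beta>" and z: "0 < z"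
  shows "((\<lambda>z. Re (c * wave \<alpha> \<beta> bs v (x, z))) has_real_derivative
     Re (c * (of_real \<alpha> * wave (\<alpha> - 1) \<beta> bs v (x, z) - wave (\<alpha> + 1) (\<beta> + 1) bs v (x, z) / 2))) (at z)"
proof -
  let ?w = "of_real \<alpha> * wave (\<alpha> - 1) \<beta> bs v (x, z) - wave (\<alpha> + 1) (\<beta> + 1) bs v (x, z) / 2"
  have "((\<lambda>z. (x, z)) has_derivative (\<lambda>r. (0, r))) (at z)"
    by (auto intro!: derivative_eq_intros)
  from has_derivative_compose[OF this Re_wave_has_derivative[OF v bs \<beta>, of "(x, z)" c \<alpha>]] z
  have "((\<lambda>z. Re (c * wave \<alpha> \<beta> bs v (x, z))) has_derivative (\<lambda>r. Re (c * (of_real r * ?w)))) (at z)"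
    by (simp add: zero_prod_def)
  moreover have "(\<lambda>r. Re (c * (of_real r * ?w))) = (*) (Re (c * ?w))"
  proof
    fix r
    have "c * (of_real r * ?w) = of_real r * (c * ?w)" by (simp only: mult_ac)
    then show "Re (c * (of_real r * ?w)) = Re (c * ?w) * r" by (simp add: algebra_simps)
  qed
  ultimately show ?thesis by (simp only: has_field_derivative_def)
qed

lemma wave_mult:
  assumes "0 < z"
  shows "of_real z * wave \<alpha> \<beta> bs v (x, z) = wave (\<alpha> + 1) \<beta> bs v (x, z)"
proof -
  have "of_real z * packet \<alpha> \<beta> bs v (x, z) p = packet (\<alpha> + 1) \<beta> bs v (x, z) p" for p
    using weight_mult[OF assms, of \<alpha> \<beta> "fst p"] by (simp add: packet_def flip: of_real_mult mult.assoc)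
  then show ?thesis unfolding wave_def integral_mult_right_zero[symmetric] by simp
qed

text \<open>The Bessel operator in \<open>z\<close> acts on the wave as the derivative of its weight
  in \<open>\<tau>\<close>, which turns the extension operator into the left side of
  \<open>wave_heat_equation\<close>.\<close>

lemma extension_equation:
  assumes v: "v \<in> schwartz" and z: "0 < z" and s: "0 < s"
    and U: "\<And>X t z. 0 < z \<Longrightarrow> U ((X, t), z) = Re (of_real c * wave (2 * s) (1 + s) [] v ((X, t), z))"
  shows "ext_op (1 - 2 * s) Q B U ((X, t), z) = 0"
proof -
  let ?Z = "((X, t), z)"
  let ?c = "complex_of_real c"
  define \<alpha> where "\<alpha> = 2 * s"
  define \<beta> where "\<beta> = 1 + s"
  have \<beta>: "0 \<le> \<beta>" using s by (simp add: \<beta>_def)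
  have ax: "axis i (1::real) \<in> Basis" for i :: 'n by (simp add: axis_in_Basis_iff)
  have nil: "set [] \<subseteq> (Basis :: (real^'n) set)" and sing: "set [axis i 1] \<subseteq> (Basis :: (real^'n) set)" for i
    by (simp_all add: ax)
  note U = U[folded \<alpha>_def \<beta>_def]
  have grad: "iter_deriv [axis i 1] (\<lambda>Y. U ((Y, t), z)) = (\<lambda>Y. Re (?c * wave \<alpha> \<beta> [axis i 1] v ((Y, t), z)))" for i
    by (simp only: iter_deriv.simps U[OF z] wave_space_deriv[OF v nil \<beta> z ax])
  have hess: "iter_deriv [axis j 1, axis i 1] (\<lambda>Y. U ((Y, t), z)) X = Re (?c * wave \<alpha> \<beta> [axis j 1, axis i 1] v ?Z)" for i j
  proof -
    have "iter_deriv [axis j 1, axis i 1] (\<lambda>Y. U ((Y, t), z)) X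
        = frechet_derivative (iter_deriv [axis i 1] (\<lambda>Y. U ((Y, t), z))) (at X) (axis j 1)" by simp
    then show ?thesis unfolding grad by (simp only: wave_space_deriv[OF v sing \<beta> z ax])
  qed
  have A: "A_op Q B (\<lambda>Y. U ((Y, t), z)) X = Re (?c * ((\<Sum>i\<in>UNIV. \<Sum>j\<in>UNIV. of_real (Q $ i $ j) * wave \<alpha> \<beta> [axis j 1, axis i 1] v ?Z)
     + (\<Sum>i\<in>UNIV. of_real ((B *v X) $ i) * wave \<alpha> \<beta> [axis i 1] v ?Z)))"
    unfolding A_op_def trace_def matrix_matrix_mult_def inner_vec_def grad_def hessian_def vec_lambda_beta hess grad
    by (simp add: distrib_left sum_distrib_left mult_ac)
  define D where "D z = Re (?c * (of_real \<alpha> * wave (\<alpha> - 1) \<beta> [] v ((X, t), z) - wave (\<alpha> + 1) (\<beta> + 1) [] v ((X, t), z) / 2))" for z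
  have d1: "deriv (\<lambda>\<zeta>. U ((X, t), \<zeta>)) z = D z" if "0 < z" for z
  proof -
    have "deriv (\<lambda>\<zeta>. U ((X, t), \<zeta>)) z = deriv (\<lambda>\<zeta>. Re (?c * wave \<alpha> \<beta> [] v ((X, t), \<zeta>))) z"
      using eventually_nhds_in_open[of "{0<..}" z] that by (intro deriv_cong_ev refl) (auto elim!: eventually_mono simp: U)
    also have "\<dots> = D z" unfolding D_def by (intro DERIV_imp_deriv wave_ext_deriv v \<beta> that) simp
    finally show ?thesis .
  qed
  have d2: "deriv (deriv (\<lambda>\<zeta>. U ((X, t), \<zeta>))) z = Re (?c * (of_real \<alpha> * (of_real (\<alpha> - 1) * wave (\<alpha> - 2) \<beta> [] v ?Z - wave \<alpha> (\<beta> + 1) [] v ?Z / 2)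
      - (of_real (\<alpha> + 1) * wave \<alpha> (\<beta> + 1) [] v ?Z - wave (\<alpha> + 2) (\<beta> + 2) [] v ?Z / 2) / 2))"
  proof -
    have "deriv (deriv (\<lambda>\<zeta>. U ((X, t), \<zeta>))) z = deriv D z"
      using eventually_nhds_in_open[of "{0<..}" z] z by (intro deriv_cong_ev refl) (auto elim!: eventually_mono simp: d1)
    also have "D = (\<lambda>z. Re ((?c * of_real \<alpha>) * wave (\<alpha> - 1) \<beta> [] v ((X, t), z)) - Re ((?c / 2) * wave (\<alpha> + 1) (\<beta> + 1) [] v ((X, t), z)))"
      by (simp add: fun_eq_iff D_def algebra_simps)
    also have "deriv \<dots> z = Re ((?c * of_real \<alpha>) * (of_real (\<alpha> - 1) * wave (\<alpha> - 1 - 1) \<beta> [] v ?Z - wave (\<alpha> - 1 + 1) (\<beta> + 1) [] v ?Z / 2))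
        - Re ((?c / 2) * (of_real (\<alpha> + 1) * wave (\<alpha> + 1 - 1) (\<beta> + 1) [] v ?Z - wave (\<alpha> + 1 + 1) (\<beta> + 1 + 1) [] v ?Z / 2))"
      using \<beta> by (intro DERIV_imp_deriv DERIV_diff wave_ext_deriv v z) auto
    finally show ?thesis by (simp add: field_simps)
  qed
  \<comment> \<open>A factor \<open>z\<close> is split off the waves in the first derivative, to be
    cancelled by the \<open>1 / z\<close> of the Bessel operator.\<close>
  have m1: "wave (\<alpha> - 1) \<beta> [] v ?Z = of_real z * wave (\<alpha> - 2) \<beta> [] v ?Z"
    using wave_mult[OF z, of "\<alpha> - 2" \<beta> "[]" v] by simp
  have m2: "wave (\<alpha> + 1) (\<beta> + 1) [] v ?Z = of_real z * wave \<alpha> (\<beta> + 1) [] v ?Z"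
    using wave_mult[OF z, of \<alpha> "\<beta> + 1" "[]" v] by simp
  have drift: "(1 - 2 * s) / z * D z = Re (?c * (of_real (1 - 2 * s) * (of_real \<alpha> * wave (\<alpha> - 2) \<beta> [] v ?Z - wave \<alpha> (\<beta> + 1) [] v ?Z / 2)))"
    unfolding D_def m1 m2 using z by (simp add: field_simps)
  \<comment> \<open>The wave with exponent \<open>\<alpha> - 2\<close> drops out because
    \<open>\<alpha> * (\<alpha> - 1) + (1 - 2 * s) * \<alpha> = 0\<close> at
    \<open>\<alpha> = 2 * s\<close>. The coefficients of the wave with exponents
    \<open>\<alpha>\<close> and \<open>\<beta> + 1\<close> add up to \<open>- \<alpha> / 2 -
    (\<alpha> + 1) / 2 - (1 - 2 * s) / 2 = - (1 + s)\<close>, which is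
    \<open>- \<beta>\<close>.\<close>
  have bessel: "bessel_op (1 - 2 * s) (\<lambda>\<zeta>. U ((X, t), \<zeta>)) z
     = Re (?c * (wave (\<alpha> + 2) (\<beta> + 2) [] v ?Z / 4 - of_real \<beta> * wave \<alpha> (\<beta> + 1) [] v ?Z))"
    unfolding bessel_op_def d1[OF z] d2 drift by (simp add: \<alpha>_def \<beta>_def field_simps)
  have time: "deriv (\<lambda>r. U ((X, r), z)) t = Re (?c * wave \<alpha> \<beta> [] (iter_deriv [(0, 1)] v) ?Z)"
    unfolding U[OF z] by (rule wave_time_deriv[OF v _ \<beta> z]) simp
  have "A_op Q B (\<lambda>Y. U ((Y, t), z)) X + bessel_op (1 - 2 * s) (\<lambda>\<zeta>. U ((X, t), \<zeta>)) z - deriv (\<lambda>r. U ((X, r), z)) t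
    = Re (?c * ((\<Sum>i\<in>UNIV. \<Sum>j\<in>UNIV. of_real (Q $ i $ j) * wave \<alpha> \<beta> [axis j 1, axis i 1] v ?Z)
     + (\<Sum>i\<in>UNIV. of_real ((B *v fst (fst ?Z)) $ i) * wave \<alpha> \<beta> [axis i 1] v ?Z)
     + (wave (\<alpha> + 2) (\<beta> + 2) [] v ?Z / 4 - of_real \<beta> * wave \<alpha> (\<beta> + 1) [] v ?Z)
     - wave \<alpha> \<beta> [] (iter_deriv [(0, 1)] v) ?Z))"
    unfolding A bessel time fst_conv by (simp only: distrib_left right_diff_distrib plus_complex.simps minus_complex.simps)
  also have "\<dots> = 0" by (subst wave_heat_equation[OF v _ \<beta>]) (use z in simp_all)
  finally show ?thesis by (simp add: ext_op_def)
qed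

end

section \<open>Small-time asymptotics of the semigroup\<close>

lemma schwartz_dir_deriv:
  assumes v: "v \<in> schwartz"
  shows "((\<lambda>s. v (p + s *\<^sub>R h)) has_real_derivative (\<Sum>b\<in>Basis. (h \<bullet> b) * iter_deriv [b] v (p + s *\<^sub>R h))) (at s)"
proof -
  have "((\<lambda>s. p + s *\<^sub>R h) has_derivative (\<lambda>s. s *\<^sub>R h)) (at s)"
    by (auto intro!: derivative_eq_intros)
  from has_derivative_compose[OF this schwartz_has_derivative[OF v]]
  have "((\<lambda>s. v (p + s *\<^sub>R h)) has_derivative
      (\<lambda>r. \<Sum>b\<in>Basis. ((r *\<^sub>R h) \<bullet> b) * iter_deriv [b] v (p + s *\<^sub>R h))) (at s)" .
  moreover have "(\<lambda>r. \<Sum>b\<in>Basis. ((r *\<^sub>R h) \<bullet> b) * iter_deriv [b] v (p + s *\<^sub>R h))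
      = (*) (\<Sum>b\<in>Basis. (h \<bullet> b) * iter_deriv [b] v (p + s *\<^sub>R h))"
    by (rule ext) (simp add: sum_distrib_left mult_ac del: iter_deriv.simps)
  ultimately show ?thesis by (simp only: has_field_derivative_def)
qed

lemma jap_mono: "norm x \<le> norm y \<Longrightarrow> jap x \<le> jap y"
  by (simp add: power_mono)

lemma recip_le_divide: "0 < x \<Longrightarrow> 0 < y \<Longrightarrow> y \<le> c * x \<Longrightarrow> 1 / x \<le> c / (y::real)"
  by (simp add: field_simps)

lemma inverse_jap_shift_le:
  fixes p k h :: "'a::real_normed_vector"
  assumes "norm k \<le> norm h"
  shows "1 / jap (p + k) ^ M \<le> 2 ^ M * jap h ^ M / jap p ^ M"
proof -
  have "jap p \<le> 2 * jap (p + k) * jap (- k)" using jap_add_le[of "p + k" "- k"] by simp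
  also have "\<dots> \<le> 2 * jap (p + k) * jap h" using jap_mono[OF assms] by (intro mult_left_mono) auto
  finally have "jap p ^ M \<le> (2 * jap (p + k) * jap h) ^ M" by (intro power_mono less_imp_le[OF jap_pos])
  also have "\<dots> = 2 ^ M * jap h ^ M * jap (p + k) ^ M" by (simp only: power_mult_distrib mult_ac)
  finally show ?thesis by (intro recip_le_divide zero_less_power jap_pos)
qed

lemma schwartz_deriv_bound:
  fixes v :: "'a::euclidean_space \<Rightarrow> real"
  assumes v: "v \<in> schwartz"
  obtains C where "C \<ge> 0" "\<And>x h. \<bar>\<Sum>b\<in>Basis. (h \<bullet> b) * iter_deriv [b] v x\<bar> \<le> norm h * (C / jap x ^ M)"
proof -
  have "\<forall>b\<in>Basis. \<exists>C>0. \<forall>x. \<bar>iter_deriv [b] v x\<bar> \<le> C / jap x ^ M"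
    by (intro ballI schwartz_bound schwartz_iter_deriv v) auto
  then obtain C where C: "\<And>b. b \<in> Basis \<Longrightarrow> C b > 0"
    "\<And>b x. b \<in> Basis \<Longrightarrow> \<bar>iter_deriv [b] v x\<bar> \<le> C b / jap x ^ M" by metis
  have "\<bar>\<Sum>b\<in>Basis. (h \<bullet> b) * iter_deriv [b] v x\<bar> \<le> norm h * (sum C Basis / jap x ^ M)" for x h
  proof -
    have "\<bar>\<Sum>b\<in>Basis. (h \<bullet> b) * iter_deriv [b] v x\<bar> \<le> (\<Sum>b\<in>Basis. norm h * (C b / jap x ^ M))"
    proof (rule order_trans[OF sum_abs], rule sum_mono)
      fix b :: 'a assume b: "b \<in> Basis"
      show "\<bar>(h \<bullet> b) * iter_deriv [b] v x\<bar> \<le> norm h * (C b / jap x ^ M)"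
        unfolding abs_mult by (intro mult_mono C b Basis_le_norm) auto
    qed
    then show ?thesis by (simp only: sum_distrib_left sum_divide_distrib)
  qed
  moreover have "sum C Basis \<ge> 0" using C(1) by (intro sum_nonneg less_imp_le)
  ultimately show ?thesis using that by blast
qed

text \<open>The mean value theorem along the segment, with the weight moved back to
  \<open>p\<close>. The increment \<open>k\<close> is separate from \<open>h\<close> so that one
  bound serves two points at different places in the second difference.\<close>

lemma schwartz_first_difference:
  fixes v :: "'a::euclidean_space \<Rightarrow> real"
  assumes v: "v \<in> schwartz"
  obtains K where "K \<ge> 0" "\<And>p h k. norm k \<le> norm (h :: 'a) \<Longrightarrow> \<bar>v (p + k) - v p\<bar> \<le> K * norm h * jap h ^ M / jap p ^ M"
proof -
  obtain C where C: "C \<ge> 0" "\<And>x h. \<bar>\<Sum>b\<in>Basis. (h \<bullet> b) * iter_deriv [b] v x\<bar> \<le> norm h * (C / jap x ^ M)"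
    using schwartz_deriv_bound[OF v] by metis
  have "\<bar>v (p + k) - v p\<bar> \<le> C * 2 ^ M * norm h * jap h ^ M / jap p ^ M" if kh: "norm k \<le> norm h" for p h k :: 'a
  proof -
    obtain z where z: "0 < z" "z < 1" "v (p + 1 *\<^sub>R k) - v (p + 0 *\<^sub>R k) = (1 - 0) * (\<Sum>b\<in>Basis. (k \<bullet> b) * iter_deriv [b] v (p + z *\<^sub>R k))"
      using MVT2[of 0 1 "\<lambda>s. v (p + s *\<^sub>R k)" "\<lambda>s. \<Sum>b\<in>Basis. (k \<bullet> b) * iter_deriv [b] v (p + s *\<^sub>R k)"]
        schwartz_dir_deriv[OF v, of p k] by auto
    have zk: "norm (z *\<^sub>R k) \<le> norm h"
      using z kh mult_right_mono[of z 1 "norm k"] by simp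
    have "\<bar>v (p + k) - v p\<bar> \<le> norm k * (C / jap (p + z *\<^sub>R k) ^ M)"
      using z(3) C(2)[of k "p + z *\<^sub>R k"] by (simp only: scaleR_one scaleR_zero_left add_0_right diff_zero mult_1_left)
    also have "\<dots> \<le> norm h * (C * (1 / jap (p + z *\<^sub>R k) ^ M))"
      using mult_right_mono[OF kh, of "C / jap (p + z *\<^sub>R k) ^ M"] C(1) by simp
    also have "\<dots> \<le> norm h * (C * (2 ^ M * jap h ^ M / jap p ^ M))"
      using C(1) by (intro mult_left_mono inverse_jap_shift_le zk) auto
    finally show ?thesis by (simp add: mult_ac)
  qed
  moreover have "C * 2 ^ M \<ge> 0" using C by simp
  ultimately show ?thesis using that by blast
qed

text \<open>The mean value theorem for the symmetric sum \<open>v (p + s h) + v (p - s h)\<close>.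
  Its derivative compares first derivatives at two points within \<open>norm h\<close> of
  \<open>p\<close>, and \<open>schwartz_first_difference\<close> for these derivatives supplies the
  second factor \<open>norm h\<close>.\<close>

lemma schwartz_second_difference:
  fixes v :: "'a::euclidean_space \<Rightarrow> real"
  assumes v: "v \<in> schwartz"
  obtains K where "K \<ge> 0" "\<And>p h. \<bar>v (p + h) + v (p - h) - 2 * v p\<bar> \<le> K * (norm h)\<^sup>2 * jap h ^ M / jap p ^ M"
proof -
  have "\<forall>b\<in>Basis. \<exists>K\<ge>0. \<forall>p h k. norm k \<le> norm (h :: 'a) \<longrightarrow> \<bar>iter_deriv [b] v (p + k) - iter_deriv [b] v p\<bar> \<le> K * norm h * jap h ^ M / jap p ^ M"
  proof
    fix b :: 'a assume "b \<in> Basis"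
    then have "iter_deriv [b] v \<in> schwartz" by (intro schwartz_iter_deriv v) auto
    then show "\<exists>K\<ge>0. \<forall>p h k. norm k \<le> norm (h :: 'a) \<longrightarrow> \<bar>iter_deriv [b] v (p + k) - iter_deriv [b] v p\<bar> \<le> K * norm h * jap h ^ M / jap p ^ M"
      using schwartz_first_difference by metis
  qed
  from bchoice[OF this] obtain K where "\<forall>b\<in>Basis. K b \<ge> 0 \<and>
      (\<forall>p h k. norm k \<le> norm (h :: 'a) \<longrightarrow> \<bar>iter_deriv [b] v (p + k) - iter_deriv [b] v p\<bar> \<le> K b * norm h * jap h ^ M / jap p ^ M)"
    by blast
  then have K: "\<And>b. b \<in> Basis \<Longrightarrow> K b \<ge> 0"
    "\<And>b p h k. b \<in> Basis \<Longrightarrow> norm k \<le> norm (h :: 'a) \<Longrightarrow>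
      \<bar>iter_deriv [b] v (p + k) - iter_deriv [b] v p\<bar> \<le> K b * norm h * jap h ^ M / jap p ^ M" by blast+

  have "\<bar>v (p + h) + v (p - h) - 2 * v p\<bar> \<le> (2 * sum K Basis) * (norm h)\<^sup>2 * jap h ^ M / jap p ^ M" for p h
  proof -
    let ?d = "\<lambda>b. iter_deriv [b] v"
    let ?f = "\<lambda>s. v (p + s *\<^sub>R h) + v (p + s *\<^sub>R (- h))"
    let ?f' = "\<lambda>s. (\<Sum>b\<in>Basis. (h \<bullet> b) * ?d b (p + s *\<^sub>R h)) + (\<Sum>b\<in>Basis. ((- h) \<bullet> b) * ?d b (p + s *\<^sub>R (- h)))"
    have "(?f has_real_derivative ?f' s) (at s)" for s
      by (intro DERIV_add schwartz_dir_deriv v)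
    then obtain z where z: "0 < z" "z < 1" "?f 1 - ?f 0 = (1 - 0) * ?f' z"
      using MVT2[of 0 1 ?f ?f'] by auto
    have zh: "norm (z *\<^sub>R h) \<le> norm h" "norm (z *\<^sub>R (- h)) \<le> norm h"
      using z mult_right_mono[of z 1 "norm h"] by simp_all
    have f': "?f' z = (\<Sum>b\<in>Basis. (h \<bullet> b) * (?d b (p + z *\<^sub>R h) - ?d b (p + z *\<^sub>R (- h))))"
      by (simp add: sum.distrib[symmetric] right_diff_distrib inner_minus_left del: iter_deriv.simps flip: sum_subtractf)
    have "\<bar>?f' z\<bar> \<le> (\<Sum>b\<in>Basis. norm h * (2 * (K b * norm h * jap h ^ M / jap p ^ M)))"
      unfolding f'
    proof (rule order_trans[OF sum_abs], rule sum_mono)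
      fix b :: 'a assume b: "b \<in> Basis"
      have "\<bar>?d b (p + z *\<^sub>R h) - ?d b (p + z *\<^sub>R (- h))\<bar> \<le> 2 * (K b * norm h * jap h ^ M / jap p ^ M)"
        using K(2)[OF b zh(1), of p] K(2)[OF b zh(2), of p] by linarith
      then show "\<bar>(h \<bullet> b) * (?d b (p + z *\<^sub>R h) - ?d b (p + z *\<^sub>R (- h)))\<bar> \<le> norm h * (2 * (K b * norm h * jap h ^ M / jap p ^ M))"
        unfolding abs_mult by (intro mult_mono Basis_le_norm b) auto
    qed
    also have "\<dots> = (2 * sum K Basis) * (norm h)\<^sup>2 * jap h ^ M / jap p ^ M"
      by (simp add: sum_distrib_left sum_distrib_right sum_divide_distrib power2_eq_square mult_ac)
    finally show ?thesis using z(3) by simp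
  qed
  moreover have "2 * sum K Basis \<ge> 0" using K(1) by (simp add: sum_nonneg)
  ultimately show ?thesis using that by blast
qed

lemma integrable_std_gauss_jap:
  "integrable lborel (\<lambda>y::'a::euclidean_space. std_gauss y * jap y ^ k)"
proof -
  obtain K where K: "K > 0" "\<And>x::real. 0 \<le> x \<Longrightarrow> (1 + x) ^ (k + DIM('a)) * exp (- (1 / 4 * x)) \<le> K"
    using exp_dominates_power[of "1 / 4" "k + DIM('a)"] by auto
  let ?c = "(4 * pi) powr (- real DIM('a) / 2)"
  show ?thesis
  proof (rule Bochner_Integration.integrable_bound[OF integrable_mult_right[OF integrable_jap_power[OF order_refl], of "?c * K"]])
    show "AE y in lborel. norm (std_gauss y * jap y ^ k) \<le> norm (?c * K * (1 / jap (y::'a) ^ DIM('a)))"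
    proof (rule AE_I2)
      fix y :: 'a
      have "jap y ^ (k + DIM('a)) * exp (- (1 / 4 * (norm y)\<^sup>2)) \<le> K" by (intro K) simp
      then have "exp (- (norm y)\<^sup>2 / 4) * jap y ^ k \<le> K * (1 / jap y ^ DIM('a))"
        by (simp add: power_add pos_le_divide_eq mult_ac)
      then have "?c * (exp (- (norm y)\<^sup>2 / 4) * jap y ^ k) \<le> ?c * (K * (1 / jap y ^ DIM('a)))"
        by (rule mult_left_mono) simp
      then show "norm (std_gauss y * jap y ^ k) \<le> norm (?c * K * (1 / jap y ^ DIM('a)))"
        using K(1) by (simp add: mult_ac)
    qed
  qed measurable
qed

context kolmogorov
begin

lemma semigroup_eq_std_gauss:
  assumes v: "v \<in> schwartz" and M: "cov \<tau> = M ** transpose M" "det M \<noteq> 0" and \<tau>: "0 < \<tau>"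
  shows "evol_semigroup Q B \<tau> v (X, t) = (LINT y|lborel. std_gauss y * v (flow \<tau> *v X + M *v y, t - \<tau>))"
proof -
  note [measurable] = schwartz_measurable[OF v]
  let ?f = "\<lambda>Y. gauss_density (cov \<tau>) (Y - flow \<tau> *v X) * v (Y, t - \<tau>)"
  have "evol_semigroup Q B \<tau> v (X, t) = (LINT Y|lborel. ?f Y)"
    by (simp add: evol_semigroup_def kol_kernel_eq[OF \<tau>])
  also have "\<dots> = (LINT Y|distr lborel borel ((+) (flow \<tau> *v X)). ?f Y)" by (simp add: lborel_distr_plus)
  also have "\<dots> = (LINT w|lborel. gauss_density (cov \<tau>) w * v (flow \<tau> *v X + w, t - \<tau>))"
    by (subst integral_distr) auto
  also have "\<dots> = (LINT y|lborel. std_gauss y * v (flow \<tau> *v X + M *v y, t - \<tau>))"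
    by (rule integral_gauss_density[OF M, of "\<lambda>w. v (flow \<tau> *v X + w, t - \<tau>)"]) measurable
  finally show ?thesis .
qed

lemma integrable_std_gauss_schwartz:
  fixes M :: "real^'n^'n"
  assumes v: "v \<in> schwartz"
  shows "integrable lborel (\<lambda>y. std_gauss y * v (Y + M *v y, r))"
proof -
  note [measurable] = schwartz_measurable[OF v]
  obtain C where C: "C > 0" "\<And>x. \<bar>v x\<bar> \<le> C / jap x ^ 0" using schwartz_bound[OF v] by blast
  have "integrable lborel (\<lambda>y::real^'n. C * std_gauss y)" by (intro integrable_mult_right integrable_std_gauss)
  then show ?thesis
    by (rule Bochner_Integration.integrable_bound) (use C in \<open>auto simp: abs_mult intro!: mult_mono\<close>)
qed

text \<open>The displacement \<open>M *v y\<close> has the size of the square root of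
  \<open>\<tau>\<close>. The mean value theorem gives
  \<open>covq \<tau> w \<le> \<kappa> * \<tau> * (norm w)\<^sup>2\<close>, a bound for
  \<open>transpose M\<close>; Cauchy-Schwarz with \<open>w = M *v y\<close> transfers it to
  \<open>M\<close>.\<close>

lemma small_time_covariance:
  obtains \<kappa> where "\<kappa> \<ge> 0" "\<And>\<tau> (M::real^'n^'n) (y::real^'n). 0 < \<tau> \<Longrightarrow> \<tau> \<le> 1 \<Longrightarrow> cov \<tau> = M ** transpose M \<Longrightarrow> (norm (M *v y))\<^sup>2 \<le> \<kappa> * \<tau> * (norm y)\<^sup>2"
proof -
  obtain L where L: "L \<ge> 1" "\<And>\<tau> x. \<bar>\<tau>\<bar> \<le> 1 \<Longrightarrow> norm (freq \<tau> x) \<le> L * norm x"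
    using flow_bounded by metis
  obtain K where K: "K > 0" "\<And>(A::real^'n^'n) (x::real^'n). norm (A *v x) \<le> norm A * norm x * K"
    using bounded_bilinear.pos_bounded[OF bounded_bilinear_matrix_vector_mult] by blast
  define \<kappa> where "\<kappa> = norm Q * K * L\<^sup>2"
  have \<kappa>: "\<kappa> \<ge> 0" using K by (simp add: \<kappa>_def)
  have cq: "covq \<tau> x \<le> \<kappa> * \<tau> * (norm x)\<^sup>2" if \<tau>: "0 < \<tau>" "\<tau> \<le> 1" for \<tau> x
  proof -
    obtain z where z: "0 < z" "z < \<tau>" "covq \<tau> x - covq 0 x = (\<tau> - 0) * ((Q *v freq z x) \<bullet> freq z x)"
      using MVT2[of 0 \<tau> "\<lambda>\<tau>. covq \<tau> x" "\<lambda>\<tau>. (Q *v freq \<tau> x) \<bullet> freq \<tau> x"] covq_deriv \<tau> by auto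
    have "(Q *v freq z x) \<bullet> freq z x \<le> norm (Q *v freq z x) * norm (freq z x)" by (rule norm_cauchy_schwarz)
    also have "\<dots> \<le> (norm Q * K) * (norm (freq z x))\<^sup>2"
      using mult_right_mono[OF K(2)[of Q "freq z x"], of "norm (freq z x)"] by (simp add: power2_eq_square mult_ac)
    also have "\<dots> \<le> (norm Q * K) * (L * norm x)\<^sup>2"
      using K z \<tau> by (intro mult_left_mono power_mono L) auto
    finally have "(Q *v freq z x) \<bullet> freq z x \<le> \<kappa> * (norm x)\<^sup>2" by (simp add: \<kappa>_def power_mult_distrib mult_ac)
    from mult_left_mono[OF this, of \<tau>] show ?thesis using z(3) \<tau> by (simp add: covq_def mult_ac)
  qed
  have "(norm (M *v y))\<^sup>2 \<le> \<kappa> * \<tau> * (norm y)\<^sup>2" if \<tau>: "0 < \<tau>" "\<tau> \<le> 1" and M: "cov \<tau> = M ** transpose M" for \<tau> and M :: "real^'n^'n" and y :: "real^'n"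
  proof (cases "M *v y = 0")
    case False
    define w where "w = M *v y"
    have "(norm (transpose M *v w))\<^sup>2 = covq \<tau> w"
      unfolding covq_def M power2_norm_eq_inner
      by (metis dot_lmul_matrix inner_commute matrix_vector_mul_assoc transpose_matrix_vector)
    also have "\<dots> \<le> \<kappa> * \<tau> * (norm w)\<^sup>2" by (rule cq[OF \<tau>])
    finally have 1: "(norm (transpose M *v w))\<^sup>2 \<le> \<kappa> * \<tau> * (norm w)\<^sup>2" .
    have "(norm w)\<^sup>2 = (transpose M *v w) \<bullet> y"
      unfolding power2_norm_eq_inner by (metis w_def dot_lmul_matrix transpose_matrix_vector)
    also have "\<dots> \<le> norm (transpose M *v w) * norm y" by (rule norm_cauchy_schwarz)
    finally have "((norm w)\<^sup>2)\<^sup>2 \<le> (norm (transpose M *v w) * norm y)\<^sup>2" by (intro power_mono) auto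
    also have "\<dots> \<le> \<kappa> * \<tau> * (norm w)\<^sup>2 * (norm y)\<^sup>2"
      unfolding power_mult_distrib by (intro mult_right_mono 1) simp
    finally have "(norm w)\<^sup>2 * (norm w)\<^sup>2 \<le> (\<kappa> * \<tau> * (norm y)\<^sup>2) * (norm w)\<^sup>2" by (simp add: power2_eq_square mult_ac)
    moreover have "(norm w)\<^sup>2 > 0" using False by (simp add: w_def)
    ultimately show ?thesis unfolding w_def by (rule mult_right_le_imp_le)
  qed (use \<kappa> \<tau> in auto)
  with \<kappa> show ?thesis by (rule that)
qed

text \<open>For \<open>\<tau>\<close> in the unit interval the inverse flow is bounded, so decay at
  the transported point is decay at \<open>(X, t)\<close>.\<close>

lemma jap_flow_le:
  obtains L where "L > 0" "\<And>\<tau> X t. 0 \<le> \<tau> \<Longrightarrow> \<tau> \<le> 1 \<Longrightarrow> jap (X, t) \<le> L * jap (flow \<tau> *v X, t - \<tau>)"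
proof -
  obtain L where L: "L \<ge> 1" "\<And>\<tau> x. \<bar>\<tau>\<bar> \<le> 1 \<Longrightarrow> norm (flow \<tau> *v x) \<le> L * norm x"
    using flow_bounded by metis
  have "jap (X, t) \<le> (3 + L\<^sup>2) * jap (flow \<tau> *v X, t - \<tau>)" if \<tau>: "0 \<le> \<tau>" "\<tau> \<le> 1" for \<tau> X t
  proof -
    have "X = flow (- \<tau>) *v (flow \<tau> *v X)"
      using flow_inverse[of "- \<tau>"] by (simp add: matrix_vector_mul_assoc)
    then have "norm X \<le> L * norm (flow \<tau> *v X)" using L(2)[of "- \<tau>" "flow \<tau> *v X"] \<tau> by simp
    then have "(norm X)\<^sup>2 \<le> L\<^sup>2 * (norm (flow \<tau> *v X))\<^sup>2" by (metis norm_ge_zero power_mono power_mult_distrib)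
    moreover have "t\<^sup>2 \<le> 2 * (t - \<tau>)\<^sup>2 + 2"
    proof -
      have "2 * (t - \<tau>)\<^sup>2 + 2 * \<tau>\<^sup>2 - t\<^sup>2 = (t - 2 * \<tau>)\<^sup>2" by (simp add: power2_eq_square algebra_simps)
      then have "t\<^sup>2 \<le> 2 * (t - \<tau>)\<^sup>2 + 2 * \<tau>\<^sup>2" using zero_le_power2[of "t - 2 * \<tau>"] by linarith
      moreover have "\<tau>\<^sup>2 \<le> 1" using \<tau> by (simp add: power_le_one)
      ultimately show ?thesis by linarith
    qed
    ultimately have "jap (X, t) \<le> 3 + L\<^sup>2 * (norm (flow \<tau> *v X))\<^sup>2 + 2 * (t - \<tau>)\<^sup>2" by (simp add: norm_Pair)
    also have "\<dots> \<le> (3 + L\<^sup>2) * jap (flow \<tau> *v X, t - \<tau>)"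
      using zero_le_power2[of L] mult_nonneg_nonneg[OF zero_le_power2[of L] zero_le_power2[of "t - \<tau>"]]
      by (simp add: norm_Pair algebra_simps)
    finally show ?thesis .
  qed
  moreover have "3 + L\<^sup>2 > 0" by (simp add: add_pos_nonneg)
  ultimately show ?thesis using that by blast
qed

text \<open>The mean value theorem along the characteristic through \<open>(X, t)\<close>. Its
  velocity grows linearly with the point, so the derivatives of \<open>v\<close> are taken with
  decay of order \<open>Suc M\<close> and one power is spent on the velocity.\<close>

lemma transport_difference_bound:
  assumes v: "v \<in> schwartz"
  obtains K where "K \<ge> 0" "\<And>\<tau> X t. 0 < \<tau> \<Longrightarrow> \<tau> \<le> 1 \<Longrightarrow> \<bar>v (flow \<tau> *v X, t - \<tau>) - v (X, t)\<bar> \<le> K * \<tau> / jap (X, t) ^ M"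
proof -
  obtain C where C: "C \<ge> 0" "\<And>x h. \<bar>\<Sum>b\<in>Basis. (h \<bullet> b) * iter_deriv [b] v x\<bar> \<le> norm h * (C / jap x ^ Suc M)"
    using schwartz_deriv_bound[OF v, of "Suc M"] by blast
  obtain L where L: "L > 0" "\<And>\<tau> X t. 0 \<le> \<tau> \<Longrightarrow> \<tau> \<le> 1 \<Longrightarrow> jap (X, t) \<le> L * jap (flow \<tau> *v X, t - \<tau>)"
    using jap_flow_le by metis
  obtain K where K: "K > 0" "\<And>(A::real^'n^'n) (x::real^'n). norm (A *v x) \<le> norm A * norm x * K"
    using bounded_bilinear.pos_bounded[OF bounded_bilinear_matrix_vector_mult] by blast
  define b where "b = 1 + norm B * K"
  have b: "b \<ge> 1" using K by (simp add: b_def)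
  have "\<bar>v (flow \<tau> *v X, t - \<tau>) - v (X, t)\<bar> \<le> (b * C * L ^ M) * \<tau> / jap (X, t) ^ M" if \<tau>: "0 < \<tau>" "\<tau> \<le> 1" for \<tau> X t
  proof -
    let ?c = "\<lambda>s. (flow s *v X, t - s)" and ?c' = "\<lambda>s. (B *v (flow s *v X), - 1 :: real)"
    have "((\<lambda>s. v (?c s)) has_real_derivative (\<Sum>e\<in>Basis. (?c' s \<bullet> e) * iter_deriv [e] v (?c s))) (at s)" for s
    proof -
      have "((\<lambda>s. flow s *v X) has_vector_derivative (B ** flow s) *v X) (at s)"
        by (rule bounded_linear.has_vector_derivative[OF bounded_bilinear.bounded_linear_left[OF bounded_bilinear_matrix_vector_mult] flow_deriv])
      then have "((\<lambda>s. flow s *v X) has_derivative (\<lambda>r. r *\<^sub>R (B *v (flow s *v X)))) (at s)"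
        by (simp add: has_vector_derivative_def matrix_vector_mul_assoc)
      moreover have "((\<lambda>s. t - s) has_derivative (\<lambda>r. r *\<^sub>R (-1))) (at s)"
        by (auto intro!: derivative_eq_intros)
      ultimately have "(?c has_derivative (\<lambda>r. (r *\<^sub>R (B *v (flow s *v X)), r *\<^sub>R (-1)))) (at s)"
        by (rule has_derivative_Pair)
      then have "(?c has_derivative (\<lambda>r. r *\<^sub>R ?c' s)) (at s)" by simp
      from has_derivative_compose[OF this schwartz_has_derivative[OF v]]
      show ?thesis
        by (simp only: has_field_derivative_def inner_scaleR_left mult.assoc sum_distrib_left[symmetric] mult_commute_abs)
    qed
    then obtain z where z: "0 < z" "z < \<tau>" "v (?c \<tau>) - v (?c 0) = (\<tau> - 0) * (\<Sum>e\<in>Basis. (?c' z \<bullet> e) * iter_deriv [e] v (?c z))"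
      using MVT2[of 0 \<tau> "\<lambda>s. v (?c s)" "\<lambda>s. \<Sum>e\<in>Basis. (?c' s \<bullet> e) * iter_deriv [e] v (?c s)"] \<tau> by auto
    have "norm (?c' z) \<le> norm (B *v (flow z *v X)) + 1"
      using norm_Pair_le[of "B *v (flow z *v X)" "-1 :: real"] by simp
    also have "\<dots> \<le> (norm B * K) * norm (flow z *v X) + 1" using K(2)[of B "flow z *v X"] by (simp add: mult_ac)
    also have "\<dots> \<le> (norm B * K) * jap (?c z) + jap (?c z)"
    proof (intro add_mono mult_left_mono)
      have "norm (flow z *v X) \<le> jap (flow z *v X)"
        using zero_le_power2[of "norm (flow z *v X) - 1/2"] by (simp add: power2_diff power2_eq_square algebra_simps)
      moreover have "jap (flow z *v X) \<le> jap (?c z)" by (rule jap_mono) (rule norm_fst_le)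
      ultimately show "norm (flow z *v X) \<le> jap (?c z)" by (rule order_trans)
    qed (use K in \<open>auto simp: jap_ge_1\<close>)
    finally have n: "norm (?c' z) \<le> b * jap (?c z)" by (simp only: b_def distrib_right mult_1_left add.commute)
    have "\<bar>v (?c \<tau>) - v (X, t)\<bar> = \<tau> * \<bar>\<Sum>e\<in>Basis. (?c' z \<bullet> e) * iter_deriv [e] v (?c z)\<bar>"
      using z(3) \<tau> by (simp add: abs_mult del: iter_deriv.simps)
    also have "\<dots> \<le> \<tau> * (norm (?c' z) * (C / jap (?c z) ^ Suc M))"
      using \<tau> by (intro mult_left_mono C) auto
    also have "\<dots> \<le> \<tau> * ((b * jap (?c z)) * (C / jap (?c z) ^ Suc M))"
      using \<tau> C(1) by (intro mult_left_mono mult_right_mono n) auto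
    also have "\<dots> = \<tau> * (b * C) * (1 / jap (?c z) ^ M)" by simp
    also have "\<dots> \<le> \<tau> * (b * C) * (L ^ M / jap (X, t) ^ M)"
    proof (intro mult_left_mono)
      have "jap (X, t) ^ M \<le> (L * jap (?c z)) ^ M" using z \<tau> by (intro power_mono L less_imp_le[OF jap_pos]) auto
      then show "1 / jap (?c z) ^ M \<le> L ^ M / jap (X, t) ^ M"
        by (intro recip_le_divide zero_less_power jap_pos) (simp only: power_mult_distrib)
    qed (use \<tau> b C in auto)
    finally show ?thesis by (simp add: mult_ac)
  qed
  moreover have "b * C * L ^ M \<ge> 0" using b C L by simp
  ultimately show ?thesis using that by blast
qed

text \<open>The factors \<open>A\<close> and \<open>- A\<close> represent the same covariance.
  Averaging the two representations leaves a second difference of \<open>v\<close>, hence the square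
  of a displacement, which is of order \<open>\<tau>\<close>.\<close>

lemma diffusion_difference_bound:
  assumes v: "v \<in> schwartz"
  obtains K where "K \<ge> 0" "\<And>\<tau> X t. 0 < \<tau> \<Longrightarrow> \<tau> \<le> 1 \<Longrightarrow>
    \<bar>evol_semigroup Q B \<tau> v (X, t) - v (flow \<tau> *v X, t - \<tau>)\<bar> \<le> K * \<tau> / jap (X, t) ^ M"
proof -
  obtain K where K: "K \<ge> 0" "\<And>p h. \<bar>v (p + h) + v (p - h) - 2 * v p\<bar> \<le> K * (norm h)\<^sup>2 * jap h ^ M / jap p ^ M"
    using schwartz_second_difference[OF v] by metis
  obtain \<kappa> where \<kappa>: "\<kappa> \<ge> 0" "\<And>\<tau> (M::real^'n^'n) (y::real^'n). 0 < \<tau> \<Longrightarrow> \<tau> \<le> 1 \<Longrightarrow> cov \<tau> = M ** transpose M \<Longrightarrow> (norm (M *v y))\<^sup>2 \<le> \<kappa> * \<tau> * (norm y)\<^sup>2"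
    using small_time_covariance by metis
  obtain L where L: "L > 0" "\<And>\<tau> X t. 0 \<le> \<tau> \<Longrightarrow> \<tau> \<le> 1 \<Longrightarrow> jap (X, t) \<le> L * jap (flow \<tau> *v X, t - \<tau>)"
    using jap_flow_le by metis
  \<comment> \<open>In \<open>Suc M\<close> one power of \<open>jap y\<close> bounds the squared
    displacement and \<open>M\<close> powers come from the factor \<open>jap h ^ M\<close> of the
    second difference.\<close>
  define G where "G = (LINT y::real^'n|lborel. std_gauss y * jap y ^ Suc M)"
  have G: "G \<ge> 0" unfolding G_def by (intro integral_nonneg_AE) auto
  define K' where "K' = K * \<kappa> * (1 + \<kappa>) ^ M * L ^ M * G"
  have "\<bar>evol_semigroup Q B \<tau> v (X, t) - v (flow \<tau> *v X, t - \<tau>)\<bar> \<le> K' * \<tau> / jap (X, t) ^ M"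
    if \<tau>: "0 < \<tau>" "\<tau> \<le> 1" for \<tau> X t
  proof -
    obtain A :: "real^'n^'n" where A: "cov \<tau> = A ** transpose A" "det A \<noteq> 0"
      using pos_def_factorization[OF transpose_cov pos_def_cov[OF \<tau>(1)]] by auto
    define p where "p = (flow \<tau> *v X, t - \<tau>)"
    define h where "h y = (A *v y, 0::real)" for y
    note [measurable] = schwartz_measurable[OF v]
    have ph: "p + h y = (flow \<tau> *v X + A *v y, t - \<tau>)" "p - h y = (flow \<tau> *v X + (- A) *v y, t - \<tau>)" for y
      by (simp_all add: p_def h_def bounded_bilinear.minus_left[OF bounded_bilinear_matrix_vector_mult])
    have i1: "integrable lborel (\<lambda>y. std_gauss y * v (p + h y))" and i2: "integrable lborel (\<lambda>y. std_gauss y * v (p - h y))"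
      unfolding ph by (rule integrable_std_gauss_schwartz[OF v])+
    have i3: "integrable lborel (\<lambda>y::real^'n. std_gauss y * v p)" by (intro integrable_mult_left integrable_std_gauss)
    have P1: "evol_semigroup Q B \<tau> v (X, t) = (LINT y|lborel. std_gauss y * v (p + h y))"
      unfolding ph by (rule semigroup_eq_std_gauss[OF v A \<tau>(1)])
    have "cov \<tau> = (- A) ** transpose (- A)" and "det (- A) \<noteq> 0"
    proof -
      have "(- A) ** transpose (- A) = A ** transpose A"
        by (simp add: matrix_matrix_mult_def vec_eq_iff)
      then show c: "cov \<tau> = (- A) ** transpose (- A)" using A by simp
      have "det (cov \<tau>) \<noteq> 0" using A by (simp add: det_mul)
      then show "det (- A) \<noteq> 0" unfolding c by (auto simp: det_mul)
    qed
    from semigroup_eq_std_gauss[OF v this \<tau>(1)]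
    have P2: "evol_semigroup Q B \<tau> v (X, t) = (LINT y|lborel. std_gauss y * v (p - h y))"
      unfolding ph .
    have "(LINT y|lborel. std_gauss y * (v (p + h y) + v (p - h y) - 2 * v p))
      = (LINT y|lborel. std_gauss y * v (p + h y) + std_gauss y * v (p - h y) - 2 * (std_gauss y * v p))"
      by (simp add: algebra_simps)
    also have "\<dots> = evol_semigroup Q B \<tau> v (X, t) + evol_semigroup Q B \<tau> v (X, t) - 2 * v p"
    proof -
      have "(LINT y::real^'n|lborel. std_gauss y * v p) = v p"
        unfolding integral_mult_left_zero integral_std_gauss by simp
      then show ?thesis
        using i1 i2 i3 P1 P2 by (simp only: Bochner_Integration.integral_diff Bochner_Integration.integral_add Bochner_Integration.integrable_add integrable_mult_right integral_mult_right_zero)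
    qed
    finally have eq: "2 * (evol_semigroup Q B \<tau> v (X, t) - v p) = (LINT y|lborel. std_gauss y * (v (p + h y) + v (p - h y) - 2 * v p))"
      by simp
    have bd: "norm (std_gauss y * (v (p + h y) + v (p - h y) - 2 * v p)) \<le> K * \<kappa> * \<tau> * (1 + \<kappa>) ^ M / jap p ^ M * (std_gauss y * jap y ^ Suc M)" for y
    proof -
      have nh: "(norm (h y))\<^sup>2 \<le> \<kappa> * \<tau> * (norm y)\<^sup>2" using \<kappa>(2)[OF \<tau> A(1), of y] by (simp add: h_def)
      also have "\<dots> \<le> \<kappa> * \<tau> * jap y" using \<kappa> \<tau> by (intro mult_left_mono) auto
      finally have nh1: "(norm (h y))\<^sup>2 \<le> \<kappa> * \<tau> * jap y" .
      have "\<kappa> * \<tau> * (norm y)\<^sup>2 \<le> \<kappa> * 1 * (norm y)\<^sup>2" using \<kappa> \<tau> by (intro mult_right_mono mult_left_mono) auto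
      then have "jap (h y) \<le> (1 + \<kappa>) * jap y"
        using nh \<kappa>(1) zero_le_power2[of "norm y"]
        unfolding distrib_left distrib_right mult_1_left mult_1_right by linarith
      then have "jap (h y) ^ M \<le> ((1 + \<kappa>) * jap y) ^ M" by (intro power_mono less_imp_le[OF jap_pos])
      then have "K * (norm (h y))\<^sup>2 * jap (h y) ^ M \<le> K * (\<kappa> * \<tau> * jap y) * ((1 + \<kappa>) * jap y) ^ M"
        using K(1) \<kappa> \<tau> by (intro mult_mono mult_left_mono nh1) auto
      then have "K * (norm (h y))\<^sup>2 * jap (h y) ^ M / jap p ^ M \<le> K * (\<kappa> * \<tau> * jap y) * ((1 + \<kappa>) * jap y) ^ M / jap p ^ M"
        by (rule divide_right_mono) simp
      with K(2)[of p "h y"] have "\<bar>v (p + h y) + v (p - h y) - 2 * v p\<bar> \<le> K * (\<kappa> * \<tau> * jap y) * ((1 + \<kappa>) * jap y) ^ M / jap p ^ M"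
        by linarith
      from mult_left_mono[OF this, of "std_gauss y"]
      show ?thesis by (simp add: abs_mult power_mult_distrib mult_ac)
    qed
    have "\<bar>2 * (evol_semigroup Q B \<tau> v (X, t) - v p)\<bar> \<le> (LINT y|lborel. norm (std_gauss y * (v (p + h y) + v (p - h y) - 2 * v p)))"
      unfolding eq using integral_norm_bound[of lborel "\<lambda>y. std_gauss y * (v (p + h y) + v (p - h y) - 2 * v p)"] by simp
    also have "\<dots> \<le> (LINT y::real^'n|lborel. K * \<kappa> * \<tau> * (1 + \<kappa>) ^ M / jap p ^ M * (std_gauss y * jap y ^ Suc M))"
    proof (rule integral_mono')
      show "integrable lborel (\<lambda>y::real^'n. K * \<kappa> * \<tau> * (1 + \<kappa>) ^ M / jap p ^ M * (std_gauss y * jap y ^ Suc M))"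
        by (intro integrable_mult_right integrable_std_gauss_jap)
    qed (rule bd, rule order_trans[OF norm_ge_zero bd])
    also have "\<dots> = K * \<kappa> * \<tau> * (1 + \<kappa>) ^ M * G * (1 / jap p ^ M)"
      unfolding integral_mult_right_zero G_def[symmetric] by simp
    also have "\<dots> \<le> K * \<kappa> * \<tau> * (1 + \<kappa>) ^ M * G * (L ^ M / jap (X, t) ^ M)"
    proof (intro mult_left_mono)
      have "jap (X, t) ^ M \<le> (L * jap p) ^ M" using \<tau> unfolding p_def by (intro power_mono L less_imp_le[OF jap_pos]) auto
      then show "1 / jap p ^ M \<le> L ^ M / jap (X, t) ^ M"
        by (intro recip_le_divide zero_less_power jap_pos) (simp only: power_mult_distrib)
    qed (use \<tau> K \<kappa> G in auto)
    also have "\<dots> = K' * \<tau> / jap (X, t) ^ M" by (simp add: K'_def mult_ac)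
    finally have "2 * \<bar>evol_semigroup Q B \<tau> v (X, t) - v p\<bar> \<le> K' * \<tau> / jap (X, t) ^ M"
      by (simp only: abs_mult abs_numeral)
    moreover have "2 * a \<le> b \<Longrightarrow> 0 \<le> a \<Longrightarrow> a \<le> b" for a b :: real by simp
    ultimately show ?thesis unfolding p_def using abs_ge_zero by blast
  qed
  moreover have "K' \<ge> 0" using K \<kappa> L G by (simp add: K'_def)
  ultimately show ?thesis using that by blast
qed

end

section \<open>Bounds for the increments of the semigroup\<close>

text \<open>With the same \<open>b\<close> in both hypotheses, \<open>\<bar>T x\<bar> powr p \<le> b
  powr (p - 1) * \<bar>T x\<bar>\<close> integrates to \<open>b powr p\<close>, so the exponent
  disappears from the bound.\<close>

lemma Lp_norm_le_interpolation:
  fixes T :: "'a::euclidean_space \<Rightarrow> real"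
  assumes [measurable]: "T \<in> borel_measurable lborel" and b: "0 \<le> b"
    and sup: "\<And>x. \<bar>T x\<bar> \<le> b" and L1: "(\<integral>\<^sup>+x. ennreal \<bar>T x\<bar> \<partial>lborel) \<le> ennreal b" and p: "1 \<le> p"
  shows "Lp_norm p T \<le> ennreal b"
proof -
  have "\<bar>T x\<bar> powr p \<le> b powr (p - 1) * \<bar>T x\<bar>" for x
  proof (cases "T x = 0")
    case False
    then have "\<bar>T x\<bar> powr p = \<bar>T x\<bar> powr (p - 1) * \<bar>T x\<bar>" by (simp add: powr_diff)
    also have "\<dots> \<le> b powr (p - 1) * \<bar>T x\<bar>"
      using p sup[of x] by (intro mult_right_mono powr_mono2) auto
    finally show ?thesis .
  qed simp
  then have "(\<integral>\<^sup>+x. ennreal (\<bar>T x\<bar> powr p) \<partial>lborel) \<le> (\<integral>\<^sup>+x. ennreal (b powr (p - 1)) * ennreal \<bar>T x\<bar> \<partial>lborel)"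
    by (intro nn_integral_mono) (simp add: ennreal_mult[symmetric] ennreal_leI)
  also have "\<dots> = ennreal (b powr (p - 1)) * (\<integral>\<^sup>+x. ennreal \<bar>T x\<bar> \<partial>lborel)" by (simp add: nn_integral_cmult)
  also have "\<dots> \<le> ennreal (b powr (p - 1)) * ennreal b" by (intro mult_left_mono L1) simp
  also have "\<dots> = ennreal (b powr p)"
    using b by (cases "b = 0") (simp_all add: ennreal_mult[symmetric] powr_diff)
  finally have le: "(\<integral>\<^sup>+x. ennreal (\<bar>T x\<bar> powr p) \<partial>lborel) \<le> ennreal (b powr p)" .
  define I where "I = (\<integral>\<^sup>+x. ennreal (\<bar>T x\<bar> powr p) \<partial>lborel)"
  have fin: "I \<noteq> \<infinity>" using le by (auto simp: I_def top_unique)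
  then have "enn2real I \<le> b powr p" using le by (simp add: I_def enn2real_leI)
  then have "enn2real I powr (1 / p) \<le> (b powr p) powr (1 / p)" using p by (intro powr_mono2) auto
  also have "\<dots> = b" using p b by (simp add: powr_powr)
  finally show ?thesis unfolding Lp_norm_def I_def[symmetric] Let_def using fin by (simp add: ennreal_leI)
qed

text \<open>The envelope of a kernel of size \<open>\<tau> powr (- 1 - \<sigma>)\<close> times an
  increment of size \<open>min 1 \<tau>\<close>. For \<open>0 < \<sigma> < 1\<close> it is
  integrable at both ends.\<close>

definition riesz :: "real \<Rightarrow> real \<Rightarrow> real" where
  "riesz \<sigma> \<tau> = indicator {0<..} \<tau> * (\<tau> powr (- 1 - \<sigma>) * min 1 \<tau>)"

lemma riesz_nonneg: "0 \<le> riesz \<sigma> \<tau>"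
  by (auto simp: riesz_def indicator_def)

lemma measurable_riesz [measurable]: "riesz \<sigma> \<in> borel_measurable borel"
  unfolding riesz_def by measurable

lemma set_integrable_lborel_nonneg:
  fixes f :: "real \<Rightarrow> real"
  assumes "f integrable_on S" "\<And>x. x \<in> S \<Longrightarrow> 0 \<le> f x" "S \<in> sets borel" "f \<in> borel_measurable borel"
  shows "set_integrable lborel S f"
proof -
  have "set_integrable lebesgue S f"
    using nonnegative_absolutely_integrable_1[OF assms(1,2)] by blast
  then show ?thesis
    unfolding set_integrable_def using assms(3,4) by (subst (asm) integrable_completion) auto
qed

lemma integrable_riesz:
  assumes "0 < \<sigma>" "\<sigma> < 1"
  shows "integrable lborel (riesz \<sigma>)"
proof -
  have 1: "set_integrable lborel {0<..1} (\<lambda>\<tau>::real. \<tau> powr (- \<sigma>))"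
    using assms by (intro set_integrable_lborel_nonneg integrable_on_powr_from_0') auto
  have 2: "set_integrable lborel {1..} (\<lambda>\<tau>::real. \<tau> powr (- 1 - \<sigma>))"
    using has_integral_powr_to_inf[of "- 1 - \<sigma>" 1] assms
    by (intro set_integrable_lborel_nonneg) (auto simp: integrable_on_def)
  have "integrable lborel (\<lambda>\<tau>. indicator {0<..1} \<tau> *\<^sub>R \<tau> powr (- \<sigma>) + indicator {1..} \<tau> *\<^sub>R \<tau> powr (- 1 - \<sigma>))"
    using 1 2 unfolding set_integrable_def by (rule Bochner_Integration.integrable_add)
  then show ?thesis
  proof (rule Bochner_Integration.integrable_bound)
    show "AE \<tau> in lborel. norm (riesz \<sigma> \<tau>) \<le> norm (indicator {0<..1} \<tau> *\<^sub>R \<tau> powr (- \<sigma>) + indicator {1..} \<tau> *\<^sub>R \<tau> powr (- 1 - \<sigma>))"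
    proof (rule AE_I2)
      fix \<tau> :: real
      have "\<tau> powr (- 1 - \<sigma>) * \<tau> = \<tau> powr (- \<sigma>)" if "0 < \<tau>"
        using that powr_add[of \<tau> "- 1 - \<sigma>" 1] by simp
      then show "norm (riesz \<sigma> \<tau>) \<le> norm (indicator {0<..1} \<tau> *\<^sub>R \<tau> powr (- \<sigma>) + indicator {1..} \<tau> *\<^sub>R \<tau> powr (- 1 - \<sigma>))"
        by (auto simp: riesz_def indicator_def min_def)
    qed
  qed measurable
qed

text \<open>The substitution of \<open>z\<^sup>2 / (4 * \<tau>)\<close> leads to Euler's integral
  for \<open>Gamma \<sigma>\<close>; the exponent \<open>1 + \<sigma>\<close> is the one that,
  together with the Jacobian, gives the power \<open>\<sigma> - 1\<close>.\<close>

lemma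
  assumes z: "0 < z" and \<sigma>: "0 < \<sigma>"
  shows set_integrable_weight: "set_integrable lborel {0<..} (\<lambda>\<tau>. weight \<alpha> (1 + \<sigma>) \<tau> z)"
    and integral_weight: "(LBINT \<tau>:{0<..}. weight \<alpha> (1 + \<sigma>) \<tau> z) = z powr \<alpha> * (z\<^sup>2 / 4) powr (- \<sigma>) * Gamma \<sigma>"
proof -
  define f where "f r = r powr (\<sigma> - 1) * exp (- r)" for r :: real
  define g where "g \<tau> = z\<^sup>2 / (4 * \<tau>)" for \<tau> :: real
  define g' where "g' \<tau> = - z\<^sup>2 / (4 * \<tau>\<^sup>2)" for \<tau> :: real
  have f: "(f has_integral Gamma \<sigma>) {0<..}"
  proof -
    have "(f has_integral Gamma \<sigma>) {0..}"
      using Gamma_integral_real[OF \<sigma>] by (simp add: f_def[abs_def] exp_minus divide_inverse)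
    then show ?thesis
      by (rule has_integral_spike_set_eq[THEN iffD1, rotated 2]) (auto intro: negligible_subset[of "{0}"])
  qed
  have fabs: "f absolutely_integrable_on {0<..}"
    using f by (intro nonnegative_absolutely_integrable_1) (auto simp: f_def integrable_on_def)
  have img: "g ` {0<..} = {0<..}"
  proof
    show "{0<..} \<subseteq> g ` {0<..}"
    proof
      fix r :: real assume "r \<in> {0<..}"
      then show "r \<in> g ` {0<..}" using z by (intro image_eqI[of _ _ "z\<^sup>2 / (4 * r)"]) (auto simp: g_def)
    qed
  qed (use z in \<open>auto simp: g_def\<close>)
  have "(\<lambda>\<tau>. \<bar>g' \<tau>\<bar> * f (g \<tau>)) absolutely_integrable_on {0<..} \<and> integral {0<..} (\<lambda>\<tau>. \<bar>g' \<tau>\<bar> * f (g \<tau>)) = Gamma \<sigma>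
    \<longleftrightarrow> f absolutely_integrable_on (g ` {0<..}) \<and> integral (g ` {0<..}) f = Gamma \<sigma>"
  proof (rule has_absolute_integral_change_of_variables_1')
    show "(g has_field_derivative g' \<tau>) (at \<tau> within {0<..})" if "\<tau> \<in> {0<..}" for \<tau>
      unfolding g_def g'_def using that by (auto intro!: derivative_eq_intros simp: power2_eq_square field_simps)
    show "inj_on g {0<..}" using z by (auto simp: inj_on_def g_def)
  qed auto
  then have cv: "(\<lambda>\<tau>. \<bar>g' \<tau>\<bar> * f (g \<tau>)) absolutely_integrable_on {0<..}" "integral {0<..} (\<lambda>\<tau>. \<bar>g' \<tau>\<bar> * f (g \<tau>)) = Gamma \<sigma>"
    using fabs f unfolding img by (auto simp: has_integral_integrable_integral)
  define c where "c = z powr \<alpha> * (z\<^sup>2 / 4) powr (- \<sigma>)"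
  have eq: "weight \<alpha> (1 + \<sigma>) \<tau> z = c * (\<bar>g' \<tau>\<bar> * f (g \<tau>))" if "\<tau> \<in> {0<..}" for \<tau>
  proof -
    have \<tau>: "0 < \<tau>" using that by simp
    define q where "q = z\<^sup>2 / 4"
    have q: "0 < q" using z by (simp add: q_def)
    have "\<bar>g' \<tau>\<bar> = q / \<tau>\<^sup>2" "g \<tau> = q / \<tau>" "- z\<^sup>2 / (4 * \<tau>) = - (q / \<tau>)" by (simp_all add: g'_def g_def q_def)
    moreover have "\<tau> powr (- (1 + \<sigma>)) = q powr (- \<sigma>) * (q / \<tau>\<^sup>2 * (q / \<tau>) powr (\<sigma> - 1))"
    proof -
      have "(q / \<tau>) powr (\<sigma> - 1) = q powr \<sigma> / q * (\<tau> / \<tau> powr \<sigma>)"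
        using q \<tau> by (simp add: powr_divide powr_diff)
      moreover have "\<tau> powr (- (1 + \<sigma>)) = 1 / (\<tau> * \<tau> powr \<sigma>)" using \<tau> powr_add[of \<tau> 1 \<sigma>] by (simp only: powr_minus_divide) simp
      moreover have "q powr (- \<sigma>) = 1 / q powr \<sigma>" using q by (simp add: powr_minus inverse_eq_divide)
      ultimately show ?thesis using q \<tau> by (simp add: power2_eq_square)
    qed
    ultimately show ?thesis by (simp add: weight_def f_def c_def flip: q_def)
  qed
  have int: "(\<lambda>\<tau>. weight \<alpha> (1 + \<sigma>) \<tau> z) integrable_on {0<..}"
  proof -
    have "(\<lambda>\<tau>. c * (\<bar>g' \<tau>\<bar> * f (g \<tau>))) integrable_on {0<..}"
      using cv(1) by (intro integrable_on_mult_right) (simp add: absolutely_integrable_on_def)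
    then show ?thesis by (rule integrable_eq) (simp add: eq)
  qed
  show si: "set_integrable lborel {0<..} (\<lambda>\<tau>. weight \<alpha> (1 + \<sigma>) \<tau> z)"
    by (intro set_integrable_lborel_nonneg int weight_nonneg) auto
  have "(LBINT \<tau>:{0<..}. weight \<alpha> (1 + \<sigma>) \<tau> z) = integral {0<..} (\<lambda>\<tau>. weight \<alpha> (1 + \<sigma>) \<tau> z)"
    by (rule set_borel_integral_eq_integral(2)[OF si])
  also have "\<dots> = integral {0<..} (\<lambda>\<tau>. c * (\<bar>g' \<tau>\<bar> * f (g \<tau>)))"
    by (rule Henstock_Kurzweil_Integration.integral_cong) (simp add: eq)
  also have "\<dots> = c * Gamma \<sigma>" by (simp add: cv(2))
  finally show "(LBINT \<tau>:{0<..}. weight \<alpha> (1 + \<sigma>) \<tau> z) = z powr \<alpha> * (z\<^sup>2 / 4) powr (- \<sigma>) * Gamma \<sigma>"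
    by (simp add: c_def)
qed

section \<open>Increments in L1 and in the supremum norm\<close>

context kolmogorov
begin

text \<open>After Tonelli the Gaussian variable \<open>y\<close> is fixed. The affine map
  \<open>S y\<close> scales volume by \<open>det (flow \<tau>)\<close>, which is at least 1, so
  composition with it does not increase the integral; the Gaussian has mass 1.\<close>

lemma nn_integral_semigroup_le:
  assumes v: "v \<in> schwartz" and \<tau>: "0 < \<tau>"
  shows "(\<integral>\<^sup>+x. ennreal \<bar>evol_semigroup Q B \<tau> v x\<bar> \<partial>lborel) \<le> (\<integral>\<^sup>+x. ennreal \<bar>v x\<bar> \<partial>lborel)"
proof -
  note [measurable] = schwartz_measurable[OF v]
  obtain A :: "real^'n^'n" where A: "cov \<tau> = A ** transpose A" "det A \<noteq> 0"
    using pos_def_factorization[OF transpose_cov pos_def_cov[OF \<tau>]] by auto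
  define g where "g x = ennreal \<bar>v x\<bar>" for x
  have [measurable]: "g \<in> borel_measurable borel" unfolding g_def by measurable
  define S where "S y x = (flow \<tau> *v fst x + A *v y, snd x - \<tau>)" for y and x :: "(real^'n) \<times> real"
  have S_meas [measurable]: "(\<lambda>q. S (snd q) (fst q)) \<in> borel_measurable borel"
    unfolding S_def by (intro borel_measurable_continuous_onI continuous_intros continuous_on_matrix_vector_mult)
  have [measurable]: "S y \<in> borel_measurable borel" for y
    unfolding S_def by (intro borel_measurable_continuous_onI continuous_intros continuous_on_matrix_vector_mult)
  have det: "1 \<le> \<bar>det (flow \<tau>)\<bar>" using det_flow_ge_1[of \<tau>] \<tau> by simp
  have inner: "(\<integral>\<^sup>+x. g (S y x) \<partial>lborel) \<le> (\<integral>\<^sup>+x. g x \<partial>lborel)" for y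
  proof -
    have [measurable]: "(\<lambda>X. g (X, r)) \<in> borel_measurable borel" for r by measurable
    have [measurable]: "(\<lambda>X. g (X + A *v y, r)) \<in> borel_measurable borel" for r
      by (intro measurable_compose[OF _ \<open>g \<in> borel_measurable borel\<close>] borel_measurable_continuous_onI continuous_intros)
    have slice: "(\<integral>\<^sup>+X. g (flow \<tau> *v X + A *v y, r) \<partial>lborel) \<le> (\<integral>\<^sup>+X. g (X, r) \<partial>lborel)" for r
    proof -
      have "(\<integral>\<^sup>+X. g (flow \<tau> *v X + A *v y, r) \<partial>lborel) * 1
          \<le> (\<integral>\<^sup>+X. g (flow \<tau> *v X + A *v y, r) \<partial>lborel) * ennreal \<bar>det (flow \<tau>)\<bar>"
        using det by (intro mult_left_mono) (auto simp: ennreal_1[symmetric] simp del: ennreal_1 intro!: ennreal_leI)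
      also have "\<dots> = (\<integral>\<^sup>+X. g (X + A *v y, r) \<partial>lborel)"
        using det by (intro nn_integral_lborel_matrix[of "flow \<tau>" "\<lambda>X. g (X + A *v y, r)"]) auto
      also have "\<dots> = (\<integral>\<^sup>+X. g (X, r) \<partial>distr lborel borel ((+) (A *v y)))"
        by (subst nn_integral_distr) (auto simp: add.commute)
      finally show ?thesis by (simp add: lborel_distr_plus)
    qed
    have "(\<integral>\<^sup>+x. g (S y x) \<partial>lborel) = (\<integral>\<^sup>+t. \<integral>\<^sup>+X. g (S y (X, t)) \<partial>lborel \<partial>lborel)"
      by (subst lborel_prod[symmetric], rule lborel_pair.nn_integral_snd[symmetric]) (simp add: lborel_prod)
    also have "\<dots> \<le> (\<integral>\<^sup>+t. \<integral>\<^sup>+X. g (X, t - \<tau>) \<partial>lborel \<partial>lborel)"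
      unfolding S_def fst_conv snd_conv by (intro nn_integral_mono slice)
    also have "\<dots> = (\<integral>\<^sup>+t. \<integral>\<^sup>+X. g (X, t) \<partial>lborel \<partial>lborel)"
    proof -
      have m: "(\<lambda>t. \<integral>\<^sup>+X. g (X, t) \<partial>lborel) \<in> borel_measurable borel" by measurable
      show ?thesis using nn_integral_real_affine[OF m, of 1 "- \<tau>"] by simp
    qed
    also have "\<dots> = (\<integral>\<^sup>+x. g x \<partial>lborel)"
      using lborel_pair.nn_integral_snd[of g] by (simp add: lborel_prod)
    finally show ?thesis .
  qed
  have "(\<integral>\<^sup>+x. ennreal \<bar>evol_semigroup Q B \<tau> v x\<bar> \<partial>lborel) \<le> (\<integral>\<^sup>+x. \<integral>\<^sup>+y. ennreal (std_gauss (y::real^'n)) * g (S y x) \<partial>lborel \<partial>lborel)"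
  proof (rule nn_integral_mono)
    fix x :: "(real^'n) \<times> real"
    obtain X t where x: "x = (X, t)" by (cases x)
    have "ennreal \<bar>evol_semigroup Q B \<tau> v x\<bar> \<le> (\<integral>\<^sup>+y. ennreal (norm (std_gauss y * v (flow \<tau> *v X + A *v y, t - \<tau>))) \<partial>lborel)"
      unfolding x semigroup_eq_std_gauss[OF v A \<tau>] real_norm_def[symmetric]
      by (rule integral_norm_bound_ennreal[OF integrable_std_gauss_schwartz[OF v]])
    also have "\<dots> = (\<integral>\<^sup>+y. ennreal (std_gauss (y::real^'n)) * g (S y x) \<partial>lborel)"
      by (simp add: g_def S_def x abs_mult ennreal_mult)
    finally show "ennreal \<bar>evol_semigroup Q B \<tau> v x\<bar> \<le> (\<integral>\<^sup>+y. ennreal (std_gauss (y::real^'n)) * g (S y x) \<partial>lborel)" .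
  qed
  also have "\<dots> = (\<integral>\<^sup>+y. \<integral>\<^sup>+x. ennreal (std_gauss (y::real^'n)) * g (S y x) \<partial>lborel \<partial>lborel)"
  proof (rule lborel_pair.Fubini'[symmetric])
    have "(\<lambda>q. ennreal (std_gauss (snd q)) * g (S (snd q) (fst q))) \<in> borel_measurable (borel :: (((real^'n) \<times> real) \<times> (real^'n)) measure)"
      by measurable
    then show "(\<lambda>(x, y). ennreal (std_gauss (y::real^'n)) * g (S y x)) \<in> borel_measurable (lborel \<Otimes>\<^sub>M lborel)"
      by (simp add: lborel_prod case_prod_beta')
  qed
  also have "\<dots> = (\<integral>\<^sup>+y. ennreal (std_gauss (y::real^'n)) * (\<integral>\<^sup>+x. g (S y x) \<partial>lborel) \<partial>lborel)"
    by (intro nn_integral_cong nn_integral_cmult) measurable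
  also have "\<dots> \<le> (\<integral>\<^sup>+y. ennreal (std_gauss (y::real^'n)) * (\<integral>\<^sup>+x. g x \<partial>lborel) \<partial>lborel)"
    by (intro nn_integral_mono mult_left_mono inner) simp
  also have "\<dots> = (\<integral>\<^sup>+y. ennreal (std_gauss (y::real^'n)) \<partial>lborel) * (\<integral>\<^sup>+x. g x \<partial>lborel)"
    by (rule nn_integral_multc) measurable
  also have "(\<integral>\<^sup>+y. ennreal (std_gauss (y::real^'n)) \<partial>lborel) = 1"
    by (subst nn_integral_eq_integral[OF integrable_std_gauss]) (simp_all only: integral_std_gauss ennreal_1, simp)
  finally show ?thesis by (simp add: g_def)
qed

lemma semigroup_sup_bound:
  assumes v: "v \<in> schwartz" and C: "\<And>x. \<bar>v x\<bar> \<le> C" and \<tau>: "0 < \<tau>"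
  shows "\<bar>evol_semigroup Q B \<tau> v x\<bar> \<le> C"
proof -
  obtain X t where x: "x = (X, t)" by (cases x)
  obtain A :: "real^'n^'n" where A: "cov \<tau> = A ** transpose A" "det A \<noteq> 0"
    using pos_def_factorization[OF transpose_cov pos_def_cov[OF \<tau>]] by auto
  have "\<bar>evol_semigroup Q B \<tau> v x\<bar> \<le> (LINT y|lborel. norm (std_gauss y * v (flow \<tau> *v X + A *v y, t - \<tau>)))"
    unfolding x semigroup_eq_std_gauss[OF v A \<tau>] real_norm_def[symmetric] by (rule integral_norm_bound)
  also have "\<dots> \<le> (LINT y::real^'n|lborel. std_gauss y * C)"
  proof (rule integral_mono')
    show "integrable lborel (\<lambda>y::real^'n. std_gauss y * C)" by (intro integrable_mult_left integrable_std_gauss)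
    have "0 \<le> C" using order_trans[OF abs_ge_zero C] .
    then show "0 \<le> std_gauss y * C" for y :: "real^'n" by simp
    show "norm (std_gauss y * v (flow \<tau> *v X + A *v y, t - \<tau>)) \<le> std_gauss y * C" for y
      unfolding norm_mult using C by (simp add: mult_left_mono)
  qed
  also have "\<dots> = C" unfolding integral_mult_left_zero integral_std_gauss by simp
  finally show ?thesis .
qed

text \<open>Zero for \<open>\<tau> \<le> 0\<close>, so that kernels in \<open>\<tau>\<close> need
  bounds only on the half-line although the integrals run over the whole line.\<close>

definition increment :: "((real^'n) \<times> real \<Rightarrow> real) \<Rightarrow> real \<Rightarrow> (real^'n) \<times> real \<Rightarrow> real" where
  "increment v \<tau> x = (if \<tau> \<le> 0 then 0 else evol_semigroup Q B \<tau> v x - v x)"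

text \<open>Joint measurability in time and position is read off the Fourier representation, built
  from \<open>covq\<close>, \<open>freq\<close> and \<open>partial_FT\<close>; the kernel itself
  would bring in the determinant and inverse of the covariance.\<close>

lemma measurable_increment:
  assumes v: "v \<in> schwartz"
  shows "(\<lambda>p. increment v (fst p) (snd p)) \<in> borel_measurable borel"
proof -
  note [measurable] = schwartz_measurable[OF v]
  have sets: "sets (borel \<Otimes>\<^sub>M lborel) = sets (borel :: ((real \<times> ((real^'n) \<times> real)) \<times> (real^'n)) measure)"
    by (subst sets_pair_measure_cong[OF refl sets_lborel]) (rule arg_cong[OF borel_prod])
  have "(\<lambda>q. mode [] v (fst (snd (fst q))) (snd (snd (fst q))) (fst (fst q)) (snd q))
      \<in> borel_measurable (borel :: ((real \<times> ((real^'n) \<times> real)) \<times> (real^'n)) measure)"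
  proof -
    let ?M = "borel :: ((real \<times> ((real^'n) \<times> real)) \<times> (real^'n)) measure"
    have [measurable]: "(\<lambda>q. covq (fst (fst q)) (snd q)) \<in> borel_measurable ?M"
      "(\<lambda>q. freq (fst (fst q)) (snd q) \<bullet> fst (snd (fst q))) \<in> borel_measurable ?M"
      by (intro borel_measurable_continuous_onI continuous_intros)+
    have [measurable]: "(\<lambda>q. partial_FT v (snd (snd (fst q)) - fst (fst q)) (snd q)) \<in> borel_measurable ?M"
      by (intro measurable_partial_FT[OF v] borel_measurable_continuous_onI continuous_intros)
    show ?thesis unfolding mode_def symb_simps by measurable
  qed
  then have "(\<lambda>(p, \<xi>). mode [] v (fst (snd p)) (snd (snd p)) (fst p) \<xi>) \<in> borel_measurable (borel \<Otimes>\<^sub>M lborel)"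
    unfolding measurable_cong_sets[OF sets refl] by (simp add: case_prod_beta')
  then have [measurable]: "(\<lambda>p. LINT \<xi>|lborel. mode [] v (fst (snd p)) (snd (snd p)) (fst p) \<xi>) \<in> borel_measurable borel"
    by (rule lborel.borel_measurable_lebesgue_integral)
  have "increment v (fst p) (snd p) = (if fst p \<le> 0 then 0 else
      Re (LINT \<xi>|lborel. mode [] v (fst (snd p)) (snd (snd p)) (fst p) \<xi>) / (2 * pi) ^ CARD('n) - v (snd p))" for p
  proof (cases "fst p \<le> 0")
    case False
    then show ?thesis
      using semigroup_eq_Fourier[OF v, of "fst p" "fst (snd p)" "snd (snd p)"] by (simp add: increment_def)
  qed (simp add: increment_def)
  then show ?thesis by simp
qed

text \<open>For \<open>\<tau> \<le> 1\<close> the transport and diffusion errors add up to order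
  \<open>\<tau>\<close>, with the weight power \<open>M\<close> equal to the dimension of space-time
  and hence integrable. For \<open>\<tau> > 1\<close> the supremum and the L1 norm of
  \<open>v\<close> suffice. \<open>C\<close> dominates the constants of all four cases.\<close>

lemma increment_bounds:
  assumes v: "v \<in> schwartz"
  obtains C where "C \<ge> 0" "\<And>\<tau> x. 0 < \<tau> \<Longrightarrow> \<bar>increment v \<tau> x\<bar> \<le> C * min 1 \<tau>"
    "\<And>\<tau>. 0 < \<tau> \<Longrightarrow> (\<integral>\<^sup>+x. ennreal \<bar>increment v \<tau> x\<bar> \<partial>lborel) \<le> ennreal (C * min 1 \<tau>)"
proof -
  define M where "M = DIM((real^'n) \<times> real)"
  obtain K1 where K1: "K1 \<ge> 0" "\<And>\<tau> X t. 0 < \<tau> \<Longrightarrow> \<tau> \<le> 1 \<Longrightarrow> \<bar>v (flow \<tau> *v X, t - \<tau>) - v (X, t)\<bar> \<le> K1 * \<tau> / jap (X, t) ^ M"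
    using transport_difference_bound[OF v] by metis
  obtain K2 where K2: "K2 \<ge> 0" "\<And>\<tau> X t. 0 < \<tau> \<Longrightarrow> \<tau> \<le> 1 \<Longrightarrow>
      \<bar>evol_semigroup Q B \<tau> v (X, t) - v (flow \<tau> *v X, t - \<tau>)\<bar> \<le> K2 * \<tau> / jap (X, t) ^ M"
    using diffusion_difference_bound[OF v] by metis
  have small: "\<bar>increment v \<tau> x\<bar> \<le> (K1 + K2) * \<tau> * (1 / jap x ^ M)" if "0 < \<tau>" "\<tau> \<le> 1" for \<tau> x
  proof (cases x)
    case (Pair X t)
    have "\<bar>increment v \<tau> x\<bar> \<le> K2 * \<tau> / jap (X, t) ^ M + K1 * \<tau> / jap (X, t) ^ M"
      using K1(2)[OF that, of X t] K2(2)[OF that, of X t] that(1) unfolding increment_def Pair by simp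
    then show ?thesis using Pair by (simp add: add_divide_distrib distrib_right add.commute)
  qed
  define I where "I = (LINT x|lborel. 1 / jap (x :: (real^'n) \<times> real) ^ M)"
  have int: "integrable lborel (\<lambda>x :: (real^'n) \<times> real. 1 / jap x ^ M)" by (rule integrable_jap_power) (simp add: M_def)
  have I: "I \<ge> 0" unfolding I_def by (intro integral_nonneg_AE) simp
  obtain C0 where C0: "C0 > 0" "\<And>x. \<bar>v x\<bar> \<le> C0 / jap x ^ 0" using schwartz_bound[OF v] by blast
  have C0': "\<bar>v x\<bar> \<le> C0" for x using C0(2)[of x] by simp
  define N where "N = (LINT x|lborel. \<bar>v x\<bar>)"
  have N: "N \<ge> 0" unfolding N_def by (intro integral_nonneg_AE) simp
  have nnN: "(\<integral>\<^sup>+x. ennreal \<bar>v x\<bar> \<partial>lborel) = ennreal N"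
    unfolding N_def by (rule nn_integral_eq_integral) (auto intro: schwartz_integrable v)
  define C where "C = (K1 + K2) * (1 + I) + 2 * C0 + 2 * N"
  have K: "0 \<le> K1 + K2" and KI: "0 \<le> (K1 + K2) * I" using K1(1) K2(1) I by auto
  show ?thesis
  proof (rule that[of C])
    show "C \<ge> 0" using K KI C0(1) N by (simp add: C_def distrib_left)
    show "\<bar>increment v \<tau> x\<bar> \<le> C * min 1 \<tau>" if \<tau>: "0 < \<tau>" for \<tau> x
    proof (cases "\<tau> \<le> 1")
      case True
      have "(K1 + K2) * \<tau> * (1 / jap x ^ M) \<le> (K1 + K2) * \<tau> * 1"
        using K \<tau> one_le_power[OF jap_ge_1[of x], of M] by (intro mult_left_mono) auto
      also have "\<dots> \<le> C * \<tau>" using \<tau> KI C0(1) N by (simp add: C_def distrib_left)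
      finally show ?thesis using small[OF \<tau> True, of x] True by (simp add: min_def)
    next
      case False
      have "\<bar>increment v \<tau> x\<bar> \<le> C0 + C0"
        using semigroup_sup_bound[OF v C0' \<tau>, of x] C0'[of x] \<tau> unfolding increment_def by simp
      also have "\<dots> \<le> C" using K KI N by (simp add: C_def distrib_left)
      finally show ?thesis using False by (simp add: min_def)
    qed
    show "(\<integral>\<^sup>+x. ennreal \<bar>increment v \<tau> x\<bar> \<partial>lborel) \<le> ennreal (C * min 1 \<tau>)" if \<tau>: "0 < \<tau>" for \<tau>
    proof (cases "\<tau> \<le> 1")
      case True
      have "(\<integral>\<^sup>+x. ennreal \<bar>increment v \<tau> x\<bar> \<partial>lborel) \<le> (\<integral>\<^sup>+x. ennreal ((K1 + K2) * \<tau> * (1 / jap (x :: (real^'n) \<times> real) ^ M)) \<partial>lborel)"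
        by (intro nn_integral_mono ennreal_leI small \<tau> True)
      also have "\<dots> = ennreal (LINT x|lborel. (K1 + K2) * \<tau> * (1 / jap (x :: (real^'n) \<times> real) ^ M))"
        using K \<tau> by (intro nn_integral_eq_integral integrable_mult_right int) auto
      also have "(LINT x|lborel. (K1 + K2) * \<tau> * (1 / jap (x :: (real^'n) \<times> real) ^ M)) = (K1 + K2) * \<tau> * I"
        unfolding integral_mult_right_zero I_def ..
      also have "ennreal ((K1 + K2) * \<tau> * I) \<le> ennreal (C * min 1 \<tau>)"
      proof (rule ennreal_leI)
        have "(K1 + K2) * I \<le> C" using K C0(1) N by (simp add: C_def distrib_left)
        from mult_right_mono[OF this, of \<tau>] show "(K1 + K2) * \<tau> * I \<le> C * min 1 \<tau>"
          using True \<tau> by (simp add: min_def mult_ac)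
      qed
      finally show ?thesis .
    next
      case False
      note [measurable] = schwartz_measurable[OF v]
      have "(\<integral>\<^sup>+x. ennreal \<bar>increment v \<tau> x\<bar> \<partial>lborel) \<le> (\<integral>\<^sup>+x. ennreal \<bar>increment v \<tau> x + v x\<bar> + ennreal \<bar>v x\<bar> \<partial>lborel)"
      proof (rule nn_integral_mono)
        fix x
        have "\<bar>increment v \<tau> x\<bar> \<le> \<bar>increment v \<tau> x + v x\<bar> + \<bar>v x\<bar>" by linarith
        then show "ennreal \<bar>increment v \<tau> x\<bar> \<le> ennreal \<bar>increment v \<tau> x + v x\<bar> + ennreal \<bar>v x\<bar>"
          by (simp add: ennreal_plus[symmetric] ennreal_leI del: ennreal_plus)
      qed
      also have "\<dots> = (\<integral>\<^sup>+x. ennreal \<bar>increment v \<tau> x + v x\<bar> \<partial>lborel) + ennreal N"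
      proof -
        have "(\<lambda>x. increment v \<tau> x) \<in> borel_measurable borel"
          using measurable_compose[OF _ measurable_increment[OF v], of "\<lambda>x. (\<tau>, x)" borel]
          by (simp add: borel_measurable_continuous_onI continuous_intros)
        note [measurable] = this
        show ?thesis by (subst nn_integral_add) (auto simp: nnN)
      qed
      also have "(\<integral>\<^sup>+x. ennreal \<bar>increment v \<tau> x + v x\<bar> \<partial>lborel) \<le> ennreal N"
        using nn_integral_semigroup_le[OF v \<tau>] \<tau> nnN by (simp add: increment_def)
      then have "(\<integral>\<^sup>+x. ennreal \<bar>increment v \<tau> x + v x\<bar> \<partial>lborel) + ennreal N \<le> ennreal N + ennreal N"
        by (rule add_right_mono)
      also have "ennreal N + ennreal N \<le> ennreal (C * min 1 \<tau>)"
        using False N K KI C0(1) by (simp add: ennreal_plus[symmetric] min_def C_def distrib_left del: ennreal_plus)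
      finally show ?thesis .
    qed
  qed
qed

end

section \<open>Boundary limits\<close>

lemma tendsto_0_powr_bound:
  fixes f :: "real \<Rightarrow> ennreal"
  assumes "0 < e" "\<And>z. 0 < z \<Longrightarrow> f z \<le> ennreal (K * z powr e)"
  shows "(f \<longlongrightarrow> 0) (at_right 0)"
proof (rule tendsto_sandwich[of "\<lambda>_. 0" f _ "\<lambda>z. ennreal (K * z powr e)"])
  have "((\<lambda>z. K * z powr e) \<longlongrightarrow> K * 0) (at_right 0)"
    using assms(1) by (intro tendsto_mult tendsto_const tendsto_zero_powrI[of _ _ _ e])
      (auto simp: eventually_at_right_field intro!: exI[of _ 1])
  then show "((\<lambda>z. ennreal (K * z powr e)) \<longlongrightarrow> 0) (at_right 0)"
    using tendsto_ennrealI by fastforce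
  show "\<forall>\<^sub>F z in at_right 0. f z \<le> ennreal (K * z powr e)"
    using assms(2) by (auto simp: eventually_at_right_field intro!: exI[of _ 1])
qed auto

lemma min_le_powr:
  assumes "0 < q" "0 < d" "d \<le> (1::real)"
  shows "min 1 q \<le> q powr d"
proof (cases "q \<le> 1")
  case True
  then have "q powr 1 \<le> q powr d" using assms by (intro powr_mono') auto
  then show ?thesis using assms True by simp
next
  case False
  then have "1 \<le> q powr d" using assms by (intro ge_one_powr_ge_zero) auto
  then show ?thesis using False by simp
qed

text \<open>With \<open>q = z\<^sup>2 / (4 * \<tau>)\<close> the profile is
  \<open>z powr (1 - 2 * s)\<close> times the derivative of the weight in \<open>z\<close>, divided
  by \<open>\<tau> powr (- 1 - s)\<close>. At \<open>q = 0\<close> it has the value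
  \<open>2 * s\<close>, which belongs to the limit kernel.\<close>

lemma neumann_profile_bounds:
  fixes s q :: real
  assumes s: "0 < s" "s < 1" and q: "0 < q"
  shows "\<bar>(2 * s - 2 * q) * exp (- q) - 2 * s\<bar> \<le> 4 * min 1 q" and "\<bar>(2 * s - 2 * q) * exp (- q)\<bar> \<le> 4"
proof -
  have "1 - q \<le> exp (- q)" using exp_ge_add_one_self[of "- q"] by simp
  moreover have "exp (- q) \<le> 1" using q by simp
  ultimately have e: "0 \<le> 1 - exp (- q)" "1 - exp (- q) \<le> min 1 q" by auto
  have "q \<le> exp q" using exp_ge_add_one_self[of q] by linarith
  then have "q * exp (- q) \<le> 1" by (simp add: exp_minus field_simps)
  moreover have "q * exp (- q) \<le> q * 1" using q by (intro mult_left_mono) auto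
  ultimately have qe: "0 \<le> q * exp (- q)" "q * exp (- q) \<le> min 1 q" using q by auto
  have "s * (1 - exp (- q)) \<le> 1 * min 1 q" using s e by (intro mult_mono) auto
  moreover have "0 \<le> s * (1 - exp (- q))" using s e by simp
  moreover have eq: "(2 * s - 2 * q) * exp (- q) - 2 * s = - (2 * (s * (1 - exp (- q)))) - 2 * (q * exp (- q))"
    by (simp add: algebra_simps)
  ultimately show "\<bar>(2 * s - 2 * q) * exp (- q) - 2 * s\<bar> \<le> 4 * min 1 q"
    unfolding eq using qe by linarith
  have "s * exp (- q) \<le> 1 * 1" using s q by (intro mult_mono) auto
  moreover have "0 \<le> s * exp (- q)" using s by simp
  moreover have "min 1 q \<le> 1" by simp
  moreover have "(2 * s - 2 * q) * exp (- q) = 2 * (s * exp (- q)) - 2 * (q * exp (- q))" by (simp add: algebra_simps)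
  ultimately show "\<bar>(2 * s - 2 * q) * exp (- q)\<bar> \<le> 4" using qe by linarith
qed

lemma quarter_square_powr:
  fixes z :: real
  assumes z: "0 < z"
  shows "(z\<^sup>2 / 4) powr (- \<sigma>) = 2 powr (2 * \<sigma>) / z powr (2 * \<sigma>)"
proof -
  have "z\<^sup>2 / 4 = (z / 2) powr 2" using z by (simp add: power_divide)
  then have "(z\<^sup>2 / 4) powr (- \<sigma>) = 1 / (z / 2) powr (2 * \<sigma>)" by (simp add: powr_powr powr_minus_divide)
  then show ?thesis using z by (simp add: powr_divide)
qed

lemma ext_const_pos: "0 < s \<Longrightarrow> 0 < ext_const s"
  by (simp add: ext_const_def Gamma_real_pos)

text \<open>The first value makes \<open>U\<close> an average of the semigroup. The other two masses
  belong to the derivative in \<open>z\<close>, where they occur with the factors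
  \<open>2 * s\<close> and \<open>- 1 / 2\<close> and cancel.\<close>

lemma integral_ext_weight:
  assumes "0 < z" "0 < s"
  shows "(LBINT \<tau>:{0<..}. ext_const s * weight (2 * s) (1 + s) \<tau> z) = 1"
    and "(LBINT \<tau>:{0<..}. ext_const s * weight (2 * s - 1) (1 + s) \<tau> z) = 1 / z"
    and "(LBINT \<tau>:{0<..}. ext_const s * weight (2 * s + 1) (1 + (1 + s)) \<tau> z) = 4 * s / z"
proof -
  have G: "Gamma s \<noteq> 0" using Gamma_real_pos[OF assms(2)] by linarith
  have w: "(LBINT \<tau>:{0<..}. ext_const s * weight \<alpha> (1 + \<sigma>) \<tau> z) = ext_const s * (z powr \<alpha> * (2 powr (2 * \<sigma>) / z powr (2 * \<sigma>)) * Gamma \<sigma>)"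
    if "0 < \<sigma>" for \<alpha> \<sigma>
    unfolding set_integral_mult_right integral_weight[OF assms(1) that] quarter_square_powr[OF assms(1)] ..
  show "(LBINT \<tau>:{0<..}. ext_const s * weight (2 * s) (1 + s) \<tau> z) = 1"
    unfolding w[OF assms(2)] using assms G by (simp add: ext_const_def)
  have "z powr (2 * s - 1) = z powr (2 * s) / z" using assms by (simp add: powr_diff)
  then show "(LBINT \<tau>:{0<..}. ext_const s * weight (2 * s - 1) (1 + s) \<tau> z) = 1 / z"
    unfolding w[OF assms(2)] using assms G by (simp add: ext_const_def)
  have "z powr (2 * s + 1) = z powr (2 * s) * z" "z powr (2 * (1 + s)) = z powr (2 * s) * z\<^sup>2"
    "2 powr (2 * (1 + s)) = (2::real) powr (2 * s) * 4" "Gamma (1 + s) = s * Gamma s"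
    using assms Gamma_plus1[of s] by (simp_all add: powr_add distrib_left add.commute nonpos_Ints_def)
  then show "(LBINT \<tau>:{0<..}. ext_const s * weight (2 * s + 1) (1 + (1 + s)) \<tau> z) = 4 * s / z"
    using assms G by (subst w) (simp_all add: ext_const_def power2_eq_square)
qed

section \<open>Superpositions of increments and the two limits\<close>

context kolmogorov
begin

lemma superposition_integrable:
  assumes v: "v \<in> schwartz" and k [measurable]: "k \<in> borel_measurable borel" and A: "0 \<le> A" and \<sigma>: "0 < \<sigma>" "\<sigma> < 1"
    and kb: "\<And>\<tau>. 0 < \<tau> \<Longrightarrow> \<bar>k \<tau>\<bar> \<le> A * \<tau> powr (- 1 - \<sigma>)"
    and C: "0 \<le> C" "\<And>\<tau> x. 0 < \<tau> \<Longrightarrow> \<bar>increment v \<tau> x\<bar> \<le> C * min 1 \<tau>"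
  shows "integrable lborel (\<lambda>\<tau>. k \<tau> * increment v \<tau> x)"
    and "norm (k \<tau> * increment v \<tau> x) \<le> C * A * riesz \<sigma> \<tau>"
proof -
  have [measurable]: "(\<lambda>\<tau>. increment v \<tau> x) \<in> borel_measurable borel"
    using measurable_compose[OF _ measurable_increment[OF v], of "\<lambda>\<tau>. (\<tau>, x)" borel]
    by (simp add: borel_measurable_continuous_onI continuous_intros)
  show b: "norm (k \<tau> * increment v \<tau> x) \<le> C * A * riesz \<sigma> \<tau>" for \<tau>
  proof (cases "0 < \<tau>")
    case True
    have "\<bar>k \<tau>\<bar> * \<bar>increment v \<tau> x\<bar> \<le> (A * \<tau> powr (- 1 - \<sigma>)) * (C * min 1 \<tau>)"
      using True A C by (intro mult_mono kb C) auto
    then show ?thesis using True by (simp add: riesz_def abs_mult mult_ac)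
  qed (simp add: increment_def riesz_def)
  show "integrable lborel (\<lambda>\<tau>. k \<tau> * increment v \<tau> x)"
  proof (rule Bochner_Integration.integrable_bound[OF integrable_mult_right[OF integrable_riesz[OF \<sigma>]]])
    show "AE \<tau> in lborel. norm (k \<tau> * increment v \<tau> x) \<le> norm (C * A * riesz \<sigma> \<tau>)"
      by (rule AE_I2, rule order_trans[OF b]) simp
  qed measurable
qed

lemma superposition_measurable:
  assumes v: "v \<in> schwartz" and k [measurable]: "k \<in> borel_measurable borel"
  shows "(\<lambda>x. LINT \<tau>|lborel. k \<tau> * increment v \<tau> x) \<in> borel_measurable lborel"
    and "(\<lambda>q. k (snd q) * increment v (snd q) (fst q)) \<in> borel_measurable borel"
proof -
  have [measurable]: "(\<lambda>q. increment v (snd q) (fst q)) \<in> borel_measurable borel"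
    using measurable_compose[OF _ measurable_increment[OF v], of "\<lambda>q. (snd q, fst q)" borel]
    by (simp add: borel_measurable_continuous_onI continuous_intros)
  show m: "(\<lambda>q. k (snd q) * increment v (snd q) (fst q)) \<in> borel_measurable borel" by measurable
  then have "(\<lambda>(x, \<tau>). k \<tau> * increment v \<tau> x) \<in> borel_measurable (lborel \<Otimes>\<^sub>M lborel)"
    by (simp add: lborel_prod case_prod_beta')
  then show "(\<lambda>x. LINT \<tau>|lborel. k \<tau> * increment v \<tau> x) \<in> borel_measurable lborel"
    by (rule lborel.borel_measurable_lebesgue_integral)
qed

text \<open>\<open>C\<close> depends on \<open>v\<close> alone. The estimate is thus uniform over
  kernels and over \<open>p\<close>, and for a kernel that depends on \<open>z\<close> the rate can
  be read off \<open>A\<close>.\<close>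

lemma superposition_Lp_bound:
  assumes v: "v \<in> schwartz"
  obtains C where "C \<ge> 0"
    "\<And>k A \<sigma> p. k \<in> borel_measurable borel \<Longrightarrow> 0 \<le> A \<Longrightarrow> 0 < \<sigma> \<Longrightarrow> \<sigma> < 1 \<Longrightarrow>
      (\<And>\<tau>. 0 < \<tau> \<Longrightarrow> \<bar>k \<tau>\<bar> \<le> A * \<tau> powr (- 1 - \<sigma>)) \<Longrightarrow> 1 \<le> p \<Longrightarrow>
      Lp_norm p (\<lambda>x. LINT \<tau>|lborel. k \<tau> * increment v \<tau> x) \<le> ennreal (C * A * (LINT \<tau>|lborel. riesz \<sigma> \<tau>))"
    "\<And>k A \<sigma> x. k \<in> borel_measurable borel \<Longrightarrow> 0 \<le> A \<Longrightarrow> 0 < \<sigma> \<Longrightarrow> \<sigma> < 1 \<Longrightarrow>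
      (\<And>\<tau>. 0 < \<tau> \<Longrightarrow> \<bar>k \<tau>\<bar> \<le> A * \<tau> powr (- 1 - \<sigma>)) \<Longrightarrow> integrable lborel (\<lambda>\<tau>. k \<tau> * increment v \<tau> x)"
proof -
  obtain C where C: "C \<ge> 0" "\<And>\<tau> x. 0 < \<tau> \<Longrightarrow> \<bar>increment v \<tau> x\<bar> \<le> C * min 1 \<tau>"
    "\<And>\<tau>. 0 < \<tau> \<Longrightarrow> (\<integral>\<^sup>+x. ennreal \<bar>increment v \<tau> x\<bar> \<partial>lborel) \<le> ennreal (C * min 1 \<tau>)"
    using increment_bounds[OF v] by metis
  show ?thesis
  proof (rule that[OF C(1)])
    fix k :: "real \<Rightarrow> real" and A \<sigma> x
    assume hyps: "k \<in> borel_measurable borel" "0 \<le> A" "0 < \<sigma>" "\<sigma> < 1" "\<And>\<tau>. 0 < \<tau> \<Longrightarrow> \<bar>k \<tau>\<bar> \<le> A * \<tau> powr (- 1 - \<sigma>)"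
    show "integrable lborel (\<lambda>\<tau>. k \<tau> * increment v \<tau> x)"
      by (rule superposition_integrable(1)[OF v hyps C(1,2)])
  next
    fix k :: "real \<Rightarrow> real" and A \<sigma> p
    assume hyps: "k \<in> borel_measurable borel" "0 \<le> A" "0 < \<sigma>" "\<sigma> < 1" "\<And>\<tau>. 0 < \<tau> \<Longrightarrow> \<bar>k \<tau>\<bar> \<le> A * \<tau> powr (- 1 - \<sigma>)"
      and p: "(1::real) \<le> p"
    note [measurable] = hyps(1)
    define J where "J = C * A * (LINT \<tau>|lborel. riesz \<sigma> \<tau>)"
    note int = superposition_integrable(1)[OF v hyps C(1,2)] and bd = superposition_integrable(2)[OF v hyps C(1,2)]
    have ir: "integrable lborel (\<lambda>\<tau>. C * A * riesz \<sigma> \<tau>)" by (intro integrable_mult_right integrable_riesz hyps)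
    have nn: "0 \<le> C * A * riesz \<sigma> \<tau>" for \<tau> using C(1) hyps(2) by (simp add: riesz_nonneg)
    have J: "J = (LINT \<tau>|lborel. C * A * riesz \<sigma> \<tau>)" by (simp add: J_def)
    have J0: "0 \<le> J" unfolding J by (intro integral_nonneg_AE AE_I2 nn)
    show "Lp_norm p (\<lambda>x. LINT \<tau>|lborel. k \<tau> * increment v \<tau> x) \<le> ennreal (C * A * (LINT \<tau>|lborel. riesz \<sigma> \<tau>))"
      unfolding J_def[symmetric]
    proof (rule Lp_norm_le_interpolation[OF superposition_measurable(1)[OF v hyps(1)] J0 _ _ p])
      fix x
      have "\<bar>LINT \<tau>|lborel. k \<tau> * increment v \<tau> x\<bar> \<le> (LINT \<tau>|lborel. norm (k \<tau> * increment v \<tau> x))"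
        unfolding real_norm_def[symmetric] by (rule integral_norm_bound)
      also have "\<dots> \<le> J" unfolding J by (rule integral_mono'[OF ir bd nn])
      finally show "\<bar>LINT \<tau>|lborel. k \<tau> * increment v \<tau> x\<bar> \<le> J" .
    next
      have "(\<integral>\<^sup>+x. ennreal \<bar>LINT \<tau>|lborel. k \<tau> * increment v \<tau> x\<bar> \<partial>lborel)
        \<le> (\<integral>\<^sup>+x. \<integral>\<^sup>+\<tau>. ennreal (norm (k \<tau> * increment v \<tau> x)) \<partial>lborel \<partial>lborel)"
        unfolding real_norm_def[symmetric] by (intro nn_integral_mono integral_norm_bound_ennreal int)
      also have "\<dots> = (\<integral>\<^sup>+\<tau>. \<integral>\<^sup>+x. ennreal (norm (k \<tau> * increment v \<tau> x)) \<partial>lborel \<partial>lborel)"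
      proof (rule lborel_pair.Fubini'[symmetric])
        have "(\<lambda>q. ennreal (norm (k (snd q) * increment v (snd q) (fst q)))) \<in> borel_measurable borel"
          using superposition_measurable(2)[OF v hyps(1)] by measurable
        then show "(\<lambda>(x, \<tau>). ennreal (norm (k \<tau> * increment v \<tau> x))) \<in> borel_measurable (lborel \<Otimes>\<^sub>M lborel)"
          by (simp add: lborel_prod case_prod_beta')
      qed
      also have "\<dots> \<le> (\<integral>\<^sup>+\<tau>. ennreal (C * A * riesz \<sigma> \<tau>) \<partial>lborel)"
      proof (rule nn_integral_mono)
        fix \<tau> :: real
        have [measurable]: "increment v \<tau> \<in> borel_measurable borel"
          using measurable_compose[OF _ measurable_increment[OF v], of "\<lambda>x. (\<tau>, x)" borel]
          by (simp add: borel_measurable_continuous_onI continuous_intros)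
        show "(\<integral>\<^sup>+x. ennreal (norm (k \<tau> * increment v \<tau> x)) \<partial>lborel) \<le> ennreal (C * A * riesz \<sigma> \<tau>)"
        proof (cases "0 < \<tau>")
          case True
          have "(\<integral>\<^sup>+x. ennreal (norm (k \<tau> * increment v \<tau> x)) \<partial>lborel) = ennreal \<bar>k \<tau>\<bar> * (\<integral>\<^sup>+x. ennreal \<bar>increment v \<tau> x\<bar> \<partial>lborel)"
            by (simp add: abs_mult ennreal_mult nn_integral_cmult)
          also have "\<dots> \<le> ennreal (A * \<tau> powr (- 1 - \<sigma>)) * ennreal (C * min 1 \<tau>)"
            by (intro mult_mono ennreal_leI hyps(5) C(3) True) auto
          also have "\<dots> = ennreal (C * A * riesz \<sigma> \<tau>)"
            using True hyps(2) C(1) by (simp add: riesz_def ennreal_mult[symmetric] mult_ac)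
          finally show ?thesis .
        qed (simp add: increment_def)
      qed
      also have "\<dots> = ennreal J" unfolding J by (intro nn_integral_eq_integral ir AE_I2 nn)
      finally show "(\<integral>\<^sup>+x. ennreal \<bar>LINT \<tau>|lborel. k \<tau> * increment v \<tau> x\<bar> \<partial>lborel) \<le> ennreal J" .
    qed
  qed
qed

text \<open>The semigroup is the identity plus the increment, and the identity part collects the
  mass of \<open>k\<close>.\<close>

lemma superposition_split:
  assumes k: "set_integrable lborel {0<..} k" and i: "integrable lborel (\<lambda>\<tau>. k \<tau> * increment v \<tau> x)"
  shows "(LBINT \<tau>:{0<..}. k \<tau> * evol_semigroup Q B \<tau> v x) = (LINT \<tau>|lborel. k \<tau> * increment v \<tau> x) + (LBINT \<tau>:{0<..}. k \<tau>) * v x"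
proof -
  have "indicator {0<..} \<tau> *\<^sub>R (k \<tau> * evol_semigroup Q B \<tau> v x) = k \<tau> * increment v \<tau> x + (indicator {0<..} \<tau> *\<^sub>R k \<tau>) * v x" for \<tau>
    by (simp add: increment_def indicator_def algebra_simps)
  then show ?thesis
    using k i by (simp add: set_lebesgue_integral_def set_integrable_def)
qed

lemma weight_le:
  assumes "0 < z" "0 < \<tau>"
  shows "weight \<alpha> \<beta> \<tau> z \<le> z powr \<alpha> * \<tau> powr (- \<beta>)"
  using assms by (simp add: weight_def mult_left_le)

text \<open>Mass 1 removes \<open>v\<close>. Dropping the exponential bounds the kernel by a
  multiple of \<open>z powr (2 * s) * \<tau> powr (- 1 - s)\<close>, and the first factor is the
  rate.\<close>

lemma extension_Lp_limit:
  assumes v: "v \<in> schwartz" and s: "0 < s" "s < 1" and p: "1 \<le> p"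
    and U: "\<And>x z. 0 < z \<Longrightarrow> U (x, z) = (LBINT \<tau>:{0<..}. ext_const s * weight (2 * s) (1 + s) \<tau> z * evol_semigroup Q B \<tau> v x)"
  shows "((\<lambda>z. Lp_norm p (\<lambda>x. U (x, z) - v x)) \<longlongrightarrow> 0) (at_right 0)"
proof -
  obtain C where C: "C \<ge> 0" and Lp: "\<And>k A \<sigma> p. k \<in> borel_measurable borel \<Longrightarrow> 0 \<le> A \<Longrightarrow> 0 < \<sigma> \<Longrightarrow> \<sigma> < 1 \<Longrightarrow>
      (\<And>\<tau>. 0 < \<tau> \<Longrightarrow> \<bar>k \<tau>\<bar> \<le> A * \<tau> powr (- 1 - \<sigma>)) \<Longrightarrow> 1 \<le> p \<Longrightarrow>
      Lp_norm p (\<lambda>x. LINT \<tau>|lborel. k \<tau> * increment v \<tau> x) \<le> ennreal (C * A * (LINT \<tau>|lborel. riesz \<sigma> \<tau>))"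
    and int: "\<And>k A \<sigma> x. k \<in> borel_measurable borel \<Longrightarrow> 0 \<le> A \<Longrightarrow> 0 < \<sigma> \<Longrightarrow> \<sigma> < 1 \<Longrightarrow>
      (\<And>\<tau>. 0 < \<tau> \<Longrightarrow> \<bar>k \<tau>\<bar> \<le> A * \<tau> powr (- 1 - \<sigma>)) \<Longrightarrow> integrable lborel (\<lambda>\<tau>. k \<tau> * increment v \<tau> x)"
    using superposition_Lp_bound[OF v] by blast
  note c = ext_const_pos[OF s(1)]
  show ?thesis
  proof (rule tendsto_0_powr_bound[of "2 * s" _ "C * ext_const s * (LINT \<tau>|lborel. riesz s \<tau>)"])
    fix z :: real assume z: "0 < z"
    define k where "k \<tau> = ext_const s * weight (2 * s) (1 + s) \<tau> z" for \<tau>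
    have k [measurable]: "k \<in> borel_measurable borel" unfolding k_def by measurable
    have A: "0 \<le> ext_const s * z powr (2 * s)" using c by simp
    have kb: "\<bar>k \<tau>\<bar> \<le> ext_const s * z powr (2 * s) * \<tau> powr (- 1 - s)" if "0 < \<tau>" for \<tau>
      using weight_le[OF z that, of "2 * s" "1 + s"] c by (simp add: k_def abs_mult weight_nonneg mult.assoc)
    have "set_integrable lborel {0<..} k"
      unfolding k_def using set_integrable_weight[OF z s(1)] by (rule set_integrable_mult_right)
    note spl = superposition_split[OF this int[OF k A s kb]]
    have I: "(LBINT \<tau>:{0<..}. k \<tau>) = 1" unfolding k_def[abs_def] by (rule integral_ext_weight(1)[OF z s(1)])
    have "U (x, z) - v x = (LINT \<tau>|lborel. k \<tau> * increment v \<tau> x)" for x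
    proof -
      have "U (x, z) = (LBINT \<tau>:{0<..}. k \<tau> * evol_semigroup Q B \<tau> v x)" by (simp only: U[OF z] k_def)
      also have "\<dots> = (LINT \<tau>|lborel. k \<tau> * increment v \<tau> x) + 1 * v x"
        using spl[of x] by (simp only: I)
      finally show ?thesis by simp
    qed
    then show "Lp_norm p (\<lambda>x. U (x, z) - v x) \<le> ennreal (C * ext_const s * (LINT \<tau>|lborel. riesz s \<tau>) * z powr (2 * s))"
      using Lp[OF k A s kb p] by (simp add: mult_ac)
  qed (use s in simp)
qed

text \<open>The derivative in \<open>z\<close> has the kernel
  \<open>2 * s * k1 \<tau> - k2 \<tau> / 2\<close>, whose mass is zero, so the semigroup may be
  replaced by its increment. The factor \<open>z powr (1 - 2 * s)\<close> then leaves dependence on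
  \<open>z\<close> only through \<open>z\<^sup>2 / (4 * \<tau>)\<close>.\<close>

lemma extension_normal_derivative:
  assumes v: "v \<in> schwartz" and s: "0 < s" "s < 1" and z: "0 < z"
    and U: "\<And>x z. 0 < z \<Longrightarrow> U (x, z) = (LBINT \<tau>:{0<..}. ext_const s * weight (2 * s) (1 + s) \<tau> z * evol_semigroup Q B \<tau> v x)"
  shows "z powr (1 - 2 * s) * deriv (\<lambda>\<zeta>. U (x, \<zeta>)) z =
    (LINT \<tau>|lborel. ext_const s * \<tau> powr (- 1 - s) * ((2 * s - 2 * (z\<^sup>2 / (4 * \<tau>))) * exp (- (z\<^sup>2 / (4 * \<tau>)))) * increment v \<tau> x)"
proof -
  obtain X t where x: "x = (X, t)" by (cases x)
  define \<kappa> where "\<kappa> = complex_of_real (ext_const s / (2 * pi) ^ CARD('n))"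
  have s1: "0 \<le> 1 + s" "0 \<le> 1 + (1 + s)" using s by auto
  note c = ext_const_pos[OF s(1)]
  have Uw: "U (x, z) = Re (\<kappa> * wave (2 * s) (1 + s) [] v (x, z))" if "0 < z" for z
    unfolding U[OF that] x \<kappa>_def by (rule semigroup_eq_wave[OF v that s1(1)])
  define k1 where "k1 \<tau> = ext_const s * weight (2 * s - 1) (1 + s) \<tau> z" for \<tau>
  define k2 where "k2 \<tau> = ext_const s * weight (2 * s + 1) (1 + (1 + s)) \<tau> z" for \<tau>
  have [measurable]: "k1 \<in> borel_measurable borel" "k2 \<in> borel_measurable borel"
    unfolding k1_def k2_def by measurable
  obtain C :: real where int: "\<And>k A \<sigma> x. k \<in> borel_measurable borel \<Longrightarrow> 0 \<le> A \<Longrightarrow> 0 < \<sigma> \<Longrightarrow> \<sigma> < 1 \<Longrightarrow>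
      (\<And>\<tau>. 0 < \<tau> \<Longrightarrow> \<bar>k \<tau>\<bar> \<le> A * \<tau> powr (- 1 - \<sigma>)) \<Longrightarrow> integrable lborel (\<lambda>\<tau>. k \<tau> * increment v \<tau> x)"
    using superposition_Lp_bound[OF v] by blast
  have i1: "integrable lborel (\<lambda>\<tau>. k1 \<tau> * increment v \<tau> x)"
  proof (rule int[OF _ _ s])
    show "\<bar>k1 \<tau>\<bar> \<le> ext_const s * z powr (2 * s - 1) * \<tau> powr (- 1 - s)" if "0 < \<tau>" for \<tau>
      using weight_le[OF z that, of "2 * s - 1" "1 + s"] c by (simp add: k1_def abs_mult weight_nonneg mult.assoc)
  qed (use c in auto)
  have i2: "integrable lborel (\<lambda>\<tau>. k2 \<tau> * increment v \<tau> x)"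
  proof (rule int[OF _ _ s])
    \<comment> \<open>Since \<open>q * exp (- q) \<le> 1\<close>, the surplus factor
      \<open>1 / \<tau>\<close> is exchanged for \<open>4 / z\<^sup>2\<close>, a constant at fixed
      \<open>z\<close>.\<close>
    show "\<bar>k2 \<tau>\<bar> \<le> ext_const s * z powr (2 * s + 1) * (4 / z\<^sup>2) * \<tau> powr (- 1 - s)" if \<tau>: "0 < \<tau>" for \<tau>
    proof -
      define q where "q = z\<^sup>2 / (4 * \<tau>)"
      have q: "0 < q" using z \<tau> by (simp add: q_def)
      have "q \<le> exp q" using exp_ge_add_one_self[of q] by linarith
      then have "q * exp (- q) \<le> 1" by (simp add: exp_minus field_simps)
      then have "1 / \<tau> * exp (- q) \<le> 4 / z\<^sup>2" using z \<tau> by (simp add: q_def field_simps)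
      moreover have "\<tau> powr (- (1 + (1 + s))) = \<tau> powr (- 1 - s) * (1 / \<tau>)"
        using \<tau> powr_diff[of \<tau> "- 1 - s" 1] by (simp add: algebra_simps)
      ultimately have "\<tau> powr (- (1 + (1 + s))) * exp (- q) \<le> \<tau> powr (- 1 - s) * (4 / z\<^sup>2)"
        by (simp only: mult.assoc) (intro mult_left_mono, auto)
      then have "weight (2 * s + 1) (1 + (1 + s)) \<tau> z \<le> z powr (2 * s + 1) * (\<tau> powr (- 1 - s) * (4 / z\<^sup>2))"
        unfolding weight_def mult.assoc by (intro mult_left_mono) (auto simp: q_def)
      from mult_left_mono[OF this, of "ext_const s"] show ?thesis
        using c by (simp add: k2_def abs_mult weight_nonneg mult_ac)
    qed
  qed (use c in auto)
  have si: "set_integrable lborel {0<..} k1" "set_integrable lborel {0<..} k2"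
    unfolding k1_def k2_def using s by (intro set_integrable_mult_right set_integrable_weight z; simp)+
  have I1: "(LBINT \<tau>:{0<..}. k1 \<tau>) = 1 / z" unfolding k1_def[abs_def] by (rule integral_ext_weight(2)[OF z s(1)])
  have I2: "(LBINT \<tau>:{0<..}. k2 \<tau>) = 4 * s / z"
    using integral_ext_weight(3)[OF z s(1)] unfolding k2_def[abs_def] by (simp add: add.assoc)
  have "deriv (\<lambda>\<zeta>. U (x, \<zeta>)) z = deriv (\<lambda>\<zeta>. Re (\<kappa> * wave (2 * s) (1 + s) [] v (x, \<zeta>))) z"
    using eventually_nhds_in_open[of "{0<..}" z] z by (intro deriv_cong_ev refl) (auto elim!: eventually_mono simp: Uw)
  also have "\<dots> = Re (\<kappa> * (of_real (2 * s) * wave (2 * s - 1) (1 + s) [] v (x, z) - wave (2 * s + 1) (1 + s + 1) [] v (x, z) / 2))"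
    by (intro DERIV_imp_deriv wave_ext_deriv v s1 z) simp
  also have "\<dots> = 2 * s * Re (\<kappa> * wave (2 * s - 1) (1 + s) [] v (x, z)) - Re (\<kappa> * wave (2 * s + 1) (1 + (1 + s)) [] v (x, z)) / 2"
    by (simp add: algebra_simps)
  also have "Re (\<kappa> * wave (2 * s - 1) (1 + s) [] v (x, z)) = (LBINT \<tau>:{0<..}. k1 \<tau> * evol_semigroup Q B \<tau> v x)"
    unfolding x \<kappa>_def k1_def by (rule semigroup_eq_wave[OF v z s1(1), symmetric])
  also have "Re (\<kappa> * wave (2 * s + 1) (1 + (1 + s)) [] v (x, z)) = (LBINT \<tau>:{0<..}. k2 \<tau> * evol_semigroup Q B \<tau> v x)"
    unfolding x \<kappa>_def k2_def by (rule semigroup_eq_wave[OF v z s1(2), symmetric])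
  also have "2 * s * (LBINT \<tau>:{0<..}. k1 \<tau> * evol_semigroup Q B \<tau> v x) - (LBINT \<tau>:{0<..}. k2 \<tau> * evol_semigroup Q B \<tau> v x) / 2
     = 2 * s * (LINT \<tau>|lborel. k1 \<tau> * increment v \<tau> x) - (LINT \<tau>|lborel. k2 \<tau> * increment v \<tau> x) / 2"
    by (simp only: superposition_split[OF si(1) i1] superposition_split[OF si(2) i2] I1 I2) (simp add: algebra_simps)
  finally have "z powr (1 - 2 * s) * deriv (\<lambda>\<zeta>. U (x, \<zeta>)) z
     = (LINT \<tau>|lborel. z powr (1 - 2 * s) * (2 * s * (k1 \<tau> * increment v \<tau> x) - k2 \<tau> * increment v \<tau> x / 2))"
    using i1 i2 by simp
  also have "\<dots> = (LINT \<tau>|lborel. ext_const s * \<tau> powr (- 1 - s) * ((2 * s - 2 * (z\<^sup>2 / (4 * \<tau>))) * exp (- (z\<^sup>2 / (4 * \<tau>)))) * increment v \<tau> x)"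
  proof (rule Bochner_Integration.integral_cong[OF refl])
    fix \<tau> :: real
    show "z powr (1 - 2 * s) * (2 * s * (k1 \<tau> * increment v \<tau> x) - k2 \<tau> * increment v \<tau> x / 2)
      = ext_const s * \<tau> powr (- 1 - s) * ((2 * s - 2 * (z\<^sup>2 / (4 * \<tau>))) * exp (- (z\<^sup>2 / (4 * \<tau>)))) * increment v \<tau> x"
    proof (cases "0 < \<tau>")
      case True
      have "z powr (1 - 2 * s) * z powr (2 * s - 1) = 1" using z by (simp flip: powr_add)
      then have 1: "z powr (1 - 2 * s) * k1 \<tau> = ext_const s * \<tau> powr (- 1 - s) * exp (- (z\<^sup>2 / (4 * \<tau>)))"
        by (simp add: k1_def weight_def flip: mult.assoc)
      have "z powr (1 - 2 * s) * z powr (2 * s + 1) = z\<^sup>2" using z by (simp flip: powr_add)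
      moreover have "\<tau> powr (- (1 + (1 + s))) = \<tau> powr (- 1 - s) * (1 / \<tau>)"
        using True powr_diff[of \<tau> "- 1 - s" 1] by (simp add: algebra_simps)
      ultimately have 2: "z powr (1 - 2 * s) * k2 \<tau> = ext_const s * \<tau> powr (- 1 - s) * (4 * (z\<^sup>2 / (4 * \<tau>))) * exp (- (z\<^sup>2 / (4 * \<tau>)))"
        unfolding k2_def weight_def by (simp only:) (simp add: mult_ac)
      have "z powr (1 - 2 * s) * (2 * s * (k1 \<tau> * increment v \<tau> x) - k2 \<tau> * increment v \<tau> x / 2)
        = (2 * s * (z powr (1 - 2 * s) * k1 \<tau>) - (z powr (1 - 2 * s) * k2 \<tau>) / 2) * increment v \<tau> x"
        by (simp add: algebra_simps)
      then show ?thesis unfolding 1 2 by (simp add: algebra_simps)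
    qed (simp add: increment_def)
  qed
  finally show ?thesis .
qed

text \<open>The kernel \<open>k z\<close> differs from its limit \<open>k0\<close> by at most a
  multiple of \<open>min 1 q * \<tau> powr (- 1 - s)\<close> with
  \<open>q = z\<^sup>2 / (4 * \<tau>)\<close>. Replacing \<open>min 1 q\<close> by
  \<open>q powr \<delta>\<close> turns part of the room between \<open>s\<close> and 1 into the rate
  \<open>z powr (2 * \<delta>)\<close>.\<close>

lemma extension_Neumann_limit:
  assumes v: "v \<in> schwartz" and s: "0 < s" "s < 1" and p: "1 \<le> p"
    and U: "\<And>x z. 0 < z \<Longrightarrow> U (x, z) = (LBINT \<tau>:{0<..}. ext_const s * weight (2 * s) (1 + s) \<tau> z * evol_semigroup Q B \<tau> v x)"
  shows "Lp_tendsto p (\<lambda>z x. z powr (1 - 2 * s) * deriv (\<lambda>\<zeta>. U (x, \<zeta>)) z)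
    (\<lambda>x. 2 * s * ext_const s * (LBINT \<tau>:{0<..}. \<tau> powr (- 1 - s) * (evol_semigroup Q B \<tau> v x - v x))) (at_right 0)"
proof -
  obtain C where C: "C \<ge> 0" and Lp: "\<And>k A \<sigma> p. k \<in> borel_measurable borel \<Longrightarrow> 0 \<le> A \<Longrightarrow> 0 < \<sigma> \<Longrightarrow> \<sigma> < 1 \<Longrightarrow>
      (\<And>\<tau>. 0 < \<tau> \<Longrightarrow> \<bar>k \<tau>\<bar> \<le> A * \<tau> powr (- 1 - \<sigma>)) \<Longrightarrow> 1 \<le> p \<Longrightarrow>
      Lp_norm p (\<lambda>x. LINT \<tau>|lborel. k \<tau> * increment v \<tau> x) \<le> ennreal (C * A * (LINT \<tau>|lborel. riesz \<sigma> \<tau>))"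
    and int: "\<And>k A \<sigma> x. k \<in> borel_measurable borel \<Longrightarrow> 0 \<le> A \<Longrightarrow> 0 < \<sigma> \<Longrightarrow> \<sigma> < 1 \<Longrightarrow>
      (\<And>\<tau>. 0 < \<tau> \<Longrightarrow> \<bar>k \<tau>\<bar> \<le> A * \<tau> powr (- 1 - \<sigma>)) \<Longrightarrow> integrable lborel (\<lambda>\<tau>. k \<tau> * increment v \<tau> x)"
    using superposition_Lp_bound[OF v] by blast
  note c = ext_const_pos[OF s(1)]
  define k where "k z \<tau> = ext_const s * \<tau> powr (- 1 - s) * ((2 * s - 2 * (z\<^sup>2 / (4 * \<tau>))) * exp (- (z\<^sup>2 / (4 * \<tau>))))" for z \<tau>
  define k0 where "k0 \<tau> = ext_const s * \<tau> powr (- 1 - s) * (2 * s)" for \<tau>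
  have km [measurable]: "k z \<in> borel_measurable borel" "k0 \<in> borel_measurable borel" for z
    unfolding k_def k0_def by measurable
  have A: "0 \<le> 4 * ext_const s" using c by simp
  have kb: "\<bar>k z \<tau>\<bar> \<le> 4 * ext_const s * \<tau> powr (- 1 - s)" if "0 < z" "0 < \<tau>" for z \<tau>
  proof -
    have "\<bar>k z \<tau>\<bar> \<le> ext_const s * \<tau> powr (- 1 - s) * 4"
      unfolding k_def abs_mult[of "ext_const s * _"]
      using c that neumann_profile_bounds(2)[OF s, of "z\<^sup>2 / (4 * \<tau>)"] by (intro mult_mono) (auto simp: abs_mult)
    then show ?thesis by (simp add: mult_ac)
  qed
  have k0b: "\<bar>k0 \<tau>\<bar> \<le> 4 * ext_const s * \<tau> powr (- 1 - s)" if "0 < \<tau>" for \<tau>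
  proof -
    have "ext_const s * \<tau> powr (- 1 - s) * (2 * s) \<le> ext_const s * \<tau> powr (- 1 - s) * 4"
      using c s by (intro mult_left_mono) auto
    then show ?thesis using c s by (simp add: k0_def abs_mult mult_ac)
  qed
  define L where "L x = (LINT \<tau>|lborel. k0 \<tau> * increment v \<tau> x)" for x
  have L: "2 * s * ext_const s * (LBINT \<tau>:{0<..}. \<tau> powr (- 1 - s) * (evol_semigroup Q B \<tau> v x - v x)) = L x" for x
  proof -
    have "k0 \<tau> * increment v \<tau> x = (2 * s * ext_const s) * (indicator {0<..} \<tau> *\<^sub>R (\<tau> powr (- 1 - s) * (evol_semigroup Q B \<tau> v x - v x)))" for \<tau>
      by (simp add: k0_def increment_def indicator_def)
    then show ?thesis by (simp only: L_def set_lebesgue_integral_def integral_mult_right_zero)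
  qed
  have D: "z powr (1 - 2 * s) * deriv (\<lambda>\<zeta>. U (x, \<zeta>)) z = (LINT \<tau>|lborel. k z \<tau> * increment v \<tau> x)" if "0 < z" for z x
    unfolding k_def by (rule extension_normal_derivative[OF v s that U])
  \<comment> \<open>Half the distance from \<open>s\<close> to 1: \<open>s + \<delta>\<close> stays
    below 1, where \<open>riesz\<close> is integrable, and \<open>\<delta>\<close> is
    positive.\<close>
  define \<delta> where "\<delta> = (1 - s) / 2"
  have \<delta>: "0 < \<delta>" "\<delta> \<le> 1" "0 < s + \<delta>" "s + \<delta> < 1" using s by (auto simp: \<delta>_def field_simps)
  show ?thesis
    unfolding Lp_tendsto_def L
  proof (intro conjI)
    have "(\<lambda>x. LINT \<tau>|lborel. k z \<tau> * increment v \<tau> x) \<in> Lp_space p" if "0 < z" for z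
      unfolding Lp_space_def
      using superposition_measurable(1)[OF v km(1)] Lp[OF km(1) A s kb[OF that] p] by (auto intro: le_less_trans)
    then have "(\<lambda>x. z powr (1 - 2 * s) * deriv (\<lambda>\<zeta>. U (x, \<zeta>)) z) \<in> Lp_space p" if "0 < z" for z
      using that by (simp add: D)
    then show "\<forall>\<^sub>F z in at_right 0. (\<lambda>x. z powr (1 - 2 * s) * deriv (\<lambda>\<zeta>. U (x, \<zeta>)) z) \<in> Lp_space p"
      by (auto simp: eventually_at_right_field intro!: exI[of _ 1])
    show "L \<in> Lp_space p"
      unfolding Lp_space_def L_def[abs_def]
      using superposition_measurable(1)[OF v km(2)] Lp[OF km(2) A s k0b p] by (auto intro: le_less_trans)
    show "((\<lambda>z. Lp_norm p (\<lambda>x. z powr (1 - 2 * s) * deriv (\<lambda>\<zeta>. U (x, \<zeta>)) z - L x)) \<longlongrightarrow> 0) (at_right 0)"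
    proof (rule tendsto_0_powr_bound[of "2 * \<delta>" _ "C * (4 * ext_const s) * (LINT \<tau>|lborel. riesz (s + \<delta>) \<tau>)"])
      fix z :: real assume z: "0 < z"
      define d where "d \<tau> = k z \<tau> - k0 \<tau>" for \<tau>
      have d [measurable]: "d \<in> borel_measurable borel" unfolding d_def by measurable
      have db: "\<bar>d \<tau>\<bar> \<le> (4 * ext_const s * z powr (2 * \<delta>)) * \<tau> powr (- 1 - (s + \<delta>))" if \<tau>: "0 < \<tau>" for \<tau>
      proof -
        define q where "q = z\<^sup>2 / (4 * \<tau>)"
        have q: "0 < q" using z \<tau> by (simp add: q_def)
        have "q \<le> z\<^sup>2 / \<tau>" using z \<tau> by (simp add: q_def field_simps)
        then have "q powr \<delta> \<le> (z\<^sup>2 / \<tau>) powr \<delta>" using q \<delta> by (intro powr_mono2) auto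
        also have "\<dots> = z powr (2 * \<delta>) * \<tau> powr (- \<delta>)"
        proof -
          have "z\<^sup>2 = z powr 2" using z by simp
          then have "(z\<^sup>2) powr \<delta> = z powr (2 * \<delta>)" by (simp only: powr_powr)
          then show ?thesis using z \<tau> by (simp add: powr_divide powr_minus_divide)
        qed
        finally have qd: "q powr \<delta> \<le> z powr (2 * \<delta>) * \<tau> powr (- \<delta>)" .
        have "d \<tau> = ext_const s * \<tau> powr (- 1 - s) * ((2 * s - 2 * q) * exp (- q) - 2 * s)"
          unfolding d_def k_def k0_def q_def by (simp only: right_diff_distrib)
        then have "\<bar>d \<tau>\<bar> = ext_const s * \<tau> powr (- 1 - s) * \<bar>(2 * s - 2 * q) * exp (- q) - 2 * s\<bar>"
          using c by (simp add: abs_mult)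
        also have "\<dots> \<le> ext_const s * \<tau> powr (- 1 - s) * (4 * (z powr (2 * \<delta>) * \<tau> powr (- \<delta>)))"
          using c neumann_profile_bounds(1)[OF s q] min_le_powr[OF q \<delta>(1,2)] qd by (intro mult_left_mono) auto
        also have "\<dots> = (4 * ext_const s * z powr (2 * \<delta>)) * (\<tau> powr (- 1 - s) * \<tau> powr (- \<delta>))" by (simp add: mult_ac)
        also have "\<tau> powr (- 1 - s) * \<tau> powr (- \<delta>) = \<tau> powr (- 1 - (s + \<delta>))" by (simp add: algebra_simps flip: powr_add)
        finally show ?thesis .
      qed
      have "z powr (1 - 2 * s) * deriv (\<lambda>\<zeta>. U (x, \<zeta>)) z - L x = (LINT \<tau>|lborel. d \<tau> * increment v \<tau> x)" for x
        unfolding D[OF z] L_def d_def left_diff_distrib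
        by (rule Bochner_Integration.integral_diff[symmetric, OF int[OF km(1) A s kb[OF z]] int[OF km(2) A s k0b]])
      moreover have "0 \<le> 4 * ext_const s * z powr (2 * \<delta>)" using c by simp
      ultimately show "Lp_norm p (\<lambda>x. z powr (1 - 2 * s) * deriv (\<lambda>\<zeta>. U (x, \<zeta>)) z - L x)
          \<le> ennreal (C * (4 * ext_const s) * (LINT \<tau>|lborel. riesz (s + \<delta>) \<tau>) * z powr (2 * \<delta>))"
        using Lp[OF d _ \<delta>(3,4) db p] by (simp add: mult_ac)
    qed (use \<delta> in simp)
  qed
qed

end

theorem theorem4p2:
  fixes s a :: real
    and Q B :: "real^'n^'n"
    and u :: "(real^'n) \<times> real \<Rightarrow> real"
    and U :: "((real^'n) \<times> real) \<times> real \<Rightarrow> real"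
  assumes "0 < s" and "s < 1" and "a = 1 - 2 * s"
    and "transpose Q = Q" and "pos_semidef Q"
    and "\<And>t. t > 0 \<Longrightarrow> pos_def (K_mat Q B t)"
    and "trace B \<ge> 0"
    and "u \<in> schwartz"
    and "\<And>X t z. z > 0 \<Longrightarrow>
      U ((X, t), z) =
        (LBINT \<tau>:{0<..}. LINT Y|lborel. poisson_kernel a Q B z X Y \<tau> * u (Y, t - \<tau>))"
  shows "smooth_on (UNIV \<times> {0<..}) U \<and>
    (\<forall>X t z. z > 0 \<longrightarrow> ext_op a Q B U ((X, t), z) = 0) \<and>
    (\<forall>p\<ge>1. ((\<lambda>z. Lp_norm p (\<lambda>x. U (x, z) - u x)) \<longlongrightarrow> 0) (at_right 0)) \<and>
    (\<forall>p\<ge>1. \<exists>L. Lp_tendsto p (\<lambda>z x. z powr a * deriv (\<lambda>\<zeta>. U (x, \<zeta>)) z) L (at_right 0) \<and>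
      (AE x in lborel.
        - (2 powr (- a) * Gamma ((1 - a) / 2) / Gamma ((1 + a) / 2)) * L x = frac_power s Q B u x))"
proof -
  interpret kolmogorov Q B by unfold_locales (fact assms)+
  note s = \<open>0 < s\<close> \<open>s < 1\<close> and u = \<open>u \<in> schwartz\<close> and a = \<open>a = 1 - 2 * s\<close>
  have Us: "U (x, z) = (LBINT \<tau>:{0<..}. ext_const s * weight (2 * s) (1 + s) \<tau> z * evol_semigroup Q B \<tau> u x)"
    if "0 < z" for x z
  proof -
    obtain X t where x: "x = (X, t)" by (cases x)
    show ?thesis unfolding x assms(9)[OF that] a by (rule extension_eq_semigroup[OF that])
  qed
  define \<kappa> where "\<kappa> = ext_const s / (2 * pi) ^ CARD('n)"
  have s1: "0 \<le> 1 + s" using s by simp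
  have Uw: "U ((X, t), z) = Re (of_real \<kappa> * wave (2 * s) (1 + s) [] u ((X, t), z))" if "0 < z" for X t z
    unfolding Us[OF that] \<kappa>_def by (rule semigroup_eq_wave[OF u that s1])
  have "smooth_on (UNIV \<times> {0<..}) U"
  proof (rule smooth_on_waves[OF waves.wave[OF u _ s1]])
    show "U Z = Re (of_real \<kappa> * wave (2 * s) (1 + s) [] u Z)" if "0 < snd Z" for Z
      using Uw[of "snd Z" "fst (fst Z)" "snd (fst Z)"] that by simp
  qed simp
  moreover have "ext_op a Q B U ((X, t), z) = 0" if "0 < z" for X t z
    unfolding a by (rule extension_equation[OF u that s(1) Uw])
  moreover have "((\<lambda>z. Lp_norm p (\<lambda>x. U (x, z) - u x)) \<longlongrightarrow> 0) (at_right 0)" if "1 \<le> p" for p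
    by (rule extension_Lp_limit[OF u s that Us])
  moreover have "\<exists>L. Lp_tendsto p (\<lambda>z x. z powr a * deriv (\<lambda>\<zeta>. U (x, \<zeta>)) z) L (at_right 0) \<and>
      (AE x in lborel. - (2 powr (- a) * Gamma ((1 - a) / 2) / Gamma ((1 + a) / 2)) * L x = frac_power s Q B u x)"
    if "1 \<le> p" for p
  \<comment> \<open>The limit is an explicit integral, so the identity with the fractional power
    holds at every point.\<close>
  proof (intro exI conjI AE_I2)
    show "Lp_tendsto p (\<lambda>z x. z powr a * deriv (\<lambda>\<zeta>. U (x, \<zeta>)) z)
      (\<lambda>x. 2 * s * ext_const s * (LBINT \<tau>:{0<..}. \<tau> powr (- 1 - s) * (evol_semigroup Q B \<tau> u x - u x))) (at_right 0)"
      unfolding a by (rule extension_Neumann_limit[OF u s that Us])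
    fix x
    have G: "Gamma s \<noteq> 0" using Gamma_real_pos[OF s(1)] by linarith
    \<comment> \<open>The powers of 2 and \<open>Gamma s\<close> cancel against
      \<open>2 * s * ext_const s\<close>, which leaves \<open>- s / Gamma (1 - s)\<close>.\<close>
    have 1: "(1 - a) / 2 = s" "(1 + a) / 2 = 1 - s" "2 powr (- a) = 2 powr (2 * s) / 2"
      using powr_diff[of 2 "2 * s" 1] by (auto simp: a field_simps)
    show "- (2 powr (- a) * Gamma ((1 - a) / 2) / Gamma ((1 + a) / 2)) *
      (2 * s * ext_const s * (LBINT \<tau>:{0<..}. \<tau> powr (- 1 - s) * (evol_semigroup Q B \<tau> u x - u x))) = frac_power s Q B u x"
      unfolding 1 frac_power_def ext_const_def using G by simp
  qed
  ultimately show ?thesis by blast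
qed

end
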